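(* Let $A$ and $B$ be commuting self-adjoint operators on a Hilbert space $\mathcal{H}$. Let $\alpha,\beta,\gamma\in\mathbb{C}$, and suppose that $\alpha\in\rho(A)$ and $\beta\in\rho(B)$. Then the following statements are equivalent: (i) $A$ and $B$ commute strongly. (ii) $\mathcal{D}\big((A-\alpha I)(B-\beta I)\big)=\mathcal{D}\big((B-\beta I)(A-\alpha I)\big)$. (iii) $\mathcal{D}\big((A-\alpha I)(B-\beta I)\big)\subseteq\mathcal{D}\big((B-\beta I)(A-\alpha I)\big)$. (iv) $\mathcal{D}\big(\overline{(A-\gamma I)(B-\beta I)}\big)=\mathcal{D}\big((B-\beta I)(A-\gamma I)\big)$. (v) $\mathcal{D}\big((A-\gamma I)(B-\beta I)\big)\subseteq\mathcal{D}\big((B-\beta I)(A-\gamma I)\big)$.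
   Context: Operators are linear and possibly unbounded on a complex Hilbert space $\mathcal{H}$. $\mathcal{D}(T)$ denotes the domain of an operator $T$, $\rho(T)$ its resolvent set, and $\overline{T}$ its closure. For operators $T,S$ the product $TS$ has the domain $\mathcal{D}(TS)=\{x\in\mathcal{D}(S): Sx\in\mathcal{D}(T)\}$. Two self-adjoint operators $A$ and $B$ on $\mathcal{H}$ commute if there exists a dense linear subspace $\mathcal{D}\subseteq\mathcal{D}(AB)\cap\mathcal{D}(BA)$ of $\mathcal{H}$ such that $ABx=BAx$ for all $x\in\mathcal{D}$. They strongly commute (commute strongly) if their spectral measures $E_A$ and $E_B$ commute, that is, $E_A(M)E_B(N)=E_B(N)E_A(M)$ for all Borel subsets $M,N$ of $(-\infty,+\infty)$. *)

theory Defs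
  imports "HOL-Analysis.Analysis"
begin

section \<open>Complex Hilbert spaces\<close>

text \<open>
  The inner product is linear in its first argument. The last assumption ties the complex
  structure to the real inner product, hence to the norm and the topology, of the type;
  applied to scalar multiples it determines the complex inner product completely.
\<close>

class complex_hilbert = real_inner + complete_space +
  fixes scaleC :: "complex \<Rightarrow> 'a \<Rightarrow> 'a"  (infixr \<open>*\<^sub>C\<close> 75)
    and cinner :: "'a \<Rightarrow> 'a \<Rightarrow> complex"
  assumes scaleC_add_right: "c *\<^sub>C (x + y) = c *\<^sub>C x + c *\<^sub>C y"
    and scaleC_add_left: "(c + d) *\<^sub>C x = c *\<^sub>C x + d *\<^sub>C x"
    and scaleC_scaleC: "c *\<^sub>C d *\<^sub>C x = (c * d) *\<^sub>C x"
    and scaleC_one: "1 *\<^sub>C x = x"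
    and scaleC_of_real: "complex_of_real r *\<^sub>C x = r *\<^sub>R x"
    and cinner_add_left: "cinner (x + y) z = cinner x z + cinner y z"
    and cinner_scaleC_left: "cinner (c *\<^sub>C x) y = c * cinner x y"
    and cinner_commute: "cinner x y = cnj (cinner y x)"
    and inner_eq_Re_cinner: "inner x y = Re (cinner x y)"

global_interpretation complex_vector: vector_space "scaleC :: complex \<Rightarrow> 'a \<Rightarrow> 'a::complex_hilbert"
  by unfold_locales (simp_all add: scaleC_add_right scaleC_add_left scaleC_scaleC scaleC_one)

instantiation complex :: complex_hilbert
begin

definition scaleC_complex :: "complex \<Rightarrow> complex \<Rightarrow> complex"
  where "scaleC_complex c x = c * x"

definition cinner_complex :: "complex \<Rightarrow> complex \<Rightarrow> complex"
  where "cinner_complex x y = x * cnj y"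

instance
  by standard
    (simp_all add: scaleC_complex_def cinner_complex_def algebra_simps inner_complex_def
      scaleR_conv_of_real)

end


section \<open>Unbounded operators\<close>

text \<open>
  An operator is a partial map satisfying \<open>lin_op\<close>; its domain is the library's \<open>dom\<close>.
  The product of operators is the library's composition \<open>T \<circ>\<^sub>m S\<close> of partial maps,
  which is defined at exactly those \<open>x \<in> dom S\<close> for which the value of \<open>S\<close> at \<open>x\<close> lies
  in \<open>dom T\<close>. Equality of partial maps is equality of operators, domains included.
\<close>

type_synonym 'h operator = "'h \<rightharpoonup> 'h"

definition lin_op :: "'h::complex_hilbert operator \<Rightarrow> bool"
  where "lin_op T \<longleftrightarrow>
    complex_vector.subspace (dom T) \<and>
    (\<forall>x\<in>dom T. \<forall>y\<in>dom T. the (T (x + y)) = the (T x) + the (T y)) \<and>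
    (\<forall>c. \<forall>x\<in>dom T. the (T (c *\<^sub>C x)) = c *\<^sub>C the (T x))"

definition densely_defined :: "'h::complex_hilbert operator \<Rightarrow> bool"
  where "densely_defined T \<longleftrightarrow> closure (dom T) = UNIV"

text \<open>The operator \<open>T - \<mu>I\<close>, with the domain of \<open>T\<close>.\<close>

definition op_shift :: "'h::complex_hilbert operator \<Rightarrow> complex \<Rightarrow> 'h operator"  (infixl \<open>-\<^sub>I\<close> 65)
  where "T -\<^sub>I \<mu> = (\<lambda>x. map_option (\<lambda>y. y - \<mu> *\<^sub>C x) (T x))"

text \<open>The vector \<open>z\<close> is unique when \<open>T\<close> is densely defined, the only case in which the adjoint is used.\<close>

definition op_adjoint :: "'h::complex_hilbert operator \<Rightarrow> 'h operator"
  where "op_adjoint T = (\<lambda>y.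
    if \<exists>z. \<forall>x\<in>dom T. cinner (the (T x)) y = cinner x z
    then Some (THE z. \<forall>x\<in>dom T. cinner (the (T x)) y = cinner x z)
    else None)"

definition self_adjoint :: "'h::complex_hilbert operator \<Rightarrow> bool"
  where "self_adjoint T \<longleftrightarrow> lin_op T \<and> densely_defined T \<and> op_adjoint T = T"

definition resolvent_set :: "'h::complex_hilbert operator \<Rightarrow> complex set"
  where "resolvent_set T = {\<mu>.
    bij_betw (\<lambda>x. the ((T -\<^sub>I \<mu>) x)) (dom T) UNIV \<and>
    (\<exists>C. \<forall>x\<in>dom T. norm x \<le> C * norm (the ((T -\<^sub>I \<mu>) x)))}"

text \<open>The closure is meaningful for closable operators, those for which such an \<open>S\<close> exists.\<close>

definition op_closure :: "'h::complex_hilbert operator \<Rightarrow> 'h operator"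
  where "op_closure T = (THE S. Map.graph S = closure (Map.graph T))"

lemma graph_op_closure:
  assumes "single_valued (closure (Map.graph T))"
  shows "Map.graph (op_closure T) = closure (Map.graph T)"
proof -
  let ?G = "closure (Map.graph T)"
  let ?S = "\<lambda>x. if x \<in> Domain ?G then Some (THE y. (x, y) \<in> ?G) else None"
  have the_eq: "(THE y. (x, y) \<in> ?G) = y" if "(x, y) \<in> ?G" for x y
    using that assms by (auto simp: single_valued_def)
  have mem: "(x, y) \<in> Map.graph R \<longleftrightarrow> R x = Some y" for R :: "'a operator" and x y
    by (auto simp: Map.graph_def)
  have S: "Map.graph ?S = ?G"
    unfolding set_eq_iff split_paired_All mem using the_eq by (auto split: if_splits)
  have inj: "R = S" if eq: "Map.graph R = Map.graph S" for R S :: "'a operator"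
  proof
    fix x
    have "R x = Some y \<longleftrightarrow> S x = Some y" for y
      using eq by (simp flip: mem)
    then show "R x = S x"
      by (metis option.exhaust)
  qed
  show ?thesis
    unfolding op_closure_def by (rule theI[of _ ?S], rule S, rule inj, simp only: S)
qed


section \<open>Spectral measures\<close>

definition orth_projection :: "('h::complex_hilbert \<Rightarrow> 'h) \<Rightarrow> bool"
  where "orth_projection P \<longleftrightarrow>
    Vector_Spaces.linear scaleC scaleC P \<and> P \<circ> P = P \<and>
    (\<forall>x y. cinner (P x) y = cinner x (P y))"

text \<open>Only the values on Borel sets matter.\<close>

definition projection_valued_measure :: "(real set \<Rightarrow> 'h::complex_hilbert \<Rightarrow> 'h) \<Rightarrow> bool"
  where "projection_valued_measure E \<longleftrightarrow>
    (\<forall>M\<in>sets borel. orth_projection (E M)) \<and>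
    E UNIV = id \<and>
    (\<forall>M :: nat \<Rightarrow> real set. range M \<subseteq> sets borel \<longrightarrow> disjoint_family M \<longrightarrow>
      (\<forall>x. (\<lambda>n. E (M n) x) sums E (\<Union>n. M n) x))"

text \<open>The scalar measure sending \<open>M\<close> to the inner product of \<open>E M x\<close> with \<open>x\<close>.\<close>

definition scalar_measure :: "(real set \<Rightarrow> 'h::complex_hilbert \<Rightarrow> 'h) \<Rightarrow> 'h \<Rightarrow> real measure"
  where "scalar_measure E x =
    measure_of UNIV (sets borel) (\<lambda>M. ennreal (Re (cinner (E M x) x)))"

lemma sets_scalar_measure [simp]: "sets (scalar_measure E x) = sets borel"
  unfolding scalar_measure_def
  by (metis sets.sets_measure_of_eq space_borel)

lemma emeasure_scalar_measure:
  assumes E: "projection_valued_measure E" and M: "M \<in> sets borel"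
  shows "emeasure (scalar_measure E x) M = ennreal (Re (cinner (E M x) x))"
proof -
  have nn: "0 \<le> Re (cinner (E N x) x)" if "N \<in> sets borel" for N
  proof -
    have P: "orth_projection (E N)"
      using E that by (simp add: projection_valued_measure_def)
    have "cinner (E N x) x = cinner (E N (E N x)) x"
      using P unfolding orth_projection_def by (metis comp_apply)
    also have "\<dots> = cinner (E N x) (E N x)"
      using P by (simp add: orth_projection_def)
    finally show ?thesis
      using inner_ge_zero[of "E N x"] by (simp add: inner_eq_Re_cinner)
  qed
  have sums: "(\<lambda>n. Re (cinner (E (N n) x) x)) sums Re (cinner (E (\<Union>n. N n) x) x)"
    if "range N \<subseteq> sets borel" "disjoint_family N" for N :: "nat \<Rightarrow> real set"
  proof -
    have "(\<lambda>n. E (N n) x) sums E (\<Union>n. N n) x"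
      using E that by (simp add: projection_valued_measure_def)
    from bounded_linear.sums[OF bounded_linear_inner_left[of x] this] show ?thesis
      by (simp add: inner_eq_Re_cinner)
  qed
  show ?thesis
    unfolding scalar_measure_def
  proof (rule emeasure_measure_of_sigma)
    show "sigma_algebra UNIV (sets (borel :: real measure))"
      using sets.sigma_algebra_axioms[of "borel :: real measure"] by simp
    have "E {} x = 0"
    proof -
      have "(\<lambda>n::nat. E {} x) sums E (\<Union>n::nat. {}) x"
        using E unfolding projection_valued_measure_def
        by (elim conjE allE[of _ "\<lambda>_. {}"]) (auto simp: disjoint_family_on_def)
      then have "summable (\<lambda>n::nat. E {} x)"
        by (rule sums_summable)
      then have "(\<lambda>n::nat. E {} x) \<longlonglongrightarrow> 0"
        by (rule summable_LIMSEQ_zero)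
      then show ?thesis
        by (simp add: LIMSEQ_const_iff)
    qed
    moreover have "cinner 0 x = 0"
      using cinner_add_left[of 0 0 x] by simp
    ultimately show "positive (sets borel) (\<lambda>M. ennreal (Re (cinner (E M x) x)))"
      by (simp add: positive_def)
    show "countably_additive (sets borel) (\<lambda>M. ennreal (Re (cinner (E M x) x)))"
    proof (rule countably_additiveI)
      fix N :: "nat \<Rightarrow> real set"
      assume N: "range N \<subseteq> sets borel" "disjoint_family N"
      have "(\<Sum>n. ennreal (Re (cinner (E (N n) x) x))) = ennreal (\<Sum>n. Re (cinner (E (N n) x) x))"
        using N nn sums_summable[OF sums[OF N]] by (intro suminf_ennreal2) auto
      also have "(\<Sum>n. Re (cinner (E (N n) x) x)) = Re (cinner (E (\<Union>n. N n) x) x)"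
        using sums[OF N] by (rule sums_unique[symmetric])
      finally show "(\<Sum>n. ennreal (Re (cinner (E (N n) x) x))) =
          ennreal (Re (cinner (E (\<Union>n. N n) x) x))" .
    qed
  qed (rule M)
qed

text \<open>
  This says that \<open>A\<close> is the spectral integral of the identity function of the real line
  with respect to \<open>E\<close>. On a complex space the diagonal values \<open>cinner (A x) x\<close> determine
  \<open>A\<close> on its domain by polarization.
\<close>

definition is_spectral_measure_of ::
    "(real set \<Rightarrow> 'h::complex_hilbert \<Rightarrow> 'h) \<Rightarrow> 'h operator \<Rightarrow> bool"
  where "is_spectral_measure_of E A \<longleftrightarrow>
    projection_valued_measure E \<and>
    dom A = {x. integrable (scalar_measure E x) (\<lambda>t. t\<^sup>2)} \<and>
    (\<forall>x\<in>dom A. cinner (the (A x)) x = complex_of_real (\<integral>t. t \<partial>scalar_measure E x))"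

text \<open>
  By the spectral theorem a self-adjoint operator has a spectral measure, and its values on
  Borel sets are unique, so the choice operator selects nothing of substance.
\<close>

definition spectral_measure :: "'h::complex_hilbert operator \<Rightarrow> real set \<Rightarrow> 'h \<Rightarrow> 'h"
  where "spectral_measure A = (SOME E. is_spectral_measure_of E A)"


section \<open>Commutation\<close>

definition ops_commute :: "'h::complex_hilbert operator \<Rightarrow> 'h operator \<Rightarrow> bool"
  where "ops_commute A B \<longleftrightarrow>
    (\<exists>D. complex_vector.subspace D \<and> closure D = UNIV \<and>
      D \<subseteq> dom (A \<circ>\<^sub>m B) \<inter> dom (B \<circ>\<^sub>m A) \<and>
      (\<forall>x\<in>D. (A \<circ>\<^sub>m B) x = (B \<circ>\<^sub>m A) x))"

definition strongly_commute :: "'h::complex_hilbert operator \<Rightarrow> 'h operator \<Rightarrow> bool"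
  where "strongly_commute A B \<longleftrightarrow>
    (\<forall>M\<in>sets borel. \<forall>N\<in>sets borel.
      spectral_measure A M \<circ> spectral_measure B N = spectral_measure B N \<circ> spectral_measure A M)"

end

theory Submission
  imports Defs "HOL-Probability.Helly_Selection"
begin

text \<open>
  Let \<open>S = (B - \<beta>)\<^sup>-\<^sup>1\<close>, and say that \<open>S\<close> commutes with \<open>A\<close> when \<open>S\<close> maps the domain of \<open>A\<close>
  into itself and \<open>A S = S A\<close> there. All five statements are equivalent to this one.

  The four domain statements are elementary. Since \<open>A B\<close> and \<open>B A\<close> agree on a dense set, symmetry
  makes them agree wherever both are defined (\<open>products_agree\<close>). If the domain of
  \<open>(A - \<gamma>)(B - \<beta>)\<close> lies in that of \<open>(B - \<beta>)(A - \<gamma>)\<close>, then evaluating both at \<open>S y\<close> for \<open>y\<close> in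
  the domain of \<open>A\<close> shows that \<open>S\<close> commutes with \<open>A\<close> (\<open>product_domains_subset_iff\<close>). The
  argument is the same for every \<open>\<gamma>\<close>. With the resolvent \<open>(A - \<alpha>)\<^sup>-\<^sup>1\<close> in place of \<open>S\<close> it gives the
  reverse inclusion, hence the equality of the domains (\<open>product_domains_eq\<close>). For the statement about the closure, the
  product \<open>(B - \<beta>)(A - \<gamma>)\<close> is closed because \<open>S\<close> is bounded, and bounded approximations of the
  identity built from resolvents of \<open>B\<close> show that it is no larger than the closure of the other
  product (\<open>closure_product_domain\<close>).

  The link with strong commutation needs the spectral theorem, together with the uniqueness of
  spectral measures, since the spectral measure of an operator is defined by choice. The
  construction starts from the Cayley transform \<open>U = (A - \<i>)(A + \<i>)\<^sup>-\<^sup>1\<close>, a unitary operator. For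
  a unit vector \<open>x\<close> the Fejer means of the moments \<open>\<langle>U\<^sup>k x, x\<rangle>\<close> are nonnegative densities, and
  Helly's theorem yields a measure \<open>\<sigma>\<^sub>x\<close> on the circle with these moments
  (\<open>represents_unit\<close>). The map \<open>p \<mapsto> p(U) x\<close> on trigonometric polynomials is isometric for the
  \<open>L\<^sup>2\<close> norm of \<open>\<sigma>\<^sub>x\<close>. Hence polynomials converging to the indicator of an open set give
  operators converging strongly to a projection, and a Dynkin argument produces a projection for
  every Borel set (\<open>is_proj_exists\<close>). Transport to the real line by the inverse Cayley transform
  is a spectral measure of \<open>A\<close> (\<open>spectral_spectral_projection\<close>).

  Commutation is handled throughout by unitary operators \<open>W\<close>. A unitary operator commuting with
  \<open>U\<close> preserves the moments, so it commutes with the constructed projections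
  (\<open>proj_commutes\<close>); one commuting with some spectral measure of \<open>A\<close> preserves the scalar
  measures, so it commutes with \<open>A\<close> (\<open>commutes_op_unitary\<close>). Projections enter through the
  reflections \<open>2P - I\<close>, which are unitary. The first use is uniqueness: any spectral measure of
  \<open>A\<close> commutes with the constructed one, and two commuting spectral measures coincide by a
  comparison on half-lines (\<open>spectral_unique\<close>). The second is that \<open>A\<close> and \<open>B\<close> commute strongly
  exactly when their Cayley transforms commute (\<open>spectral_projections_commute_iff\<close>), and this in
  turn means that \<open>S\<close> commutes with \<open>A\<close>.
\<close>

section \<open>Complex Hilbert spaces\<close>

instance complex_hilbert \<subseteq> banach ..

abbreviation clinear :: "('h::complex_hilbert \<Rightarrow> 'h) \<Rightarrow> bool"
  where "clinear \<equiv> Vector_Spaces.linear scaleC scaleC"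

lemma clinearI:
  assumes "\<And>x y. f (x + y) = f x + f y" "\<And>c x. f (c *\<^sub>C x) = c *\<^sub>C f x"
  shows "clinear f"
  using assms by unfold_locales auto

lemma clinear_add: "clinear f \<Longrightarrow> f (x + y) = f x + f y"
  unfolding Vector_Spaces.linear_def module_hom_def module_hom_axioms_def by blast

lemma clinear_scale: "clinear f \<Longrightarrow> f (c *\<^sub>C x) = c *\<^sub>C f x"
  unfolding Vector_Spaces.linear_def module_hom_def module_hom_axioms_def by blast

lemma clinear_zero: "clinear f \<Longrightarrow> f 0 = 0"
  using clinear_add[of f 0 0] by simp

lemma clinear_diff: "clinear f \<Longrightarrow> f (x - y) = f x - f y"
  using clinear_add[of f "x - y" y] by simp

lemma cinner_add_right: "cinner x (y + z) = cinner x y + cinner x z"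
  by (metis cinner_add_left cinner_commute complex_cnj_add)

lemma cinner_scaleC_right: "cinner x (c *\<^sub>C y) = cnj c * cinner x y"
  by (metis cinner_scaleC_left cinner_commute complex_cnj_mult complex_cnj_cnj)

lemma cinner_self: "cinner x x = complex_of_real ((norm x)\<^sup>2)"
proof -
  have "Im (cinner x x) = 0"
    using cinner_commute[of x x] by (metis cnj.simps(2) neg_equal_zero)
  moreover have "Re (cinner x x) = (norm x)\<^sup>2"
    by (simp flip: inner_eq_Re_cinner add: power2_norm_eq_inner)
  ultimately show ?thesis
    by (simp add: complex_eq_iff)
qed

lemma cinner_self_eq_0 [simp]: "cinner x x = 0 \<longleftrightarrow> x = 0"
  by (simp add: cinner_self)

lemma norm_scaleC: "norm (c *\<^sub>C x) = cmod c * norm x"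
proof -
  have "complex_of_real ((norm (c *\<^sub>C x))\<^sup>2) = cnj c * (c * complex_of_real ((norm x)\<^sup>2))"
    by (simp only: cinner_self[symmetric] cinner_scaleC_left cinner_scaleC_right)
  also have "\<dots> = complex_of_real ((cmod c * norm x)\<^sup>2)"
    by (simp add: power_mult_distrib complex_norm_square algebra_simps del: of_real_power)
  finally have "(norm (c *\<^sub>C x))\<^sup>2 = (cmod c * norm x)\<^sup>2"
    by (simp only: of_real_eq_iff)
  then show ?thesis
    by (simp add: power2_eq_iff_nonneg)
qed

lemma scaleR_conv_scaleC: "r *\<^sub>R x = complex_of_real r *\<^sub>C x"
  by (simp add: scaleC_of_real)

lemma norm_cinner_le: "cmod (cinner x y) \<le> norm x * norm y"
proof (cases "cinner x y = 0")
  case False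
  \<comment> \<open>Rotating \<open>x\<close> by a phase makes the inner product real, where the real inequality applies.\<close>
  define c where "c = cnj (sgn (cinner x y))"
  have "cmod (cinner x y) = Re (cinner (c *\<^sub>C x) y)"
  proof -
    have "c * cinner x y = complex_of_real ((cmod (cinner x y))\<^sup>2 / cmod (cinner x y))"
      unfolding c_def sgn_eq by (simp add: complex_norm_square mult.commute del: of_real_power)
    then show ?thesis
      by (simp add: cinner_scaleC_left power2_eq_square)
  qed
  also have "\<dots> \<le> norm (c *\<^sub>C x) * norm y"
    by (metis inner_eq_Re_cinner norm_cauchy_schwarz)
  also have "\<dots> = norm x * norm y"
    using False by (simp add: norm_scaleC c_def norm_sgn)
  finally show ?thesis .
qed simp

lemma bounded_bilinear_cinner: "bounded_bilinear (cinner :: 'h::complex_hilbert \<Rightarrow> 'h \<Rightarrow> complex)"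
proof
  show "\<exists>K. \<forall>a b :: 'h. cmod (cinner a b) \<le> norm a * norm b * K"
    by (intro exI[of _ 1] allI) (simp add: norm_cinner_le)
  fix r and x y :: 'h
  show "cinner (r *\<^sub>R x) y = r *\<^sub>R cinner x y" "cinner x (r *\<^sub>R y) = r *\<^sub>R cinner x y"
    by (simp_all add: scaleR_conv_of_real cinner_scaleC_left cinner_scaleC_right
        flip: scaleC_of_real[where 'a = 'h])
qed (simp_all add: cinner_add_left cinner_add_right)

lemma bounded_bilinear_scaleC: "bounded_bilinear (scaleC :: complex \<Rightarrow> 'h::complex_hilbert \<Rightarrow> 'h)"
proof
  show "\<exists>K. \<forall>a (b :: 'h). norm (a *\<^sub>C b) \<le> cmod a * norm b * K"
    by (intro exI[of _ 1]) (simp add: norm_scaleC)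
  fix r c and x :: 'h
  show "(r *\<^sub>R c) *\<^sub>C x = r *\<^sub>R c *\<^sub>C x" "c *\<^sub>C r *\<^sub>R x = r *\<^sub>R c *\<^sub>C x"
    by (simp_all add: scaleR_conv_of_real[of r c] scaleC_scaleC mult.commute
        flip: scaleC_of_real[where 'a = 'h])
qed (simp_all add: scaleC_add_left scaleC_add_right)

lemmas tendsto_cinner [tendsto_intros] = bounded_bilinear.tendsto[OF bounded_bilinear_cinner]
lemmas tendsto_scaleC [tendsto_intros] = bounded_bilinear.tendsto[OF bounded_bilinear_scaleC]
lemmas cinner_zero_left [simp] = bounded_bilinear.zero_left[OF bounded_bilinear_cinner]
lemmas cinner_zero_right [simp] = bounded_bilinear.zero_right[OF bounded_bilinear_cinner]
lemmas cinner_diff_left = bounded_bilinear.diff_left[OF bounded_bilinear_cinner]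
lemmas cinner_diff_right = bounded_bilinear.diff_right[OF bounded_bilinear_cinner]
lemmas cinner_sum_left = bounded_bilinear.sum_left[OF bounded_bilinear_cinner]
lemmas cinner_sum_right = bounded_bilinear.sum_right[OF bounded_bilinear_cinner]
lemmas scaleC_diff_right = bounded_bilinear.diff_right[OF bounded_bilinear_scaleC]
lemmas scaleC_minus_left = bounded_bilinear.minus_left[OF bounded_bilinear_scaleC]
lemmas cinner_simps = cinner_add_left cinner_add_right cinner_diff_left cinner_diff_right
  cinner_scaleC_left cinner_scaleC_right

lemmas subspace_add = complex_vector.subspace_add
lemmas subspace_scale = complex_vector.subspace_scale
lemmas subspace_diff = complex_vector.subspace_diff

text \<open>
  Over the complex numbers a sesquilinear form is determined by its diagonal: replacing \<open>y\<close>
  by \<open>\<i>y\<close> changes the relative sign of the two mixed terms.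
\<close>

lemma sesquilinear_form_zero:
  fixes q :: "'h::complex_hilbert \<Rightarrow> 'h \<Rightarrow> complex"
  assumes S: "complex_vector.subspace S"
    and add_l: "\<And>x y z. x \<in> S \<Longrightarrow> y \<in> S \<Longrightarrow> z \<in> S \<Longrightarrow> q (x + y) z = q x z + q y z"
    and add_r: "\<And>x y z. x \<in> S \<Longrightarrow> y \<in> S \<Longrightarrow> z \<in> S \<Longrightarrow> q x (y + z) = q x y + q x z"
    and scale_l: "\<And>c x y. x \<in> S \<Longrightarrow> y \<in> S \<Longrightarrow> q (c *\<^sub>C x) y = c * q x y"
    and scale_r: "\<And>c x y. x \<in> S \<Longrightarrow> y \<in> S \<Longrightarrow> q x (c *\<^sub>C y) = cnj c * q x y"
    and diag: "\<And>x. x \<in> S \<Longrightarrow> q x x = 0"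
    and xy: "x \<in> S" "y \<in> S"
  shows "q x y = 0"
proof -
  have sum0: "q x y + q y x = 0" if "x \<in> S" "y \<in> S" for x y
    using diag[of "x + y"] diag[of x] diag[of y] that S
    by (simp add: add_l add_r subspace_add add.commute)
  have "q x y + q y x = 0" "- \<i> * q x y + \<i> * q y x = 0"
    using sum0[OF xy] sum0[of x "\<i> *\<^sub>C y"] xy S by (simp_all add: scale_l scale_r subspace_scale)
  then show ?thesis
    by (auto simp: complex_eq_iff)
qed

lemma cinner_ext:
  assumes "\<And>y. cinner x y = cinner x' y" shows "x = x'"
  using assms[of "x - x'"] cinner_self_eq_0[of "x - x'"] by (simp add: cinner_diff_left)

lemma clinear_eqI:
  assumes F: "clinear F" and G: "clinear G" and eq: "\<And>x. cinner (F x) x = cinner (G x) x"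
  shows "F = G"
proof
  fix x
  have "cinner (F x) y - cinner (G x) y = 0" for y
    by (rule sesquilinear_form_zero[where S = UNIV and q = "\<lambda>x y. cinner (F x) y - cinner (G x) y"])
      (simp_all add: eq clinear_add[OF F] clinear_add[OF G] clinear_scale[OF F]
        clinear_scale[OF G] cinner_simps algebra_simps)
  then show "F x = G x"
    by (intro cinner_ext[of "F x"]) simp
qed

lemma clinear_isometry_cinner:
  assumes F: "clinear F" and iso: "\<And>x. norm (F x) = norm x"
  shows "cinner (F x) (F y) = cinner x y"
proof -
  have "cinner (F x) (F y) - cinner x y = 0"
    by (rule sesquilinear_form_zero[where S = UNIV and q = "\<lambda>x y. cinner (F x) (F y) - cinner x y"])
      (simp_all add: iso cinner_self clinear_add[OF F] clinear_scale[OF F] cinner_simps algebra_simps)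
  then show ?thesis
    by simp
qed

lemma dense_orthogonal_imp_zero:
  assumes D: "closure D = UNIV" and z: "\<And>x. x \<in> D \<Longrightarrow> cinner x z = 0"
  shows "z = 0"
proof -
  obtain f where f: "\<And>n. f n \<in> D" "f \<longlonglongrightarrow> z"
    using D by (metis UNIV_I closure_sequential)
  have "(\<lambda>n. cinner (f n) z) \<longlonglongrightarrow> cinner z z"
    by (intro tendsto_intros f)
  then have "cinner z z = 0"
    using z f by (simp add: LIMSEQ_const_iff)
  then show ?thesis
    by simp
qed

text \<open>
  A sequence in \<open>S\<close> minimizing the distance to a point \<open>v\<close> is Cauchy by the parallelogram law,
  and the difference between \<open>v\<close> and its limit is orthogonal to \<open>S\<close>.
\<close>

lemma closed_subspace_orthogonal:
  fixes S :: "'h::complex_hilbert set"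
  assumes S: "complex_vector.subspace S" and cl: "closed S" and v: "v \<notin> S"
  shows "\<exists>w. w \<noteq> 0 \<and> (\<forall>s\<in>S. cinner s w = 0)"
proof -
  define d where "d = infdist v S"
  have ne: "S \<noteq> {}"
    using complex_vector.subspace_0[OF S] by auto
  have d_le: "d \<le> norm (v - s)" if "s \<in> S" for s
    using infdist_le[OF that, of v] by (simp add: d_def dist_norm)
  have d0: "0 \<le> d"
    by (simp add: d_def infdist_nonneg)
  have half: "(1/2::real) *\<^sub>R (x + y) \<in> S" if "x \<in> S" "y \<in> S" for x y
    unfolding scaleR_conv_scaleC using that S by (intro subspace_scale subspace_add)
  have "\<exists>s\<in>S. norm (v - s) < d + 1 / Suc n" for n
  proof (rule ccontr)
    assume "\<not> ?thesis"
    then have "d + 1 / Suc n \<le> infdist v S"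
      using ne by (subst infdist_notempty) (auto simp: dist_norm not_less intro!: cINF_greatest)
    then show False
      by (simp add: d_def)
  qed
  then obtain s where s: "\<And>n. s n \<in> S" "\<And>n. norm (v - s n) < d + 1 / Suc n"
    by metis
  have close: "(norm (s m - s n))\<^sup>2 \<le> (8 * d + 8) * (1 / Suc N)" if "N \<le> m" "N \<le> n" for m n N
  proof -
    let ?e = "1 / real (Suc N)"
    have e: "0 \<le> ?e" "?e \<le> 1"
      by auto
    have *: "(norm (v - s k))\<^sup>2 \<le> d\<^sup>2 + (2 * d + 1) * ?e" if "N \<le> k" for k
    proof -
      have "1 / real (Suc k) \<le> ?e"
        using that by (simp add: frac_le)
      then have "norm (v - s k) \<le> d + ?e"
        using s(2)[of k] by linarith
      then have "(norm (v - s k))\<^sup>2 \<le> (d + ?e)\<^sup>2"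
        by (intro power_mono) auto
      also have "\<dots> = d\<^sup>2 + 2 * d * ?e + ?e * ?e"
        by (simp only: power2_sum) (simp only: power2_eq_square)
      also have "\<dots> \<le> d\<^sup>2 + 2 * d * ?e + 1 * ?e"
        using e by (intro add_left_mono mult_right_mono)
      finally show ?thesis
        by (simp only: algebra_simps)
    qed
    have "(norm (s m - s n))\<^sup>2 = 2 * (norm (v - s m))\<^sup>2 + 2 * (norm (v - s n))\<^sup>2
        - 4 * (norm (v - (1/2) *\<^sub>R (s m + s n)))\<^sup>2"
      unfolding power2_norm_eq_inner by (simp add: algebra_simps inner_commute)
    moreover have "d\<^sup>2 \<le> (norm (v - (1/2) *\<^sub>R (s m + s n)))\<^sup>2"
      using d0 by (intro power_mono d_le half s)
    moreover have "(8 * d + 8) * ?e = 4 * ((2 * d + 1) * ?e) + 4 * ?e"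
      by (simp only: algebra_simps)
    ultimately show ?thesis
      using *[OF that(1)] *[OF that(2)] e by linarith
  qed
  have "Cauchy s"
  proof (rule metric_CauchyI)
    fix e :: real assume e: "0 < e"
    obtain N where N: "(8 * d + 8) / e\<^sup>2 < real N"
      using reals_Archimedean2 by blast
    have "(8 * d + 8) * (1 / Suc N) < e\<^sup>2"
    proof -
      have "8 * d + 8 < e\<^sup>2 * real N"
        using N e by (simp add: pos_divide_less_eq mult.commute)
      also have "\<dots> \<le> e\<^sup>2 * real (Suc N)"
        by (intro mult_left_mono) auto
      finally show ?thesis
        by (simp add: pos_divide_less_eq)
    qed
    then have "(norm (s m - s n))\<^sup>2 < e\<^sup>2" if "N \<le> m" "N \<le> n" for m n
      using close[OF that] by linarith
    then have "dist (s m) (s n) < e" if "N \<le> m" "N \<le> n" for m n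
      using that e unfolding dist_norm by (metis less_imp_le power_less_imp_less_base)
    then show "\<exists>M. \<forall>m\<ge>M. \<forall>n\<ge>M. dist (s m) (s n) < e"
      by blast
  qed
  then obtain p where p: "s \<longlonglongrightarrow> p"
    using Cauchy_convergent convergent_def by blast
  have pS: "p \<in> S"
    using cl s(1) p closed_sequentially by blast
  have "(\<lambda>n. d + 1 / real (Suc n)) \<longlonglongrightarrow> d + 0"
    by (intro tendsto_intros LIMSEQ_Suc lim_1_over_n)
  moreover have "(\<lambda>n. norm (v - s n)) \<longlonglongrightarrow> norm (v - p)"
    by (intro tendsto_intros p)
  ultimately have np: "norm (v - p) \<le> d"
    using s(2) by (intro LIMSEQ_le[of "\<lambda>n. norm (v - s n)" _ "\<lambda>n. d + 1 / real (Suc n)"])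
      (auto intro: less_imp_le)
  define w where "w = v - p"
  have "cinner x w = 0" if x: "x \<in> S" for x
  proof (cases "x = 0")
    case False
    define c where "c = cinner w x / cinner x x"
    have "p + c *\<^sub>C x \<in> S"
      using S pS x by (simp add: subspace_add subspace_scale)
    then have "(norm w)\<^sup>2 \<le> (norm (w - c *\<^sub>C x))\<^sup>2"
      using d_le[of "p + c *\<^sub>C x"] np unfolding w_def
      by (intro power_mono) (auto simp: algebra_simps)
    then have "Re (cinner w w) \<le> Re (cinner (w - c *\<^sub>C x) (w - c *\<^sub>C x))"
      by (simp add: cinner_self)
    moreover have "cinner (w - c *\<^sub>C x) (w - c *\<^sub>C x)
        = cinner w w - cnj (cinner w x) * cinner w x / cinner x x"
      using False cinner_commute[of x w] cinner_commute[of x x]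
      by (simp add: cinner_simps c_def field_simps)
    moreover have "cnj (cinner w x) * cinner w x / cinner x x
        = complex_of_real ((cmod (cinner w x))\<^sup>2 / (norm x)\<^sup>2)"
      by (simp add: cinner_self complex_norm_square mult.commute del: of_real_power)
    ultimately have "(cmod (cinner w x))\<^sup>2 / (norm x)\<^sup>2 \<le> 0"
      by simp
    then have "cinner w x = 0"
      using False by (simp add: divide_le_0_iff)
    then show ?thesis
      by (metis cinner_commute complex_cnj_zero)
  qed simp
  moreover have "w \<noteq> 0"
    using pS v by (auto simp: w_def)
  ultimately show ?thesis
    by blast
qed

section \<open>Self-adjoint operators\<close>

text \<open>
  The operator is encoded by its domain \<open>D\<close> and a total function, so that its values can be written
  without the option type. The last assumption says that the adjoint of this densely defined
  symmetric operator is not a proper extension.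
\<close>

locale selfadjoint =
  fixes D :: "'h::complex_hilbert set" and a :: "'h \<Rightarrow> 'h"
  assumes subspace: "complex_vector.subspace D"
    and add: "x \<in> D \<Longrightarrow> y \<in> D \<Longrightarrow> a (x + y) = a x + a y"
    and scale: "x \<in> D \<Longrightarrow> a (c *\<^sub>C x) = c *\<^sub>C a x"
    and dense: "closure D = UNIV"
    and symmetric: "x \<in> D \<Longrightarrow> y \<in> D \<Longrightarrow> cinner (a x) y = cinner x (a y)"
    and maximal: "(\<And>x. x \<in> D \<Longrightarrow> cinner (a x) y = cinner x z) \<Longrightarrow> y \<in> D \<and> a y = z"
begin

text \<open>As an inclusion of operators this reads \<open>T a \<subseteq> a T\<close>, for \<open>T\<close> defined everywhere.\<close>

definition commutes_op :: "('h \<Rightarrow> 'h) \<Rightarrow> bool"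
  where "commutes_op T \<longleftrightarrow> (\<forall>x\<in>D. T x \<in> D \<and> a (T x) = T (a x))"

definition is_resolvent :: "complex \<Rightarrow> ('h \<Rightarrow> 'h) \<Rightarrow> bool"
  where "is_resolvent \<mu> S \<longleftrightarrow>
    (\<forall>y. S y \<in> D \<and> a (S y) - \<mu> *\<^sub>C S y = y) \<and> (\<forall>x\<in>D. S (a x - \<mu> *\<^sub>C x) = x)"

lemma D_add: "x \<in> D \<Longrightarrow> y \<in> D \<Longrightarrow> x + y \<in> D"
  using subspace by (rule subspace_add)

lemma D_diff: "x \<in> D \<Longrightarrow> y \<in> D \<Longrightarrow> x - y \<in> D"
  using subspace by (rule subspace_diff)

lemma D_scale: "x \<in> D \<Longrightarrow> c *\<^sub>C x \<in> D"
  using subspace by (rule subspace_scale)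

lemma diff: "x \<in> D \<Longrightarrow> y \<in> D \<Longrightarrow> a (x - y) = a x - a y"
  using add[of "x - y" y] D_diff by (simp add: algebra_simps)

lemma closed_graph:
  assumes x: "\<And>n. x n \<in> D" "x \<longlonglongrightarrow> y" and ax: "(\<lambda>n. a (x n)) \<longlonglongrightarrow> z"
  shows "y \<in> D \<and> a y = z"
proof (rule maximal)
  fix v assume v: "v \<in> D"
  have "(\<lambda>n. cinner (a v) (x n)) \<longlonglongrightarrow> cinner (a v) y"
    by (intro tendsto_intros x)
  moreover have "(\<lambda>n. cinner (a v) (x n)) \<longlonglongrightarrow> cinner v z"
    unfolding symmetric[OF v x(1)] by (intro tendsto_intros ax)
  ultimately show "cinner (a v) y = cinner v z"
    by (rule LIMSEQ_unique)
qed

text \<open>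
  As \<open>\<langle>a x, x\<rangle>\<close> is real, the mixed terms cancel when \<open>\<mu>\<close> is imaginary.
\<close>

lemma norm_imaginary_shift:
  assumes x: "x \<in> D" and \<mu>: "Re \<mu> = 0"
  shows "(norm (a x - \<mu> *\<^sub>C x))\<^sup>2 = (norm (a x))\<^sup>2 + (cmod \<mu> * norm x)\<^sup>2"
proof -
  have c: "cnj \<mu> = - \<mu>"
    using \<mu> by (simp add: complex_eq_iff)
  have "complex_of_real ((norm (a x - \<mu> *\<^sub>C x))\<^sup>2)
      = cinner (a x) (a x) - \<mu> * cinner x (a x) - cnj \<mu> * cinner (a x) x + \<mu> * cnj \<mu> * cinner x x"
    by (simp only: cinner_self[symmetric] cinner_simps) (simp add: algebra_simps)
  also have "\<dots> = cinner (a x) (a x) + \<mu> * cnj \<mu> * cinner x x"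
    by (simp add: symmetric[OF x x] c)
  also have "\<dots> = complex_of_real ((norm (a x))\<^sup>2 + (cmod \<mu> * norm x)\<^sup>2)"
    by (simp add: cinner_self complex_norm_square[symmetric] power_mult_distrib)
  finally show ?thesis
    by (simp only: of_real_eq_iff)
qed

lemma imaginary_shift_bound:
  assumes "x \<in> D" "Re \<mu> = 0"
  shows "cmod \<mu> * norm x \<le> norm (a x - \<mu> *\<^sub>C x)" "norm (a x) \<le> norm (a x - \<mu> *\<^sub>C x)"
  by (rule power2_le_imp_le; simp add: norm_imaginary_shift[OF assms])+

text \<open>
  The lower bound for \<open>\<parallel>a x - \<mu> x\<parallel>\<close> makes the range closed. A vector orthogonal to the range would
  be an eigenvector of the adjoint, hence of \<open>a\<close>, for a non-real eigenvalue.
\<close>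

lemma imaginary_shift_surj:
  assumes \<mu>: "Re \<mu> = 0" "\<mu> \<noteq> 0"
  shows "\<exists>x\<in>D. a x - \<mu> *\<^sub>C x = y"
proof (rule ccontr)
  define S where "S = (\<lambda>x. a x - \<mu> *\<^sub>C x) ` D"
  assume "\<not> ?thesis"
  then have "y \<notin> S"
    by (auto simp: S_def)
  moreover have "complex_vector.subspace S"
  proof (rule complex_vector.subspaceI)
    have "a 0 = 0"
      using scale[of 0 0] complex_vector.subspace_0[OF subspace] by simp
    then show "0 \<in> S"
      unfolding S_def using complex_vector.subspace_0[OF subspace] by (intro image_eqI[of _ _ 0]) auto
  next
    fix u v assume "u \<in> S" "v \<in> S"
    then obtain x y where "x \<in> D" "y \<in> D" "u = a x - \<mu> *\<^sub>C x" "v = a y - \<mu> *\<^sub>C y"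
      by (auto simp: S_def)
    then show "u + v \<in> S"
      unfolding S_def by (intro image_eqI[of _ _ "x + y"]) (auto simp: add D_add scaleC_add_right)
  next
    fix c u assume "u \<in> S"
    then obtain x where "x \<in> D" "u = a x - \<mu> *\<^sub>C x"
      by (auto simp: S_def)
    then show "c *\<^sub>C u \<in> S"
      unfolding S_def by (intro image_eqI[of _ _ "c *\<^sub>C x"])
        (auto simp: scale D_scale scaleC_diff_right scaleC_scaleC mult.commute)
  qed
  moreover have "closed S"
    unfolding closed_sequential_limits
  proof (intro allI impI, elim conjE)
    fix u l assume u: "\<forall>n. u n \<in> S" and l: "u \<longlonglongrightarrow> l"
    then obtain x where x: "\<And>n. x n \<in> D" "\<And>n. u n = a (x n) - \<mu> *\<^sub>C x n"
      unfolding S_def image_iff by metis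
    have Cu: "Cauchy u"
      using l by (rule LIMSEQ_imp_Cauchy)
    have d: "a (x m - x n) - \<mu> *\<^sub>C (x m - x n) = u m - u n" for m n
      by (simp add: x diff scaleC_diff_right)
    have Cx: "Cauchy x"
    proof (rule metric_CauchyI)
      fix e :: real assume "0 < e"
      then have "0 < cmod \<mu> * e"
        using \<mu> by simp
      then obtain N where N: "\<And>m n. N \<le> m \<Longrightarrow> N \<le> n \<Longrightarrow> dist (u m) (u n) < cmod \<mu> * e"
        using metric_CauchyD[OF Cu] by metis
      have "dist (x m) (x n) < e" if "N \<le> m" "N \<le> n" for m n
      proof -
        have "cmod \<mu> * norm (x m - x n) < cmod \<mu> * e"
          using N[OF that] imaginary_shift_bound(1)[of "x m - x n", OF D_diff[OF x(1) x(1)] \<mu>(1)]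
          unfolding d dist_norm by linarith
        then show ?thesis
          using \<mu> by (simp add: dist_norm)
      qed
      then show "\<exists>M. \<forall>m\<ge>M. \<forall>n\<ge>M. dist (x m) (x n) < e"
        by blast
    qed
    then obtain p where p: "x \<longlonglongrightarrow> p"
      using Cauchy_convergent convergent_def by blast
    have "(\<lambda>n. u n + \<mu> *\<^sub>C x n) \<longlonglongrightarrow> l + \<mu> *\<^sub>C p"
      by (intro tendsto_intros l p)
    then have "(\<lambda>n. a (x n)) \<longlonglongrightarrow> l + \<mu> *\<^sub>C p"
      by (simp add: x(2))
    from closed_graph[OF x(1) p this] show "l \<in> S"
      unfolding S_def by (intro image_eqI[of _ _ p]) auto
  qed
  ultimately obtain w where w: "w \<noteq> 0" "\<And>s. s \<in> S \<Longrightarrow> cinner s w = 0"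
    using closed_subspace_orthogonal by blast
  have "w \<in> D \<and> a w = cnj \<mu> *\<^sub>C w"
  proof (rule maximal)
    fix x assume "x \<in> D"
    then have "cinner (a x - \<mu> *\<^sub>C x) w = 0"
      by (intro w) (auto simp: S_def)
    then show "cinner (a x) w = cinner x (cnj \<mu> *\<^sub>C w)"
      by (simp add: cinner_simps)
  qed
  then have "cinner (cnj \<mu> *\<^sub>C w) w = cinner w (cnj \<mu> *\<^sub>C w)"
    using symmetric[of w w] by simp
  then have "cnj \<mu> = \<mu>"
    using w(1) by (simp add: cinner_simps)
  then show False
    using \<mu> by (auto simp: complex_eq_iff)
qed

lemma imaginary_resolvent:
  assumes \<mu>: "Re \<mu> = 0" "\<mu> \<noteq> 0"
  shows "\<exists>S. is_resolvent \<mu> S"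
proof -
  obtain S where S: "\<And>y. S y \<in> D" "\<And>y. a (S y) - \<mu> *\<^sub>C S y = y"
    using imaginary_shift_surj[OF \<mu>] by metis
  have "S (a x - \<mu> *\<^sub>C x) = x" if x: "x \<in> D" for x
  proof -
    let ?z = "S (a x - \<mu> *\<^sub>C x) - x"
    have z: "?z \<in> D"
      by (intro D_diff S x)
    have "a ?z - \<mu> *\<^sub>C ?z = (a (S (a x - \<mu> *\<^sub>C x)) - \<mu> *\<^sub>C S (a x - \<mu> *\<^sub>C x)) - (a x - \<mu> *\<^sub>C x)"
      by (simp add: diff S(1) x scaleC_diff_right)
    also have "\<dots> = 0"
      unfolding S(2) by simp
    finally have "cmod \<mu> * norm ?z \<le> 0"
      using imaginary_shift_bound(1)[OF z \<mu>(1)] by simp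
    then show ?thesis
      using \<mu>(2) by (simp add: mult_le_0_iff)
  qed
  then show ?thesis
    using S unfolding is_resolvent_def by blast
qed

lemma clinear_resolvent:
  assumes S: "is_resolvent \<mu> S" shows "clinear S"
proof (rule clinearI)
  have in_D: "S y \<in> D" and right: "a (S y) - \<mu> *\<^sub>C S y = y" for y
    using S by (auto simp: is_resolvent_def)
  have left: "S (a x - \<mu> *\<^sub>C x) = x" if "x \<in> D" for x
    using S that by (auto simp: is_resolvent_def)
  fix x y c
  have "a (S x + S y) - \<mu> *\<^sub>C (S x + S y) = x + y"
    using right[of x] right[of y] by (simp add: add in_D scaleC_add_right algebra_simps)
  then show "S (x + y) = S x + S y"
    using left[OF D_add[OF in_D in_D], of x y] by simp
  have "a (c *\<^sub>C S x) - \<mu> *\<^sub>C c *\<^sub>C S x = c *\<^sub>C (a (S x) - \<mu> *\<^sub>C S x)"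
    by (simp add: scale in_D scaleC_diff_right scaleC_scaleC mult.commute)
  then show "S (c *\<^sub>C x) = c *\<^sub>C S x"
    using left[OF D_scale[OF in_D], of c x] by (simp add: right)
qed

text \<open>
  As the left-hand side does not mention \<open>\<mu>\<close>, commuting with one resolvent is the same as commuting
  with any other, and with the Cayley transform below.
\<close>

lemma commutes_op_iff_resolvent:
  assumes S: "is_resolvent \<mu> S" and T: "clinear T"
  shows "commutes_op T \<longleftrightarrow> (\<forall>y. T (S y) = S (T y))"
proof -
  have in_D: "S y \<in> D" and right: "a (S y) - \<mu> *\<^sub>C S y = y" for y
    using S by (auto simp: is_resolvent_def)
  have left: "S (a x - \<mu> *\<^sub>C x) = x" if "x \<in> D" for x
    using S that by (auto simp: is_resolvent_def)
  show ?thesis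
  proof
    assume c: "commutes_op T"
    show "\<forall>y. T (S y) = S (T y)"
    proof
      fix y
      have "a (T (S y)) - \<mu> *\<^sub>C T (S y) = T (a (S y) - \<mu> *\<^sub>C S y)"
        using c in_D by (simp add: commutes_op_def clinear_diff[OF T] clinear_scale[OF T])
      then show "T (S y) = S (T y)"
        unfolding right using left[of "T (S y)"] c in_D by (simp add: commutes_op_def)
    qed
  next
    assume *: "\<forall>y. T (S y) = S (T y)"
    show "commutes_op T"
      unfolding commutes_op_def
    proof
      fix x assume x: "x \<in> D"
      have eq: "T x = S (T (a x - \<mu> *\<^sub>C x))"
        using left[OF x] * by metis
      have "a (T x) - \<mu> *\<^sub>C T x = T (a x) - \<mu> *\<^sub>C T x"
        using right[of "T (a x - \<mu> *\<^sub>C x)", folded eq]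
        by (simp add: clinear_diff[OF T] clinear_scale[OF T])
      then show "T x \<in> D \<and> a (T x) = T (a x)"
        using in_D[of "T (a x - \<mu> *\<^sub>C x)", folded eq] by simp
    qed
  qed
qed

text \<open>The Cayley transform \<open>(a - \<i>)(a + \<i>)\<^sup>-\<^sup>1 = I - 2\<i>(a + \<i>)\<^sup>-\<^sup>1\<close>.\<close>

definition cayley :: "'h \<Rightarrow> 'h"
  where "cayley y = y - (2 * \<i>) *\<^sub>C (SOME S. is_resolvent (- \<i>) S) y"

lemma cayley_resolvent:
  obtains S where "is_resolvent (- \<i>) S" "\<And>y. cayley y = y - (2 * \<i>) *\<^sub>C S y"
  using someI_ex[OF imaginary_resolvent[of "- \<i>"]] by (simp add: cayley_def)

lemma clinear_cayley: "clinear cayley"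
proof -
  obtain S where S: "is_resolvent (- \<i>) S" "\<And>y. cayley y = y - (2 * \<i>) *\<^sub>C S y"
    using cayley_resolvent by blast
  note lin = clinear_resolvent[OF S(1)]
  show ?thesis
    by (rule clinearI) (simp_all add: S(2) clinear_add[OF lin] clinear_scale[OF lin]
        scaleC_add_right scaleC_diff_right scaleC_scaleC algebra_simps)
qed

lemma commutes_op_iff_cayley:
  assumes T: "clinear T"
  shows "commutes_op T \<longleftrightarrow> (\<forall>y. T (cayley y) = cayley (T y))"
proof -
  obtain S where S: "is_resolvent (- \<i>) S" "\<And>y. cayley y = y - (2 * \<i>) *\<^sub>C S y"
    using cayley_resolvent by blast
  show ?thesis
    unfolding commutes_op_iff_resolvent[OF S(1) T] S(2) clinear_diff[OF T] clinear_scale[OF T]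
    by simp
qed

text \<open>
  The defining property of the Cayley transform. It reduces the isometry property to the symmetry of
  \<open>norm_imaginary_shift\<close> under conjugation of \<open>\<mu>\<close>.
\<close>

lemma cayley_shift: "x \<in> D \<Longrightarrow> cayley (a x + \<i> *\<^sub>C x) = a x - \<i> *\<^sub>C x"
proof -
  assume x: "x \<in> D"
  obtain S where S: "is_resolvent (- \<i>) S" "\<And>y. cayley y = y - (2 * \<i>) *\<^sub>C S y"
    using cayley_resolvent by blast
  have "S (a x + \<i> *\<^sub>C x) = x"
    using S(1) x by (simp add: is_resolvent_def scaleC_minus_left)
  moreover have "(2 * \<i>) *\<^sub>C x = \<i> *\<^sub>C x + \<i> *\<^sub>C x"
    by (simp flip: scaleC_add_left)
  ultimately show ?thesis
    by (simp add: S(2))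
qed

lemma norm_cayley: "norm (cayley y) = norm y"
proof -
  obtain x where x: "x \<in> D" "y = a x + \<i> *\<^sub>C x"
    using imaginary_shift_surj[of "- \<i>" y] by (auto simp: scaleC_minus_left)
  have "(norm (a x - \<i> *\<^sub>C x))\<^sup>2 = (norm (a x + \<i> *\<^sub>C x))\<^sup>2"
    using norm_imaginary_shift[OF x(1), of \<i>] norm_imaginary_shift[OF x(1), of "- \<i>"]
    by (simp add: scaleC_minus_left)
  then show ?thesis
    unfolding x(2) cayley_shift[OF x(1)] by simp
qed

lemma surj_cayley: "surj cayley"
proof -
  have "\<exists>y. cayley y = z" for z
    using imaginary_shift_surj[of \<i> z] cayley_shift by auto
  then show ?thesis
    by (metis surjI)
qed

text \<open>
  Together with the next lemma, this recovers \<open>a\<close> as \<open>\<i>(I + U)(I - U)\<^sup>-\<^sup>1\<close> from its Cayley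
  transform \<open>U\<close>.
\<close>

lemma D_eq_cayley: "D = range (\<lambda>y. y - cayley y)"
proof (intro equalityI subsetI)
  fix x assume x: "x \<in> D"
  define y where "y = (1 / (2 * \<i>)) *\<^sub>C (a x + \<i> *\<^sub>C x)"
  have "y - cayley y = (1 / (2 * \<i>)) *\<^sub>C ((a x + \<i> *\<^sub>C x) - (a x - \<i> *\<^sub>C x))"
    unfolding y_def by (simp only: clinear_scale[OF clinear_cayley] cayley_shift[OF x] scaleC_diff_right)
  also have "(a x + \<i> *\<^sub>C x) - (a x - \<i> *\<^sub>C x) = (2 * \<i>) *\<^sub>C x"
    by (simp flip: scaleC_add_left)
  finally show "x \<in> range (\<lambda>y. y - cayley y)"
    by (auto simp: scaleC_scaleC scaleC_one intro!: range_eqI[of _ _ y])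
next
  fix x assume "x \<in> range (\<lambda>y. y - cayley y)"
  then obtain y where y: "x = y - cayley y"
    by blast
  obtain S where S: "is_resolvent (- \<i>) S" "\<And>y. cayley y = y - (2 * \<i>) *\<^sub>C S y"
    using cayley_resolvent by blast
  show "x \<in> D"
    using S(1) by (simp add: y S(2) is_resolvent_def D_scale)
qed

lemma a_cayley: "a (y - cayley y) = \<i> *\<^sub>C (y + cayley y)"
proof -
  obtain x where x: "x \<in> D" "y = a x + \<i> *\<^sub>C x"
    using imaginary_shift_surj[of "- \<i>" y] by (auto simp: scaleC_minus_left)
  have "y - cayley y = (2 * \<i>) *\<^sub>C x"
    unfolding x(2) cayley_shift[OF x(1)] by (simp flip: scaleC_add_left)
  moreover have "y + cayley y = 2 *\<^sub>C a x"
    unfolding x(2) cayley_shift[OF x(1)] using scaleC_add_left[of 1 1 "a x"] by (simp add: scaleC_one)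
  ultimately show ?thesis
    by (simp add: scale x(1) scaleC_scaleC mult.commute)
qed

end

section \<open>Trigonometric moments of a unitary operator\<close>

locale unitary =
  fixes U :: "'h::complex_hilbert \<Rightarrow> 'h"
  assumes lin: "clinear U" and norm: "norm (U x) = norm x" and surj: "surj U"

lemma cis_integral:
  "has_bochner_integral lborel (\<lambda>\<theta>. indicator {0..2 * pi} \<theta> *\<^sub>R cis (of_int m * \<theta>))
    (if m = 0 then complex_of_real (2 * pi) else 0)"
proof (cases "m = 0")
  case True
  have "has_bochner_integral lborel (\<lambda>\<theta>. indicator {0..2 * pi} \<theta> *\<^sub>R (1::complex))
      (complex_of_real (2 * pi) - complex_of_real 0)"
    by (rule has_bochner_integral_FTC_Icc) (auto intro!: derivative_eq_intros)
  then show ?thesis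
    using True by simp
next
  case False
  define F where "F \<theta> = cis (of_int m * \<theta>) / (\<i> * of_int m)" for \<theta>
  have "has_bochner_integral lborel (\<lambda>\<theta>. indicator {0..2 * pi} \<theta> *\<^sub>R cis (of_int m * \<theta>))
      (F (2 * pi) - F 0)"
  proof (rule has_bochner_integral_FTC_Icc)
    fix \<theta> :: real
    have "((\<lambda>t. exp (\<i> * (of_int m * complex_of_real t)) / (\<i> * of_int m)) has_vector_derivative
        exp (\<i> * (of_int m * complex_of_real \<theta>))) (at \<theta> within {0..2 * pi})"
      using False
      by (auto intro!: derivative_eq_intros has_vector_derivative_real_field simp: mult.commute mult.left_commute)
    then show "(F has_vector_derivative cis (of_int m * \<theta>)) (at \<theta> within {0..2 * pi})"
      by (simp add: F_def[abs_def] cis_conv_exp)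
  next
    show "continuous_on {0..2 * pi} (\<lambda>\<theta>. cis (of_int m * \<theta>))"
      by (intro continuous_intros)
  qed auto
  moreover have "cis (of_int m * (2 * pi)) = 1"
    using cis_multiple_2pi[of "of_int m"] by (simp add: mult.commute mult.left_commute)
  ultimately show ?thesis
    using False by (simp add: F_def)
qed

context unitary
begin

lemma clinear_funpow: "clinear (U ^^ n)"
  by (rule clinearI; induction n) (simp_all add: clinear_add[OF lin] clinear_scale[OF lin])

lemma norm_funpow: "norm ((U ^^ n) x) = norm x"
  by (induction n) (simp_all add: norm)

lemma cinner_U: "cinner (U x) (U y) = cinner x y"
  using clinear_isometry_cinner[OF lin] norm by blast

lemma cinner_funpow: "cinner ((U ^^ n) x) ((U ^^ n) y) = cinner x y"
  by (rule clinear_isometry_cinner[OF clinear_funpow norm_funpow])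

text \<open>
  The Fejer kernel: its coefficients are the moments \<open>\<langle>U\<^sup>k x, x\<rangle>\<close> with weights tending to \<open>1\<close>,
  and it is nonnegative because it is the squared norm of a vector.
\<close>

definition fejer :: "'h \<Rightarrow> nat \<Rightarrow> real \<Rightarrow> real"
  where "fejer x n \<theta> = (norm (\<Sum>j<n. cis (- (real j * \<theta>)) *\<^sub>C (U ^^ j) x))\<^sup>2 / (2 * pi * real n)"

lemma continuous_fejer: "continuous_on UNIV (fejer x n)"
proof -
  have "continuous_on UNIV (\<lambda>\<theta>. cis (- (real j * \<theta>)) *\<^sub>C (U ^^ j) x)" for j
    by (rule bounded_bilinear.continuous_on[OF bounded_bilinear_scaleC])
      (intro continuous_intros)+
  then show ?thesis
    unfolding fejer_def[abs_def] divide_inverse by (intro continuous_intros)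
qed

lemma fejer_moments:
  assumes n: "0 < n" and k: "k \<le> n"
  shows "has_bochner_integral lborel
    (\<lambda>\<theta>. indicator {0..2 * pi} \<theta> *\<^sub>R (cis (real k * \<theta>) * complex_of_real (fejer x n \<theta>)))
    (complex_of_real ((real n - real k) / real n) * cinner ((U ^^ k) x) x)"
proof -
  let ?g = "\<lambda>j l. cinner ((U ^^ j) x) ((U ^^ l) x)"
  let ?c = "complex_of_real (1 / (2 * pi * real n))"
  have eq: "indicator {0..2 * pi} \<theta> *\<^sub>R (cis (real k * \<theta>) * complex_of_real (fejer x n \<theta>))
      = ?c * (\<Sum>l<n. \<Sum>j<n. ?g j l *
          (indicator {0..2 * pi} \<theta> *\<^sub>R cis (of_int (int k + int l - int j) * \<theta>)))" for \<theta>
  proof -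
    let ?S = "\<Sum>j<n. cis (- (real j * \<theta>)) *\<^sub>C (U ^^ j) x"
    have "complex_of_real (fejer x n \<theta>) = ?c * cinner ?S ?S"
      by (simp add: fejer_def cinner_self)
    also have "cinner ?S ?S = (\<Sum>l<n. \<Sum>j<n. cis (- (real j * \<theta>)) * cis (real l * \<theta>) * ?g j l)"
      by (simp add: cinner_sum_left cinner_sum_right cinner_simps sum_distrib_left cis_cnj
          algebra_simps)
    finally have "cis (real k * \<theta>) * complex_of_real (fejer x n \<theta>) = ?c *
        (\<Sum>l<n. \<Sum>j<n. ?g j l * (cis (real k * \<theta>) * (cis (- (real j * \<theta>)) * cis (real l * \<theta>))))"
      by (simp add: sum_distrib_left algebra_simps)
    moreover have "cis (real k * \<theta>) * (cis (- (real j * \<theta>)) * cis (real l * \<theta>))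
        = cis (of_int (int k + int l - int j) * \<theta>)" for j l
      by (simp add: cis_mult algebra_simps)
    ultimately show ?thesis
      by (simp add: indicator_def)
  qed
  \<comment> \<open>The surviving terms have \<open>j = l + k\<close>; there are \<open>n - k\<close> of them, all equal.\<close>
  have sum: "(\<Sum>l<n. \<Sum>j<n. ?g j l * (if int k + int l - int j = 0 then complex_of_real (2 * pi) else 0))
      = of_nat (n - k) * (complex_of_real (2 * pi) * cinner ((U ^^ k) x) x)"
  proof -
    have "(\<Sum>j<n. ?g j l * (if int k + int l - int j = 0 then complex_of_real (2 * pi) else 0))
        = (if l < n - k then complex_of_real (2 * pi) * cinner ((U ^^ k) x) x else 0)" for l
    proof -
      have "(\<Sum>j<n. ?g j l * (if int k + int l - int j = 0 then complex_of_real (2 * pi) else 0))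
          = (\<Sum>j<n. if j = l + k then complex_of_real (2 * pi) * ?g j l else 0)"
        by (intro sum.cong) auto
      also have "?g (l + k) l = cinner ((U ^^ k) x) x"
        by (simp add: funpow_add cinner_funpow)
      ultimately show ?thesis
        by (auto simp: sum.delta)
    qed
    then have "(\<Sum>l<n. \<Sum>j<n. ?g j l * (if int k + int l - int j = 0 then complex_of_real (2 * pi) else 0))
        = (\<Sum>l<n. if l < n - k then complex_of_real (2 * pi) * cinner ((U ^^ k) x) x else 0)"
      by simp
    also have "\<dots> = (\<Sum>l<n - k. complex_of_real (2 * pi) * cinner ((U ^^ k) x) x)"
      by (rule sum.mono_neutral_cong_right) auto
    finally show ?thesis
      by simp
  qed
  have "has_bochner_integral lborel (\<lambda>\<theta>. ?c * (\<Sum>l<n. \<Sum>j<n. ?g j l *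
          (indicator {0..2 * pi} \<theta> *\<^sub>R cis (of_int (int k + int l - int j) * \<theta>))))
      (?c * (\<Sum>l<n. \<Sum>j<n. ?g j l * (if int k + int l - int j = 0 then complex_of_real (2 * pi) else 0)))"
    by (intro has_bochner_integral_mult_right has_bochner_integral_sum cis_integral)
  also have "?c * (\<Sum>l<n. \<Sum>j<n. ?g j l * (if int k + int l - int j = 0 then complex_of_real (2 * pi) else 0))
      = complex_of_real ((real n - real k) / real n) * cinner ((U ^^ k) x) x"
    unfolding sum using n k by (simp add: of_nat_diff field_simps)
  finally show ?thesis
    unfolding eq .
qed

definition fejer_measure :: "'h \<Rightarrow> nat \<Rightarrow> real measure"
  where "fejer_measure x n = density lborel (\<lambda>\<theta>. ennreal (indicator {0..2 * pi} \<theta> * fejer x n \<theta>))"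

lemma fejer_measurable [measurable]: "fejer x n \<in> borel_measurable borel"
  by (rule borel_measurable_continuous_onI[OF continuous_fejer])

lemma fejer_nonneg: "0 \<le> fejer x n \<theta>"
  by (simp add: fejer_def)

lemma real_distribution_fejer_measure:
  assumes x: "norm x = 1" and n: "0 < n"
  shows "real_distribution (fejer_measure x n)"
proof -
  have "has_bochner_integral lborel (\<lambda>\<theta>. indicator {0..2 * pi} \<theta> * fejer x n \<theta>) 1"
    using has_bochner_integral_bounded_linear[OF bounded_linear_Re fejer_moments[of n 0 x]] x n
    by (simp add: cinner_self indicator_def if_distrib[of Re] cong: if_cong)
  then have "(\<integral>\<^sup>+\<theta>. ennreal (indicator {0..2 * pi} \<theta> * fejer x n \<theta>) \<partial>lborel) = ennreal 1"
    by (subst nn_integral_eq_integral)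
      (auto simp: has_bochner_integral_iff fejer_nonneg)
  then have "emeasure (fejer_measure x n) UNIV = 1"
    by (simp add: fejer_measure_def emeasure_density)
  then have "prob_space (fejer_measure x n)"
    by (intro prob_spaceI) (simp add: fejer_measure_def)
  then show ?thesis
    by (simp add: real_distribution_def real_distribution_axioms_def fejer_measure_def)
qed

lemma integral_fejer_measure:
  assumes n: "0 < n" and k: "k \<le> n"
  shows "(\<integral>\<theta>. cis (real k * \<theta>) \<partial>fejer_measure x n)
    = complex_of_real ((real n - real k) / real n) * cinner ((U ^^ k) x) x"
proof -
  have "(\<integral>\<theta>. cis (real k * \<theta>) \<partial>fejer_measure x n)
      = (\<integral>\<theta>. (indicator {0..2 * pi} \<theta> * fejer x n \<theta>) *\<^sub>R cis (real k * \<theta>) \<partial>lborel)"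
    unfolding fejer_measure_def
    by (subst integral_density)
      (auto simp: fejer_nonneg intro!: borel_measurable_continuous_onI continuous_intros)
  also have "\<dots> = (\<integral>\<theta>. indicator {0..2 * pi} \<theta> *\<^sub>R (cis (real k * \<theta>) * complex_of_real (fejer x n \<theta>)) \<partial>lborel)"
    by (intro Bochner_Integration.integral_cong) (auto simp: indicator_def scaleR_conv_of_real)
  finally show ?thesis
    using fejer_moments[OF assms] by (simp add: has_bochner_integral_iff)
qed

lemma tight_fejer_measure:
  assumes x: "norm x = 1"
  shows "tight (\<lambda>n. fejer_measure x (Suc n))"
  unfolding tight_def
proof (intro conjI allI impI)
  show dist: "real_distribution (fejer_measure x (Suc n))" for n
    using real_distribution_fejer_measure[OF x] by simp
  fix e :: real assume e: "0 < e"
  have "measure (fejer_measure x (Suc n)) {- 1<..8} = 1" for n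
  proof -
    interpret real_distribution "fejer_measure x (Suc n)"
      by (rule dist)
    have "AE \<theta> in fejer_measure x (Suc n). \<theta> \<in> {- 1<..8}"
      unfolding fejer_measure_def using pi_less_4
      by (subst AE_density) (auto simp: indicator_def)
    then show ?thesis
      by (subst prob_eq_1) auto
  qed
  then show "\<exists>a b. a < b \<and> (\<forall>n. 1 - e < measure (fejer_measure x (Suc n)) {a<..b})"
    using e by (intro exI[of _ "- 1"] exI[of _ 8]) simp
qed

text \<open>
  A solution of the trigonometric moment problem for \<open>x\<close>. The negative moments follow by
  conjugation. The measure lives on the Borel sets of the plane and is concentrated on the circle.
\<close>

definition represents :: "'h \<Rightarrow> complex measure \<Rightarrow> bool"
  where "represents x \<sigma> \<longleftrightarrow> finite_measure \<sigma> \<and> sets \<sigma> = sets borel \<and> (AE z in \<sigma>. norm z = 1) \<and>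
    (\<forall>n. (\<integral>z. z ^ n \<partial>\<sigma>) = cinner ((U ^^ n) x) x)"

text \<open>
  The solution is a weak limit of the Fejer measures, which Helly's theorem provides because all of
  them live on the same bounded interval of angles; the exponential map carries it to the circle.
\<close>

lemma represents_unit:
  assumes x: "norm x = 1"
  shows "\<exists>\<sigma>. represents x \<sigma>"
proof -
  let ?\<mu> = "\<lambda>n. fejer_measure x (Suc n)"
  obtain r M where r: "strict_mono (r :: nat \<Rightarrow> nat)" and M: "real_distribution M"
    and weak: "weak_conv_m (?\<mu> \<circ> id \<circ> r) M"
    using tight_imp_convergent_subsubsequence[OF tight_fejer_measure[OF x], of id]
    by (auto simp: strict_mono_def)
  interpret M: real_distribution M
    by (rule M)
  have cis_m [measurable]: "cis \<in> borel_measurable borel"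
    by (intro borel_measurable_continuous_onI continuous_intros)
  have moment: "(\<integral>\<theta>. cis (real k * \<theta>) \<partial>M) = cinner ((U ^^ k) x) x" for k
  proof (rule LIMSEQ_unique)
    have "continuous_on UNIV (\<lambda>\<theta>. cis (real k * \<theta>))"
      by (intro continuous_intros)
    then have "isCont (\<lambda>\<theta>. cis (real k * \<theta>)) \<theta>" for \<theta>
      by (simp add: continuous_on_eq_continuous_at)
    then show "(\<lambda>n. \<integral>\<theta>. cis (real k * \<theta>) \<partial>?\<mu> (r n)) \<longlonglongrightarrow> (\<integral>\<theta>. cis (real k * \<theta>) \<partial>M)"
      using weak_conv_imp_integral_bdd_continuous_conv[OF _ M weak, of "\<lambda>\<theta>. cis (real k * \<theta>)" 1]
        real_distribution_fejer_measure[OF x] by (auto simp: comp_def)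
    have "(\<lambda>n. complex_of_real ((real (Suc n) - real k) / real (Suc n)) * cinner ((U ^^ k) x) x)
        \<longlonglongrightarrow> complex_of_real 1 * cinner ((U ^^ k) x) x"
    proof (intro tendsto_intros)
      have "(\<lambda>n. 1 - real k * (1 / real (Suc n))) \<longlonglongrightarrow> 1 - real k * 0"
        by (intro tendsto_intros LIMSEQ_Suc lim_1_over_n)
      then show "(\<lambda>n. (real (Suc n) - real k) / real (Suc n)) \<longlonglongrightarrow> 1"
        by (simp add: diff_divide_distrib del: of_nat_Suc)
    qed
    then have lim: "(\<lambda>n. complex_of_real ((real (Suc (r n)) - real k) / real (Suc (r n)))
        * cinner ((U ^^ k) x) x) \<longlonglongrightarrow> cinner ((U ^^ k) x) x"
      using LIMSEQ_subseq_LIMSEQ[OF _ r] by (fastforce simp: comp_def)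
    \<comment> \<open>The formula for the moment of order \<open>k\<close> requires \<open>k\<close> not to exceed the degree \<open>Suc (r n)\<close>.\<close>
    have "\<forall>\<^sub>F n in sequentially. (\<integral>\<theta>. cis (real k * \<theta>) \<partial>?\<mu> (r n))
        = complex_of_real ((real (Suc (r n)) - real k) / real (Suc (r n))) * cinner ((U ^^ k) x) x"
      using eventually_ge_at_top[of k]
    proof eventually_elim
      case (elim n)
      then have "k \<le> Suc (r n)"
        using seq_suble[OF r, of n] by linarith
      then show ?case
        by (intro integral_fejer_measure) auto
    qed
    from tendsto_cong[OF this] lim
    show "(\<lambda>n. \<integral>\<theta>. cis (real k * \<theta>) \<partial>?\<mu> (r n)) \<longlonglongrightarrow> cinner ((U ^^ k) x) x"
      by (simp only:)
  qed
  have "represents x (distr M borel cis)"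
    unfolding represents_def
  proof (intro conjI allI)
    show "finite_measure (distr M borel cis)"
      by (intro M.finite_measure_distr) simp
    show "AE z in distr M borel cis. norm z = 1"
      by (subst AE_distr_iff) auto
    fix n
    have "(\<integral>z. z ^ n \<partial>distr M borel cis) = (\<integral>\<theta>. cis \<theta> ^ n \<partial>M)"
      by (intro integral_distr) auto
    also have "\<dots> = cinner ((U ^^ n) x) x"
      by (simp add: Complex.DeMoivre moment)
    finally show "(\<integral>z. z ^ n \<partial>distr M borel cis) = cinner ((U ^^ n) x) x" .
  qed simp
  then show ?thesis
    by blast
qed

lemma represents_scale:
  assumes \<sigma>: "represents x \<sigma>"
  shows "represents (c *\<^sub>C x) (density \<sigma> (\<lambda>_. ennreal ((cmod c)\<^sup>2)))"
proof -
  have [measurable_cong]: "sets \<sigma> = sets borel"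
    using \<sigma> by (simp add: represents_def)
  show ?thesis
    unfolding represents_def
  proof (intro conjI allI)
    have "emeasure \<sigma> (space \<sigma>) < \<infinity>"
      using \<sigma> finite_measure.emeasure_finite by (auto simp: represents_def top.not_eq_extremum)
    then show "finite_measure (density \<sigma> (\<lambda>_. ennreal ((cmod c)\<^sup>2)))"
      by (intro finite_measureI) (simp add: emeasure_density ennreal_mult_eq_top_iff)
    show "AE z in density \<sigma> (\<lambda>_. ennreal ((cmod c)\<^sup>2)). norm z = 1"
      using \<sigma> by (subst AE_density) (auto simp: represents_def)
    fix n
    have "(\<integral>z. z ^ n \<partial>density \<sigma> (\<lambda>_. ennreal ((cmod c)\<^sup>2))) = (\<integral>z. (cmod c)\<^sup>2 *\<^sub>R z ^ n \<partial>\<sigma>)"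
      by (intro integral_density) auto
    also have "\<dots> = cinner ((U ^^ n) (c *\<^sub>C x)) (c *\<^sub>C x)"
      using \<sigma> by (simp add: represents_def scaleR_conv_of_real complex_norm_square
          clinear_scale[OF clinear_funpow] cinner_simps mult.commute mult.left_commute del: of_real_power)
    finally show "(\<integral>z. z ^ n \<partial>density \<sigma> (\<lambda>_. ennreal ((cmod c)\<^sup>2)))
        = cinner ((U ^^ n) (c *\<^sub>C x)) (c *\<^sub>C x)" .
  qed (simp add: \<open>sets \<sigma> = sets borel\<close>)
qed

lemma represents_exists: "\<exists>\<sigma>. represents x \<sigma>"
proof (cases "x = 0")
  case True
  have "represents x (null_measure borel)"
    using True AE_I'[of UNIV "null_measure borel" "\<lambda>z. norm z = 1"]
    by (auto simp: represents_def null_sets_def intro!: finite_measureI)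
  then show ?thesis
    by blast
next
  case False
  define e where "e = (1 / norm x) *\<^sub>R x"
  have "norm e = 1" "x = complex_of_real (norm x) *\<^sub>C e"
    using False by (simp_all add: e_def scaleC_of_real)
  then show ?thesis
    using represents_unit[of e] represents_scale by metis
qed

end

section \<open>Trigonometric polynomials of a unitary operator\<close>

text \<open>On the unit circle this is the integer power of \<open>z\<close>; elsewhere it is still continuous.\<close>

definition zpow :: "int \<Rightarrow> complex \<Rightarrow> complex"
  where "zpow k z = (if 0 \<le> k then z ^ nat k else cnj z ^ nat (- k))"

lemma zpow_0 [simp]: "zpow 0 z = 1"
  by (simp add: zpow_def)

lemma continuous_zpow: "continuous_on A (zpow k)"
  unfolding zpow_def[abs_def] by (cases "0 \<le> k") (auto intro!: continuous_intros)

lemma cnj_zpow: "cnj (zpow k z) = zpow (- k) z"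
  by (auto simp: zpow_def)

lemma zpow_add:
  assumes z: "cmod z = 1" shows "zpow (k + l) z = zpow k z * zpow l z"
proof -
  have "z * cnj z = 1"
    using z complex_norm_square[of z] by simp
  then have "inverse z = cnj z"
    by (rule inverse_unique)
  then have "zpow k z = z powi k" for k
    by (simp add: zpow_def power_int_def)
  moreover have "z \<noteq> 0"
    using z by auto
  ultimately show ?thesis
    by (simp add: power_int_add)
qed

lemma norm_diff_sqr_le:
  fixes u v w :: "'a::real_normed_vector"
  shows "(norm (u - v))\<^sup>2 \<le> 2 * (norm (u - w))\<^sup>2 + 2 * (norm (v - w))\<^sup>2"
proof -
  have "norm (u - v) \<le> norm (u - w) + norm (v - w)"
    using norm_triangle_ineq4[of "u - w" "v - w"] by simp
  then have "(norm (u - v))\<^sup>2 \<le> (norm (u - w) + norm (v - w))\<^sup>2"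
    by (intro power_mono) auto
  also have "\<dots> \<le> 2 * (norm (u - w))\<^sup>2 + 2 * (norm (v - w))\<^sup>2"
    using sum_squares_bound[of "norm (u - w)" "norm (v - w)"] by (simp add: power2_sum)
  finally show ?thesis .
qed

context unitary
begin

definition upow :: "int \<Rightarrow> 'h \<Rightarrow> 'h"
  where "upow k = (if 0 \<le> k then U ^^ nat k else inv U ^^ nat (- k))"

lemma U_inv: "U (inv U x) = x"
  using surj by (rule surj_f_inv_f)

lemma inj_U: "inj U"
proof (rule injI)
  fix x y assume "U x = U y"
  then have "norm (U (x - y)) = 0"
    by (simp add: clinear_diff[OF lin])
  then show "x = y"
    by (simp add: norm)
qed

lemma unitary_inv: "unitary (inv U)"
proof (rule unitary.intro)
  show "clinear (inv U)"
    by (rule clinearI; rule inv_f_eq[OF inj_U])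
      (simp_all add: clinear_add[OF lin] clinear_scale[OF lin] U_inv)
  show "norm (inv U x) = norm x" for x
    using norm[of "inv U x"] by (simp add: U_inv)
  show "surj (inv U)"
    using inj_U by (rule inj_imp_surj_inv)
qed

lemma upow_0 [simp]: "upow 0 x = x"
  by (simp add: upow_def)

lemma clinear_upow: "clinear (upow k)"
  using clinear_funpow unitary.clinear_funpow[OF unitary_inv] by (simp add: upow_def)

lemma upow_add_1: "upow (k + 1) x = U (upow k x)"
proof (cases "0 \<le> k")
  case True
  then have "nat (k + 1) = Suc (nat k)"
    by simp
  then show ?thesis
    using True by (simp add: upow_def)
next
  case False
  show ?thesis
  proof (cases "k = - 1")
    case True
    then show ?thesis
      by (simp add: upow_def U_inv)
  next
    case False
    with \<open>\<not> 0 \<le> k\<close> have "nat (- k) = Suc (nat (- (k + 1)))" "\<not> 0 \<le> k + 1"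
      by auto
    with \<open>\<not> 0 \<le> k\<close> show ?thesis
      unfolding upow_def by (simp add: U_inv del: minus_add_distrib)
  qed
qed

lemma cinner_upow_shift: "cinner (upow (k + int n) x) (upow (l + int n) y) = cinner (upow k x) (upow l y)"
proof (induction n)
  case (Suc n)
  then show ?case
    using upow_add_1[of "k + int n" x] upow_add_1[of "l + int n" y]
    by (simp add: cinner_U algebra_simps)
qed simp

lemma cinner_upow: "cinner (upow k x) (upow l y) = cinner (upow (k - l) x) y"
proof (cases "0 \<le> l")
  case True
  then show ?thesis
    using cinner_upow_shift[of "k - l" "nat l" x 0 y] by simp
next
  case False
  then show ?thesis
    using cinner_upow_shift[of k "nat (- l)" x l y] by simp
qed

text \<open>A trigonometric polynomial, together with the operator obtained by substituting \<open>U\<close>.\<close>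

inductive trig :: "(complex \<Rightarrow> complex) \<Rightarrow> ('h \<Rightarrow> 'h) \<Rightarrow> bool"
  where monomial: "trig (\<lambda>z. c * zpow k z) (\<lambda>x. c *\<^sub>C upow k x)"
  | add: "trig f F \<Longrightarrow> trig g G \<Longrightarrow> trig (\<lambda>z. f z + g z) (\<lambda>x. F x + G x)"

lemma trig_const: "trig (\<lambda>z. c) (\<lambda>x. c *\<^sub>C x)"
  using monomial[of c 0] by simp

lemma trig_scale: "trig f F \<Longrightarrow> trig (\<lambda>z. c * f z) (\<lambda>x. c *\<^sub>C F x)"
proof (induction rule: trig.induct)
  case (monomial d k)
  then show ?case
    using trig.monomial[of "c * d" k] by (simp add: scaleC_scaleC mult.assoc)
next
  case (add f F g G)
  then show ?case
    using trig.add[OF add.IH] by (simp add: algebra_simps scaleC_add_right)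
qed

lemma trig_diff:
  assumes "trig f F" "trig g G" shows "trig (\<lambda>z. f z - g z) (\<lambda>x. F x - G x)"
  using trig.add[OF assms(1) trig_scale[OF assms(2), of "- 1"]]
  by (simp add: scaleC_minus_left scaleC_one)

lemma trig_sum:
  assumes "\<And>i. i \<in> I \<Longrightarrow> trig (f i) (F i)"
  shows "trig (\<lambda>z. \<Sum>i\<in>I. f i z) (\<lambda>x. \<Sum>i\<in>I. F i x)"
  using assms
proof (induction I rule: infinite_finite_induct)
  case (insert i I)
  then show ?case
    using trig.add[of "f i" "F i"] by simp
qed (use trig_const[of 0] in simp_all)

lemma trig_clinear: "trig f F \<Longrightarrow> clinear F"
proof (induction rule: trig.induct)
  case (monomial c k)
  then show ?case
    by (intro clinearI) (simp_all add: clinear_add[OF clinear_upow] clinear_scale[OF clinear_upow]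
        scaleC_add_right scaleC_scaleC mult.commute)
next
  case (add f F g G)
  then show ?case
    by (intro clinearI) (simp_all add: clinear_add clinear_scale scaleC_add_right algebra_simps)
qed

lemma trig_continuous: "trig f F \<Longrightarrow> continuous_on A f"
  by (induction rule: trig.induct) (auto intro!: continuous_intros continuous_zpow)

lemma trig_mult:
  assumes f: "trig f F" and g: "trig g G"
  shows "\<exists>h H. trig h H \<and> (\<forall>z\<in>sphere 0 1. h z = f z * g z)"
  using f
proof (induction rule: trig.induct)
  case (monomial c k)
  show ?case
    using g
  proof (induction rule: trig.induct)
    case (monomial d l)
    show ?case
      using trig.monomial[of "c * d" "k + l"]
      by (intro exI conjI) (auto simp: zpow_add algebra_simps)
  next
    case (add f F g G)
    then obtain h1 H1 h2 H2 where "trig h1 H1" "\<forall>z\<in>sphere 0 1. h1 z = c * zpow k z * f z"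
      "trig h2 H2" "\<forall>z\<in>sphere 0 1. h2 z = c * zpow k z * g z"
      by blast
    then show ?case
      using trig.add[of h1 H1 h2 H2]
      by (intro exI[of _ "\<lambda>z. h1 z + h2 z"] exI[of _ "\<lambda>x. H1 x + H2 x"]) (auto simp: distrib_left)
  qed
next
  case (add f1 F1 f2 F2)
  then obtain h1 H1 h2 H2 where "trig h1 H1" "\<forall>z\<in>sphere 0 1. h1 z = f1 z * g z"
      "trig h2 H2" "\<forall>z\<in>sphere 0 1. h2 z = f2 z * g z"
    by blast
  then show ?case
    using trig.add[of h1 H1 h2 H2]
      by (intro exI[of _ "\<lambda>z. h1 z + h2 z"] exI[of _ "\<lambda>x. H1 x + H2 x"]) (auto simp: distrib_right)
qed

text \<open>
  On the circle the coordinates of \<open>z\<close> are combinations of \<open>z\<close> and its inverse \<open>cnj z\<close>. Thus the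
  Stone-Weierstrass theorem for real polynomials in two variables also applies to \<open>trig\<close>.
\<close>

lemma trig_real_polynomial:
  assumes "real_polynomial_function p"
  shows "\<exists>f F. trig f F \<and> (\<forall>z\<in>sphere 0 1. f z = complex_of_real (p z))"
  using assms
proof (induction rule: real_polynomial_function.induct)
  case (linear p)
  define c where "c = Complex (p 1 / 2) (- p \<i> / 2)"
  have pz: "p z = Re z * p 1 + Im z * p \<i>" for z
  proof -
    interpret bounded_linear p
      by fact
    have "z = Re z *\<^sub>R 1 + Im z *\<^sub>R \<i>"
      by (simp add: complex_eq_iff)
    then have "p z = p (Re z *\<^sub>R 1 + Im z *\<^sub>R \<i>)"
      by (rule arg_cong)
    also have "\<dots> = Re z * p 1 + Im z * p \<i>"
      unfolding add scaleR real_scaleR_def ..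
    finally show ?thesis .
  qed
  have "c * zpow 1 z + cnj c * zpow (- 1) z = complex_of_real (p z)" for z
    unfolding pz[of z] by (simp add: zpow_def c_def complex_eq_iff algebra_simps)
  then show ?case
    using trig.add[OF trig.monomial[of c 1] trig.monomial[of "cnj c" "- 1"]] by auto
next
  case (const c)
  then show ?case
    using trig_const[of "complex_of_real c"] by auto
next
  case (add p q)
  then obtain f F g G where "trig f F" "\<forall>z\<in>sphere 0 1. f z = complex_of_real (p z)"
    "trig g G" "\<forall>z\<in>sphere 0 1. g z = complex_of_real (q z)"
    by blast
  then show ?case
    using trig.add[of f F g G]
    by (intro exI[of _ "\<lambda>z. f z + g z"] exI[of _ "\<lambda>x. F x + G x"]) auto
next
  case (mult p q)
  then obtain f F g G where fg: "trig f F" "\<forall>z\<in>sphere 0 1. f z = complex_of_real (p z)"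
    "trig g G" "\<forall>z\<in>sphere 0 1. g z = complex_of_real (q z)"
    by blast
  show ?case
    using trig_mult[OF fg(1,3)] fg(2,4) by auto
qed

lemma trig_approx:
  fixes f :: "complex \<Rightarrow> real"
  assumes "continuous_on (sphere 0 1) f" "0 < e"
  shows "\<exists>p P. trig p P \<and> (\<forall>z\<in>sphere 0 1. cmod (p z - complex_of_real (f z)) < e)"
proof -
  obtain g where g: "real_polynomial_function g" "\<And>z. z \<in> sphere 0 1 \<Longrightarrow> \<bar>f z - g z\<bar> < e"
    using Stone_Weierstrass_real_polynomial_function[OF compact_sphere assms] by blast
  obtain p P where p: "trig p P" "\<forall>z\<in>sphere 0 1. p z = complex_of_real (g z)"
    using trig_real_polynomial[OF g(1)] by blast
  have "cmod (p z - complex_of_real (f z)) < e" if "z \<in> sphere 0 1" for z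
    using g(2)[OF that] p(2) that by (simp add: abs_minus_commute flip: of_real_diff)
  then show ?thesis
    using p(1) by blast
qed

text \<open>
  The indicator of an open set is a bounded limit of trigonometric polynomials on the circle:
  cut off multiples of the distance to the complement, and approximate by Stone-Weierstrass.
\<close>

lemma trig_indicator:
  fixes V :: "complex set"
  assumes V: "open V"
  obtains p P where "\<And>n. trig (p n) (P n)" "\<And>n z. z \<in> sphere 0 1 \<Longrightarrow> cmod (p n z) \<le> 2"
    "\<And>z. z \<in> sphere 0 1 \<Longrightarrow> (\<lambda>n::nat. p n z) \<longlonglongrightarrow> indicator V z"
proof -
  define f where "f n z = (if V = UNIV then 1 else min 1 (real n * infdist z (- V)))" for n :: nat and z
  have cont: "continuous_on A (f n)" for A n
    unfolding f_def by (cases "V = UNIV") (auto intro!: continuous_intros)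
  have f01: "0 \<le> f n z" "f n z \<le> 1" for n z
    by (auto simp: f_def infdist_nonneg)
  have lim: "(\<lambda>n. f n z) \<longlonglongrightarrow> indicator V z" for z
  proof (cases "V = UNIV")
    case False
    show ?thesis
    proof (cases "z \<in> V")
      case True
      have "infdist z (- V) \<noteq> 0"
        using in_closed_iff_infdist_zero[of "- V" z] V False True by auto
      then have pos: "0 < infdist z (- V)"
        using infdist_nonneg[of z "- V"] by linarith
      obtain N where N: "1 / infdist z (- V) < real N"
        using reals_Archimedean2 by blast
      have "f n z = 1" if "N \<le> n" for n
      proof -
        have "1 < real N * infdist z (- V)"
          using N pos by (simp add: pos_divide_less_eq)
        also have "\<dots> \<le> real n * infdist z (- V)"
          using that pos by (intro mult_right_mono) auto
        finally show ?thesis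
          using False by (simp add: f_def)
      qed
      then show ?thesis
        using True by (intro tendsto_eventually) (auto simp: eventually_sequentially)
    next
      case z: False
      then show ?thesis
        using False by (simp add: f_def infdist_zero)
    qed
  qed (simp add: f_def)
  have "\<exists>p P. trig p P \<and> (\<forall>z\<in>sphere 0 1. cmod (p z - complex_of_real (f n z)) < 1 / real (Suc n))" for n
    by (intro trig_approx cont) simp
  then obtain p P where p: "\<And>n. trig (p n) (P n)"
    "\<And>n z. z \<in> sphere 0 1 \<Longrightarrow> cmod (p n z - complex_of_real (f n z)) < 1 / real (Suc n)"
    by metis
  have "cmod (p n z) \<le> 2" if "z \<in> sphere 0 1" for n z
  proof -
    have "1 / real (Suc n) \<le> 1"
      by simp
    then show ?thesis
      using p(2)[OF that, of n] f01[of n z] norm_triangle_sub[of "p n z" "complex_of_real (f n z)"]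
      unfolding norm_of_real by linarith
  qed
  moreover have "(\<lambda>n. p n z) \<longlonglongrightarrow> indicator V z" if z: "z \<in> sphere 0 1" for z
  proof -
    have "(\<lambda>n. p n z - complex_of_real (f n z)) \<longlonglongrightarrow> 0"
    proof (rule Lim_null_comparison)
      show "\<forall>\<^sub>F n in sequentially. cmod (p n z - complex_of_real (f n z)) \<le> 1 / real (Suc n)"
        by (intro always_eventually allI less_imp_le p(2) z)
    qed (rule LIMSEQ_Suc[OF lim_1_over_n])
    moreover have "(\<lambda>n. complex_of_real (f n z)) \<longlonglongrightarrow> complex_of_real (indicator V z)"
      by (intro tendsto_intros lim)
    ultimately have "(\<lambda>n. p n z - complex_of_real (f n z) + complex_of_real (f n z))
        \<longlonglongrightarrow> 0 + complex_of_real (indicator V z)"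
      by (rule tendsto_add)
    then show ?thesis
      by (cases "z \<in> V") simp_all
  qed
  ultimately show ?thesis
    using p(1) that by blast
qed

lemma represents_measurable:
  "represents x \<sigma> \<Longrightarrow> f \<in> borel_measurable borel \<Longrightarrow> f \<in> borel_measurable \<sigma>"
  unfolding represents_def by (metis measurable_cong_sets)

lemma represents_integrable:
  fixes f :: "complex \<Rightarrow> 'b::{banach, second_countable_topology}"
  assumes \<sigma>: "represents x \<sigma>" and f: "f \<in> borel_measurable borel"
    and B: "\<And>z. z \<in> sphere 0 1 \<Longrightarrow> norm (f z) \<le> B"
  shows "integrable \<sigma> f"
proof (rule finite_measure.integrable_const_bound)
  show "finite_measure \<sigma>"
    using \<sigma> by (simp add: represents_def)
  have "AE z in \<sigma>. norm z = 1"
    using \<sigma> by (simp add: represents_def)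
  then show "AE z in \<sigma>. norm (f z) \<le> B"
    by eventually_elim (use B in auto)
qed (rule represents_measurable[OF \<sigma> f])

lemma represents_integrable_continuous:
  fixes f :: "complex \<Rightarrow> 'b::{banach, second_countable_topology}"
  assumes \<sigma>: "represents x \<sigma>" and f: "continuous_on UNIV f"
  shows "integrable \<sigma> f"
proof -
  have "compact (f ` sphere 0 1)"
    by (intro compact_continuous_image continuous_on_subset[OF f] compact_sphere) auto
  then obtain B where "\<And>z. z \<in> sphere 0 1 \<Longrightarrow> norm (f z) \<le> B"
    using compact_imp_bounded bounded_iff by (metis imageI)
  then show ?thesis
    using represents_integrable[OF \<sigma> borel_measurable_continuous_onI[OF f]] by blast
qed

lemma represents_zpow:
  assumes \<sigma>: "represents x \<sigma>"
  shows "(\<integral>z. zpow k z \<partial>\<sigma>) = cinner (upow k x) x"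
proof (cases "0 \<le> k")
  case True
  then show ?thesis
    using \<sigma> by (simp add: zpow_def upow_def represents_def)
next
  case False
  then have "(\<integral>z. zpow k z \<partial>\<sigma>) = cnj (\<integral>z. z ^ nat (- k) \<partial>\<sigma>)"
    using Bochner_Integration.integral_cnj[of \<sigma> "\<lambda>z. z ^ nat (- k)"] by (simp add: zpow_def del: Bochner_Integration.integral_cnj)
  also have "\<dots> = cnj (cinner (upow (- k) x) x)"
    using \<sigma> False by (simp add: represents_def upow_def)
  also have "\<dots> = cinner (upow 0 x) (upow (- k) x)"
    by (metis cinner_commute upow_0)
  finally show ?thesis
    unfolding cinner_upow by simp
qed

text \<open>This makes the passage from a polynomial \<open>f\<close> to the vector \<open>F x\<close> an isometry from \<open>L\<^sup>2(\<sigma>)\<close>.\<close>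

lemma trig_cinner:
  assumes \<sigma>: "represents x \<sigma>" and f: "trig f F" and g: "trig g G"
  shows "cinner (F x) (G x) = (\<integral>z. f z * cnj (g z) \<partial>\<sigma>)"
proof -
  have int: "integrable \<sigma> (\<lambda>z. f z * cnj (g z))" if "trig f F" "trig g G" for f F g G
    by (intro represents_integrable_continuous[OF \<sigma>] continuous_intros
        trig_continuous[OF that(1)] trig_continuous[OF that(2)])
  show ?thesis
    using f
  proof (induction rule: trig.induct)
    case (monomial c k)
    show ?case
      using g
    proof (induction rule: trig.induct)
      case (monomial d l)
      have "AE z in \<sigma>. norm z = 1"
        using \<sigma> by (simp add: represents_def)
      then have ae: "AE z in \<sigma>. zpow k z * cnj (zpow l z) = zpow (k - l) z"
        by eventually_elim (simp add: cnj_zpow flip: zpow_add)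
      have "(\<integral>z. zpow k z * cnj (zpow l z) \<partial>\<sigma>) = (\<integral>z. zpow (k - l) z \<partial>\<sigma>)"
        by (intro integral_cong_AE ae represents_measurable[OF \<sigma>] borel_measurable_continuous_onI
            continuous_intros continuous_zpow)
      then have "(\<integral>z. zpow k z * cnj (zpow l z) \<partial>\<sigma>) = cinner (upow k x) (upow l x)"
        by (simp add: represents_zpow[OF \<sigma>] cinner_upow)
      moreover have "(\<integral>z. c * zpow k z * cnj (d * zpow l z) \<partial>\<sigma>)
          = c * cnj d * (\<integral>z. zpow k z * cnj (zpow l z) \<partial>\<sigma>)"
        by (subst integral_mult_right_zero[symmetric]) (simp add: algebra_simps)
      ultimately show ?case
        by (simp add: cinner_simps)
    next
      case (add g1 G1 g2 G2)
      then show ?case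
        using int[OF trig.monomial add.hyps(1), of c k] int[OF trig.monomial add.hyps(2), of c k]
        by (simp add: cinner_add_right distrib_left)
    qed
  next
    case (add f1 F1 f2 F2)
    then show ?case
      using int[OF add.hyps(1) g] int[OF add.hyps(2) g] by (simp add: cinner_add_left distrib_right)
  qed
qed

lemma trig_cinner_self:
  assumes "represents x \<sigma>" "trig f F"
  shows "cinner (F x) x = (\<integral>z. f z \<partial>\<sigma>)"
  using trig_cinner[OF assms trig_const[of 1]] by (simp add: scaleC_one)

lemma trig_norm:
  assumes "represents x \<sigma>" "trig f F"
  shows "(norm (F x))\<^sup>2 = (\<integral>z. (cmod (f z))\<^sup>2 \<partial>\<sigma>)"
proof -
  have "complex_of_real ((norm (F x))\<^sup>2) = (\<integral>z. f z * cnj (f z) \<partial>\<sigma>)"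
    using trig_cinner[OF assms assms(2)] by (simp add: cinner_self)
  also have "\<dots> = complex_of_real (\<integral>z. (cmod (f z))\<^sup>2 \<partial>\<sigma>)"
    by (simp add: complex_norm_square del: of_real_power flip: integral_complex_of_real)
  finally show ?thesis
    by (simp only: of_real_eq_iff)
qed

text \<open>
  By the isometry, convergence of the polynomials in \<open>L\<^sup>2(\<sigma>)\<close> makes the vectors a Cauchy sequence.
  The limit \<open>g\<close> need not be a polynomial; it will be an indicator or the function \<open>1/(1 - z)\<close>.
\<close>

lemma trig_L2_convergent:
  assumes \<sigma>: "represents x \<sigma>" and p: "\<And>n. trig (p n) (P n)"
    and int: "\<And>n. integrable \<sigma> (\<lambda>z. (cmod (p n z - g z))\<^sup>2)"
    and lim: "(\<lambda>n. \<integral>z. (cmod (p n z - g z))\<^sup>2 \<partial>\<sigma>) \<longlonglongrightarrow> 0"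
  shows "convergent (\<lambda>n. P n x)"
proof -
  let ?e = "\<lambda>n. \<integral>z. (cmod (p n z - g z))\<^sup>2 \<partial>\<sigma>"
  have le: "(norm (P m x - P n x))\<^sup>2 \<le> 2 * ?e m + 2 * ?e n" for m n
  proof -
    have "(norm (P m x - P n x))\<^sup>2 = (\<integral>z. (cmod (p m z - p n z))\<^sup>2 \<partial>\<sigma>)"
      by (rule trig_norm[OF \<sigma> trig_diff[OF p p]])
    also have "\<dots> \<le> (\<integral>z. 2 * (cmod (p m z - g z))\<^sup>2 + 2 * (cmod (p n z - g z))\<^sup>2 \<partial>\<sigma>)"
    proof (rule integral_mono)
      show "integrable \<sigma> (\<lambda>z. (cmod (p m z - p n z))\<^sup>2)"
        by (intro represents_integrable_continuous[OF \<sigma>] continuous_intros trig_continuous[OF p])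
      show "integrable \<sigma> (\<lambda>z. 2 * (cmod (p m z - g z))\<^sup>2 + 2 * (cmod (p n z - g z))\<^sup>2)"
        using int by simp
    qed (rule norm_diff_sqr_le)
    also have "\<dots> = 2 * ?e m + 2 * ?e n"
      using int by simp
    finally show ?thesis .
  qed
  have "Cauchy (\<lambda>n. P n x)"
  proof (rule metric_CauchyI)
    fix e :: real assume e: "0 < e"
    then have "0 < e\<^sup>2 / 4"
      by simp
    from order_tendstoD(2)[OF lim this] obtain N where N: "\<And>n. N \<le> n \<Longrightarrow> ?e n < e\<^sup>2 / 4"
      by (auto simp: eventually_sequentially)
    have "dist (P m x) (P n x) < e" if "N \<le> m" "N \<le> n" for m n
    proof -
      have "(norm (P m x - P n x))\<^sup>2 < e\<^sup>2"
        using le[of m n] N[OF that(1)] N[OF that(2)] by linarith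
      then show ?thesis
        using e unfolding dist_norm by (metis less_imp_le power_less_imp_less_base)
    qed
    then show "\<exists>M. \<forall>m\<ge>M. \<forall>n\<ge>M. dist (P m x) (P n x) < e"
      by blast
  qed
  then show ?thesis
    by (simp add: Cauchy_convergent)
qed

lemma represents_dominated_convergence:
  fixes s :: "nat \<Rightarrow> complex \<Rightarrow> 'b::{banach, second_countable_topology}"
  assumes \<sigma>: "represents x \<sigma>"
    and s: "\<And>n. s n \<in> borel_measurable borel" and g: "g \<in> borel_measurable borel"
    and B: "\<And>n z. z \<in> sphere 0 1 \<Longrightarrow> norm (s n z) \<le> B"
    and lim: "\<And>z. z \<in> sphere 0 1 \<Longrightarrow> (\<lambda>n. s n z) \<longlonglongrightarrow> g z"
  shows "(\<lambda>n. \<integral>z. s n z \<partial>\<sigma>) \<longlonglongrightarrow> (\<integral>z. g z \<partial>\<sigma>)"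
proof (rule integral_dominated_convergence)
  have ae: "AE z in \<sigma>. norm z = 1"
    using \<sigma> by (simp add: represents_def)
  then show "AE z in \<sigma>. (\<lambda>n. s n z) \<longlonglongrightarrow> g z"
    by eventually_elim (use lim in auto)
  show "AE z in \<sigma>. norm (s n z) \<le> B" for n
    using ae by eventually_elim (use B in auto)
  show "integrable \<sigma> (\<lambda>_. B)"
    using \<sigma> by (intro finite_measure.integrable_const) (simp add: represents_def)
qed (use represents_measurable[OF \<sigma>] s g in auto)

lemma represents_indicator_limit:
  assumes \<sigma>: "represents x \<sigma>" and A: "A \<in> sets borel" and p: "\<And>n. trig (p n) (P n)"
    and B: "\<And>n z. z \<in> sphere 0 1 \<Longrightarrow> cmod (p n z) \<le> 2"
    and lim: "\<And>z. z \<in> sphere 0 1 \<Longrightarrow> (\<lambda>n. p n z) \<longlonglongrightarrow> indicator A z"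
  shows "(\<lambda>n. cinner (P n x) x) \<longlonglongrightarrow> complex_of_real (measure \<sigma> A)"
    and "(\<lambda>n. (norm (P n x))\<^sup>2) \<longlonglongrightarrow> measure \<sigma> A"
    and "convergent (\<lambda>n. P n x)"
proof -
  have meas: "p n \<in> borel_measurable borel" for n
    by (intro borel_measurable_continuous_onI trig_continuous[OF p])
  have [measurable]: "A \<in> sets borel" "p n \<in> borel_measurable borel" for n
    using A meas by auto
  have A_\<sigma>: "A \<in> sets \<sigma>"
    using A \<sigma> by (simp add: represents_def)
  have int: "(\<integral>z. indicator A z \<partial>\<sigma>) = measure \<sigma> A"
    using A_\<sigma> by (simp add: sets.Int_space_eq2)
  have int': "(\<integral>z. indicator A z \<partial>\<sigma>) = complex_of_real (measure \<sigma> A)"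
    unfolding int[symmetric] integral_complex_of_real[symmetric]
    by (intro Bochner_Integration.integral_cong) (auto simp: indicator_def)
  show "(\<lambda>n. cinner (P n x) x) \<longlonglongrightarrow> complex_of_real (measure \<sigma> A)"
    unfolding trig_cinner_self[OF \<sigma> p] int'[symmetric]
    by (rule represents_dominated_convergence[OF \<sigma> _ _ B lim]) measurable
  have "(\<lambda>n. \<integral>z. (cmod (p n z))\<^sup>2 \<partial>\<sigma>) \<longlonglongrightarrow> (\<integral>z. (cmod (indicator A z))\<^sup>2 \<partial>\<sigma>)"
  proof (rule represents_dominated_convergence[OF \<sigma>, where B = 4])
    show "(\<lambda>n. (cmod (p n z))\<^sup>2) \<longlonglongrightarrow> (cmod (indicator A z))\<^sup>2" if "z \<in> sphere 0 1" for z
      by (intro tendsto_intros lim that)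
    show "norm ((cmod (p n z))\<^sup>2) \<le> 4" if "z \<in> sphere 0 1" for n z
      using power_mono[OF B[OF that, of n], of 2] by simp
  qed measurable
  also have "(\<integral>z. (cmod (indicator A z))\<^sup>2 \<partial>\<sigma>) = measure \<sigma> A"
    unfolding int[symmetric] by (intro Bochner_Integration.integral_cong) (auto simp: indicator_def)
  finally show "(\<lambda>n. (norm (P n x))\<^sup>2) \<longlonglongrightarrow> measure \<sigma> A"
    unfolding trig_norm[OF \<sigma> p] .
  have bound: "(cmod (p n z - indicator A z))\<^sup>2 \<le> 9" if "z \<in> sphere 0 1" for n z
  proof -
    have "cmod (p n z - indicator A z) \<le> 2 + 1"
      by (intro order_trans[OF norm_triangle_ineq4] add_mono B that) (simp add: indicator_def)
    then show ?thesis
      using power_mono[of "cmod (p n z - indicator A z)" 3 2] by simp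
  qed
  show "convergent (\<lambda>n. P n x)"
  proof (rule trig_L2_convergent[OF \<sigma> p, where g = "indicator A"])
    show "integrable \<sigma> (\<lambda>z. (cmod (p n z - indicator A z))\<^sup>2)" for n
      by (rule represents_integrable[OF \<sigma>, where B = 9]) (use bound in \<open>auto simp: sphere_def\<close>)
    have "(\<lambda>n. \<integral>z. (cmod (p n z - indicator A z))\<^sup>2 \<partial>\<sigma>) \<longlonglongrightarrow> (\<integral>z. 0 \<partial>\<sigma>)"
    proof (rule represents_dominated_convergence[OF \<sigma>, where B = 9])
      show "(\<lambda>n. (cmod (p n z - indicator A z))\<^sup>2) \<longlonglongrightarrow> 0" if "z \<in> sphere 0 1" for z
      proof -
        have "(\<lambda>n. (cmod (p n z - indicator A z))\<^sup>2) \<longlonglongrightarrow> (cmod (indicator A z - indicator A z))\<^sup>2"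
          by (intro tendsto_intros lim that)
        then show ?thesis
          by simp
      qed
    qed (use bound in \<open>auto simp: sphere_def\<close>)
    then show "(\<lambda>n. \<integral>z. (cmod (p n z - indicator A z))\<^sup>2 \<partial>\<sigma>) \<longlonglongrightarrow> 0"
      by simp
  qed
qed

text \<open>
  The measure of an open set is the limit of the numbers \<open>\<parallel>P n x\<parallel>\<^sup>2\<close>, which do not depend on the
  measure; and open sets generate the Borel sets.
\<close>

lemma represents_unique:
  assumes \<sigma>: "represents x \<sigma>" and \<tau>: "represents x \<tau>"
  shows "\<sigma> = \<tau>"
proof (rule measure_eqI_generator_eq)
  show "Int_stable {S :: complex set. open S}"
    by (auto simp: Int_stable_def)
  show "sets \<sigma> = sigma_sets UNIV {S. open S}" "sets \<tau> = sigma_sets UNIV {S. open S}"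
    using \<sigma> \<tau> by (simp_all add: represents_def sets_borel)
  interpret \<sigma>: finite_measure \<sigma>
    using \<sigma> by (simp add: represents_def)
  interpret \<tau>: finite_measure \<tau>
    using \<tau> by (simp add: represents_def)
  show "emeasure \<sigma> ((\<lambda>_::nat. UNIV) n) \<noteq> \<infinity>" for n
    by simp
  fix X :: "complex set" assume "X \<in> {S. open S}"
  then obtain p P where p: "\<And>n. trig (p n) (P n)" "\<And>n z. z \<in> sphere 0 1 \<Longrightarrow> cmod (p n z) \<le> 2"
    "\<And>z. z \<in> sphere 0 1 \<Longrightarrow> (\<lambda>n::nat. p n z) \<longlonglongrightarrow> indicator X z" and X: "X \<in> sets borel"
    using trig_indicator[of X] by (metis mem_Collect_eq borel_open)
  have "measure \<sigma> X = measure \<tau> X"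
    using LIMSEQ_unique[OF represents_indicator_limit(2)[OF \<sigma> X p] represents_indicator_limit(2)[OF \<tau> X p]] .
  then show "emeasure \<sigma> X = emeasure \<tau> X"
    by (simp add: \<sigma>.emeasure_eq_measure \<tau>.emeasure_eq_measure)
qed auto

end

section \<open>Orthogonal projections\<close>

lemma orth_projection_clinear: "orth_projection P \<Longrightarrow> clinear P"
  by (simp add: orth_projection_def)

lemma orth_projection_idem: "orth_projection P \<Longrightarrow> P (P x) = P x"
  by (metis comp_apply orth_projection_def)

lemma orth_projection_symmetric: "orth_projection P \<Longrightarrow> cinner (P x) y = cinner x (P y)"
  by (simp add: orth_projection_def)

lemma orth_projection_form:
  "orth_projection P \<Longrightarrow> cinner (P x) x = complex_of_real ((norm (P x))\<^sup>2)"
  by (metis cinner_self orth_projection_idem orth_projection_symmetric)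

text \<open>
  A real quadratic form belongs to a symmetric operator, and then the hypothesis says that \<open>P\<close> and
  its square have the same form.
\<close>

lemma orth_projectionI:
  assumes lin: "clinear P" and form: "\<And>x. cinner (P x) x = complex_of_real ((norm (P x))\<^sup>2)"
  shows "orth_projection P"
proof -
  have sym: "cinner (P x) y = cinner x (P y)" for x y
  proof -
    have "cinner (P x) y - cinner x (P y) = 0"
    proof (rule sesquilinear_form_zero[where S = UNIV and q = "\<lambda>x y. cinner (P x) y - cinner x (P y)"])
      fix x :: 'a
      have "cinner x (P x) = cinner (P x) x"
        by (metis cinner_commute form complex_cnj_complex_of_real)
      then show "cinner (P x) x - cinner x (P x) = 0"
        by simp
    qed (simp_all add: clinear_add[OF lin] clinear_scale[OF lin] cinner_simps algebra_simps)
    then show ?thesis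
      by simp
  qed
  have "P \<circ> P = P"
  proof (rule clinear_eqI)
    show "clinear (P \<circ> P)"
      by (rule clinearI) (simp_all add: clinear_add[OF lin] clinear_scale[OF lin])
    show "cinner ((P \<circ> P) x) x = cinner (P x) x" for x
      using form[of x] sym[of "P x" x] by (simp add: cinner_self)
  qed (rule lin)
  then show ?thesis
    using lin sym by (simp add: orth_projection_def)
qed

lemma orth_projection_complement:
  assumes P: "orth_projection P"
  shows "orth_projection (\<lambda>x. x - P x)"
proof (rule orth_projectionI)
  show "clinear (\<lambda>x. x - P x)"
    using orth_projection_clinear[OF P]
    by (intro clinearI) (simp_all add: clinear_add clinear_scale scaleC_diff_right)
  show "cinner (x - P x) x = complex_of_real ((norm (x - P x))\<^sup>2)" for x
  proof -
    have "cinner x (P x) = cinner (P x) x" "cinner (P x) (P x) = cinner (P x) x"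
      using orth_projection_symmetric[OF P] orth_projection_idem[OF P] by metis+
    then show ?thesis
      unfolding cinner_self[symmetric] by (simp add: cinner_simps)
  qed
qed

lemma norm_orth_projection_le:
  assumes P: "orth_projection P" shows "norm (P x) \<le> norm x"
proof -
  have "(norm (P x))\<^sup>2 = cmod (cinner (P x) x)"
    by (simp add: orth_projection_form[OF P] norm_power)
  also have "\<dots> \<le> norm (P x) * norm x"
    by (rule norm_cinner_le)
  finally show ?thesis
    by (cases "norm (P x) = 0") (simp_all add: power2_eq_square)
qed

text \<open>
  Reflections are the device by which statements about unitary operators are applied to projections.
\<close>

lemma orth_projection_reflection:
  assumes P: "orth_projection P"
  shows "unitary (\<lambda>x. 2 *\<^sub>C P x - x)"
proof (rule unitary.intro)
  note lin = orth_projection_clinear[OF P]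
  show "clinear (\<lambda>x. 2 *\<^sub>C P x - x)"
    by (intro clinearI) (simp_all add: clinear_add[OF lin] clinear_scale[OF lin] scaleC_diff_right
        scaleC_add_right scaleC_scaleC mult.commute)
  fix x
  have "cinner x (P x) = cinner (P x) x" "cinner (P x) (P x) = cinner (P x) x"
    using orth_projection_symmetric[OF P] orth_projection_idem[OF P] by metis+
  then have "complex_of_real ((norm (2 *\<^sub>C P x - x))\<^sup>2) = complex_of_real ((norm x)\<^sup>2)"
    unfolding cinner_self[symmetric] by (simp add: cinner_simps)
  then have "(norm (2 *\<^sub>C P x - x))\<^sup>2 = (norm x)\<^sup>2"
    by (simp only: of_real_eq_iff)
  then show "norm (2 *\<^sub>C P x - x) = norm x"
    by simp
  have "2 *\<^sub>C P (2 *\<^sub>C P x - x) - (2 *\<^sub>C P x - x) = x" for x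
  proof -
    have "P (2 *\<^sub>C P x - x) = P x"
      using scaleC_add_left[of 1 1 "P x"]
      by (simp add: clinear_diff[OF lin] clinear_add[OF lin] orth_projection_idem[OF P] scaleC_one)
    then show ?thesis
      by simp
  qed
  then show "surj (\<lambda>x. 2 *\<^sub>C P x - x)"
    by (rule surjI[where f = "\<lambda>x. 2 *\<^sub>C P x - x"])
qed

text \<open>
  On the range of \<open>Q\<close> the second term already exhausts the right-hand side.
\<close>

lemma orth_projections_orthogonal:
  assumes P: "orth_projection P" and Q: "orth_projection Q"
    and le: "\<And>x. (norm (P x))\<^sup>2 + (norm (Q x))\<^sup>2 \<le> (norm x)\<^sup>2"
  shows "P (Q x) = 0"
  using le[of "Q x"] orth_projection_idem[OF Q, of x] by simp

text \<open>
  The terms are pairwise orthogonal, so by Pythagoras the series of vectors is Cauchy together with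
  the series of squared norms.
\<close>

lemma orth_projection_series:
  fixes F :: "nat \<Rightarrow> 'h::complex_hilbert \<Rightarrow> 'h"
  assumes F: "\<And>n. orth_projection (F n)"
    and orth: "\<And>m n x. m \<noteq> n \<Longrightarrow> F m (F n x) = 0"
    and sum: "\<And>x. summable (\<lambda>n. (norm (F n x))\<^sup>2)"
  shows "summable (\<lambda>n. F n x)" and "orth_projection (\<lambda>x. \<Sum>n. F n x)"
    and "(\<lambda>n. (norm (F n x))\<^sup>2) sums (norm (\<Sum>n. F n x))\<^sup>2"
proof -
  note lin = orth_projection_clinear[OF F]
  have pyth: "(norm (\<Sum>n\<in>I. F n x))\<^sup>2 = (\<Sum>n\<in>I. (norm (F n x))\<^sup>2)" if "finite I" for I x
  proof (rule norm_sum_Pythagorean[OF that])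
    show "pairwise (\<lambda>m n. orthogonal (F m x) (F n x)) I"
    proof (rule pairwiseI)
      fix m n :: nat assume "m \<noteq> n"
      then have "cinner (F m x) (F n x) = 0"
        using orth_projection_symmetric[OF F, of m x "F n x"] orth by simp
      then show "orthogonal (F m x) (F n x)"
        by (simp add: orthogonal_def inner_eq_Re_cinner)
    qed
  qed
  have summ: "summable (\<lambda>n. F n x)" for x
    unfolding summable_Cauchy
  proof (intro allI impI)
    fix e :: real assume e: "0 < e"
    then have "0 < e\<^sup>2"
      by simp
    then obtain N where N: "\<And>m n. N \<le> m \<Longrightarrow> norm (\<Sum>k=m..<n. (norm (F k x))\<^sup>2) < e\<^sup>2"
      using sum[of x] unfolding summable_Cauchy by meson
    have "norm (\<Sum>k=m..<n. F k x) < e" if "N \<le> m" for m n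
    proof -
      have "(norm (\<Sum>k=m..<n. F k x))\<^sup>2 < e\<^sup>2"
        using N[OF that, of n] by (simp add: pyth)
      then show ?thesis
        using e by (metis less_imp_le power_less_imp_less_base)
    qed
    then show "\<exists>N. \<forall>m\<ge>N. \<forall>n. norm (\<Sum>k=m..<n. F k x) < e"
      by blast
  qed
  then show "summable (\<lambda>n. F n x)" .
  have lim: "(\<lambda>n. \<Sum>k<n. F k x) \<longlonglongrightarrow> (\<Sum>n. F n x)" for x
    using summable_LIMSEQ[OF summ] .
  have sq: "(\<lambda>n. \<Sum>k<n. (norm (F k x))\<^sup>2) \<longlonglongrightarrow> (norm (\<Sum>n. F n x))\<^sup>2" for x
    using tendsto_power[OF tendsto_norm[OF lim], of x 2] by (simp add: pyth)
  then show "(\<lambda>n. (norm (F n x))\<^sup>2) sums (norm (\<Sum>n. F n x))\<^sup>2"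
    by (simp add: sums_def)
  show "orth_projection (\<lambda>x. \<Sum>n. F n x)"
  proof (rule orth_projectionI)
    show "clinear (\<lambda>x. \<Sum>n. F n x)"
    proof (rule clinearI)
      show "(\<Sum>n. F n (x + y)) = (\<Sum>n. F n x) + (\<Sum>n. F n y)" for x y
        by (simp add: clinear_add[OF lin] suminf_add[OF summ summ])
      show "(\<Sum>n. F n (c *\<^sub>C x)) = c *\<^sub>C (\<Sum>n. F n x)" for c x
        by (simp add: clinear_scale[OF lin]
            bounded_linear.suminf[OF bounded_bilinear.bounded_linear_right[OF bounded_bilinear_scaleC] summ])
    qed
    fix x
    have "(\<lambda>n. cinner (\<Sum>k<n. F k x) x) \<longlonglongrightarrow> cinner (\<Sum>n. F n x) x"
      by (intro tendsto_intros lim)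
    moreover have "cinner (\<Sum>k<n. F k x) x = complex_of_real (\<Sum>k<n. (norm (F k x))\<^sup>2)" for n
      by (simp add: cinner_sum_left orth_projection_form[OF F])
    ultimately have "(\<lambda>n. complex_of_real (\<Sum>k<n. (norm (F k x))\<^sup>2)) \<longlonglongrightarrow> cinner (\<Sum>n. F n x) x"
      by (simp only:)
    then show "cinner (\<Sum>n. F n x) x = complex_of_real ((norm (\<Sum>n. F n x))\<^sup>2)"
      by (rule LIMSEQ_unique[OF _ tendsto_of_real[OF sq]])
  qed
qed

section \<open>The spectral measure of a unitary operator\<close>

context unitary
begin

definition circle_measure :: "'h \<Rightarrow> complex measure"
  where "circle_measure x = (SOME \<sigma>. represents x \<sigma>)"

lemma represents_circle_measure: "represents x (circle_measure x)"
  unfolding circle_measure_def using represents_exists by (rule someI_ex)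

lemma circle_measure_eqI: "represents x \<sigma> \<Longrightarrow> circle_measure x = \<sigma>"
  using represents_circle_measure represents_unique by blast

lemma sets_circle_measure [simp, measurable_cong]: "sets (circle_measure x) = sets borel"
  using represents_circle_measure by (simp add: represents_def)

lemma space_circle_measure [simp]: "space (circle_measure x) = UNIV"
  using sets_eq_imp_space_eq[OF sets_circle_measure] by simp

lemma finite_circle_measure: "finite_measure (circle_measure x)"
  using represents_circle_measure by (simp add: represents_def)

lemma circle_measure_UNIV: "measure (circle_measure x) UNIV = (norm x)\<^sup>2"
proof -
  have "(\<integral>z. z ^ 0 \<partial>circle_measure x) = cinner x x"
    using represents_circle_measure[of x] unfolding represents_def by (metis funpow_0)
  then have "complex_of_real (measure (circle_measure x) UNIV) = complex_of_real ((norm x)\<^sup>2)"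
    by (simp add: cinner_self scaleR_conv_of_real)
  then show ?thesis
    by (simp only: of_real_eq_iff)
qed

lemma circle_measure_le: "measure (circle_measure x) A \<le> (norm x)\<^sup>2"
  using finite_measure.bounded_measure[OF finite_circle_measure] by (simp add: circle_measure_UNIV)

text \<open>
  A projection is determined by its quadratic form, so a set has at most one such \<open>P\<close>.
\<close>

definition is_proj :: "complex set \<Rightarrow> ('h \<Rightarrow> 'h) \<Rightarrow> bool"
  where "is_proj A P \<longleftrightarrow> orth_projection P \<and> (\<forall>x. (norm (P x))\<^sup>2 = measure (circle_measure x) A)"

lemma is_proj_unique: "is_proj A P \<Longrightarrow> is_proj A Q \<Longrightarrow> P = Q"
  unfolding is_proj_def by (metis clinear_eqI orth_projection_clinear orth_projection_form)

text \<open>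
  A strong limit of polynomials converging to the indicator of the set. The limits of the form and of
  the squared norm coincide since an indicator is its own square.
\<close>

lemma is_proj_open:
  assumes "open A" shows "\<exists>P. is_proj A P"
proof -
  obtain p P where p: "\<And>n. trig (p n) (P n)" "\<And>n z. z \<in> sphere 0 1 \<Longrightarrow> cmod (p n z) \<le> 2"
    "\<And>z. z \<in> sphere 0 1 \<Longrightarrow> (\<lambda>n::nat. p n z) \<longlonglongrightarrow> indicator A z"
    using trig_indicator[OF assms] by metis
  have A: "A \<in> sets borel"
    using assms by simp
  note lim = represents_indicator_limit[OF represents_circle_measure A p]
  obtain Q where Q: "\<And>x. (\<lambda>n. P n x) \<longlonglongrightarrow> Q x"
    using lim(3) unfolding convergent_def by metis
  have norm_Q: "(norm (Q x))\<^sup>2 = measure (circle_measure x) A" for x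
    using LIMSEQ_unique[OF tendsto_power[OF tendsto_norm[OF Q]] lim(2)] .
  have "orth_projection Q"
  proof (rule orth_projectionI)
    show "clinear Q"
    proof (rule clinearI)
      show "Q (x + y) = Q x + Q y" for x y
        using LIMSEQ_unique[OF Q[of "x + y"]] tendsto_add[OF Q[of x] Q[of y]]
        by (simp add: clinear_add[OF trig_clinear[OF p(1)]])
      show "Q (c *\<^sub>C x) = c *\<^sub>C Q x" for c x
        using LIMSEQ_unique[OF Q[of "c *\<^sub>C x"]] tendsto_scaleC[OF tendsto_const Q[of x], of c]
        by (simp add: clinear_scale[OF trig_clinear[OF p(1)]])
    qed
    show "cinner (Q x) x = complex_of_real ((norm (Q x))\<^sup>2)" for x
      unfolding norm_Q by (rule LIMSEQ_unique[OF tendsto_cinner[OF Q tendsto_const] lim(1)])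
  qed
  then show ?thesis
    using norm_Q unfolding is_proj_def by blast
qed

text \<open>
  The measure of a union of two disjoint sets is at most \<open>\<parallel>x\<parallel>\<^sup>2\<close>, which forces their projections to be
  orthogonal.
\<close>

lemma is_proj_UN:
  fixes M :: "nat \<Rightarrow> complex set"
  assumes M: "range M \<subseteq> sets borel" and dis: "disjoint_family M" and F: "\<And>n. is_proj (M n) (F n)"
  shows "is_proj (\<Union>n. M n) (\<lambda>x. \<Sum>n. F n x)" and "summable (\<lambda>n. F n x)"
proof -
  have sums: "(\<lambda>n. (norm (F n x))\<^sup>2) sums measure (circle_measure x) (\<Union>n. M n)" for x
  proof -
    interpret finite_measure "circle_measure x"
      by (rule finite_circle_measure)
    show ?thesis
      using finite_measure_UNION[OF _ dis] M F by (simp add: is_proj_def)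
  qed
  have orth: "F m (F n x) = 0" if "m \<noteq> n" for m n x
  proof (rule orth_projections_orthogonal[of "F m" "F n"])
    show "orth_projection (F m)" "orth_projection (F n)"
      using F by (simp_all add: is_proj_def)
    fix x
    interpret finite_measure "circle_measure x"
      by (rule finite_circle_measure)
    have "measure (circle_measure x) (M m \<union> M n) = measure (circle_measure x) (M m) + measure (circle_measure x) (M n)"
      using that dis M by (intro finite_measure_Union) (auto simp: disjoint_family_on_def)
    then show "(norm (F m x))\<^sup>2 + (norm (F n x))\<^sup>2 \<le> (norm x)\<^sup>2"
      using F circle_measure_le[of x "M m \<union> M n"] by (simp add: is_proj_def)
  qed
  have "orth_projection (F n)" for n
    using F by (simp add: is_proj_def)
  note series = orth_projection_series[OF this orth sums_summable[OF sums]]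
  show "is_proj (\<Union>n. M n) (\<lambda>x. \<Sum>n. F n x)"
    unfolding is_proj_def using series(2) sums_unique2[OF series(3) sums] by blast
  show "summable (\<lambda>n. F n x)"
    by (rule series(1))
qed

lemma is_proj_exists:
  assumes "A \<in> sets borel" shows "\<exists>P. is_proj A P"
proof -
  have "Int_stable {S :: complex set. open S}" "{S :: complex set. open S} \<subseteq> Pow UNIV"
    "A \<in> sigma_sets UNIV {S. open S}"
    using assms by (auto simp: Int_stable_def sets_borel)
  then show ?thesis
  proof (induction rule: sigma_sets_induct_disjoint)
    case (basic A)
    then show ?case
      using is_proj_open by simp
  next
    case empty
    then show ?case
      using is_proj_open by simp
  next
    case (compl A)
    then obtain P where P: "is_proj A P"
      by blast
    have A: "A \<in> sets borel"
      using compl by (simp add: sets_borel)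
    have orth: "orth_projection P"
      using P by (simp add: is_proj_def)
    have "(norm (x - P x))\<^sup>2 = measure (circle_measure x) (UNIV - A)" for x
    proof -
      interpret finite_measure "circle_measure x"
        by (rule finite_circle_measure)
      have "complex_of_real ((norm (x - P x))\<^sup>2) = cinner (x - P x) x"
        using orth_projection_form[OF orth_projection_complement[OF orth]] by simp
      also have "\<dots> = complex_of_real ((norm x)\<^sup>2 - (norm (P x))\<^sup>2)"
        by (simp add: cinner_diff_left orth_projection_form[OF orth] cinner_self)
      finally have "(norm (x - P x))\<^sup>2 = (norm x)\<^sup>2 - (norm (P x))\<^sup>2"
        by (simp only: of_real_eq_iff)
      then show ?thesis
        using finite_measure_compl[of A] A P by (simp add: circle_measure_UNIV is_proj_def)
    qed
    then show ?case
      using orth_projection_complement[OF orth] unfolding is_proj_def by blast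
  next
    case (union M)
    then obtain F where "\<And>n. is_proj (M n) (F n)"
      by metis
    then show ?case
      using is_proj_UN(1)[of M F] union by (auto simp: sets_borel)
  qed
qed

definition proj :: "complex set \<Rightarrow> 'h \<Rightarrow> 'h"
  where "proj A = (SOME P. is_proj A P)"

lemma is_proj_proj: "A \<in> sets borel \<Longrightarrow> is_proj A (proj A)"
  unfolding proj_def by (rule someI_ex[OF is_proj_exists])

lemma orth_projection_proj: "A \<in> sets borel \<Longrightarrow> orth_projection (proj A)"
  using is_proj_proj by (simp add: is_proj_def)

lemma norm_proj: "A \<in> sets borel \<Longrightarrow> (norm (proj A x))\<^sup>2 = measure (circle_measure x) A"
  using is_proj_proj by (simp add: is_proj_def)

lemma proj_sums:
  assumes M: "range M \<subseteq> sets borel" and dis: "disjoint_family (M :: nat \<Rightarrow> complex set)"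
  shows "(\<lambda>n. proj (M n) x) sums proj (\<Union>n. M n) x"
proof -
  have "is_proj (M n) (proj (M n))" for n
    using M by (intro is_proj_proj) auto
  note UN = is_proj_UN[OF M dis this]
  have "(\<Union>n. M n) \<in> sets borel"
    using M by auto
  then have "proj (\<Union>n. M n) = (\<lambda>x. \<Sum>n. proj (M n) x)"
    using is_proj_unique is_proj_proj UN(1) by blast
  then show ?thesis
    using UN(2) by (simp add: summable_sums)
qed

lemma proj_UNIV: "proj UNIV = id"
proof -
  have "is_proj UNIV id"
    by (auto simp: is_proj_def circle_measure_UNIV cinner_self intro!: orth_projectionI clinearI)
  then show ?thesis
    using is_proj_unique is_proj_proj[of UNIV] by auto
qed

text \<open>
  A unitary operator that commutes with \<open>U\<close> preserves all moments, hence the measures and the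
  quadratic forms of the projections.
\<close>

lemma proj_commutes:
  assumes W: "unitary W" and comm: "\<And>x. W (U x) = U (W x)" and A: "A \<in> sets borel"
  shows "proj A (W x) = W (proj A x)"
proof -
  interpret W: unitary W
    by (rule W)
  have "(U ^^ n) (W x) = W ((U ^^ n) x)" for n x
    by (induction n) (simp_all add: comm)
  then have "represents (W x) (circle_measure x)" for x
    using represents_circle_measure[of x] by (simp add: represents_def W.cinner_U)
  then have cm: "circle_measure (W x) = circle_measure x" for x
    by (rule circle_measure_eqI)
  note P = orth_projection_proj[OF A]
  interpret V: unitary "inv W"
    by (rule W.unitary_inv)
  have "inv W \<circ> proj A \<circ> W = proj A"
  proof (rule clinear_eqI)
    show "clinear (inv W \<circ> proj A \<circ> W)"
      by (rule clinearI) (simp_all add: clinear_add[OF W.lin] clinear_scale[OF W.lin]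
          clinear_add[OF V.lin] clinear_scale[OF V.lin]
          clinear_add[OF orth_projection_clinear[OF P]] clinear_scale[OF orth_projection_clinear[OF P]])
    show "clinear (proj A)"
      by (rule orth_projection_clinear[OF P])
    fix x
    have "cinner ((inv W \<circ> proj A \<circ> W) x) x = cinner (proj A (W x)) (W x)"
      using W.cinner_U[of "inv W (proj A (W x))" x] by (simp add: W.U_inv)
    also have "\<dots> = cinner (proj A x) x"
      by (simp add: orth_projection_form[OF P] norm_proj[OF A] cm)
    finally show "cinner ((inv W \<circ> proj A \<circ> W) x) x = cinner (proj A x) x" .
  qed
  then have "inv W (proj A (W x)) = proj A x"
    by (metis comp_apply)
  then show ?thesis
    using W.U_inv[of "proj A (W x)"] by simp
qed

end

section \<open>The spectral theorem\<close>

text \<open>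
  On the unit circle, away from the point \<open>1\<close>, this is the inverse of the Cayley transform: the
  number \<open>\<i>(1 + z)/(1 - z)\<close>, which is real there.
\<close>

definition cayley_inv :: "complex \<Rightarrow> real"
  where "cayley_inv z = - 2 * Im z / (cmod (1 - z))\<^sup>2"

lemma cayley_inv_measurable [measurable]: "cayley_inv \<in> borel_measurable borel"
  unfolding cayley_inv_def[abs_def] by (intro borel_measurable_divide borel_measurable_continuous_onI continuous_intros)

lemma sqr_dist_1_measurable [measurable]: "(\<lambda>z::complex. (cmod (1 - z))\<^sup>2) \<in> borel_measurable borel"
  by (intro borel_measurable_continuous_onI continuous_intros)

lemma cmod_1_minus_sqr: "cmod z = 1 \<Longrightarrow> (cmod (1 - z))\<^sup>2 = 2 * (1 - Re z)"
  using cmod_power2[of z] cmod_power2[of "1 - z"] by (simp add: power2_diff)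

lemma cayley_inv_mult: "(cmod (1 - z))\<^sup>2 * cayley_inv z = - 2 * Im z"
  by (cases "z = 1") (simp_all add: cayley_inv_def)

text \<open>
  This identity trades the square integrability of \<open>cayley_inv\<close> for that of \<open>1/(1 - z)\<close>.
\<close>

lemma cayley_inv_sqr:
  assumes z: "cmod z = 1" "z \<noteq> 1"
  shows "(cmod (1 - z))\<^sup>2 * (1 + (cayley_inv z)\<^sup>2) = 4"
proof -
  define s where "s = 1 - Re z"
  have m: "(cmod (1 - z))\<^sup>2 = 2 * s" and s: "s \<noteq> 0" and im: "(Im z)\<^sup>2 = s * (2 - s)"
  proof -
    show "(cmod (1 - z))\<^sup>2 = 2 * s"
      using cmod_1_minus_sqr[OF z(1)] by (simp add: s_def)
    then show "s \<noteq> 0"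
      using z(2) by auto
    show "(Im z)\<^sup>2 = s * (2 - s)"
      using cmod_power2[of z] z(1) by (simp add: s_def power2_eq_square algebra_simps)
  qed
  have "(cayley_inv z)\<^sup>2 = 4 * (Im z)\<^sup>2 / (2 * s)\<^sup>2"
    by (simp add: cayley_inv_def m power_divide power_mult_distrib)
  also have "4 * (Im z)\<^sup>2 / (2 * s)\<^sup>2 = (2 - s) / s"
    unfolding im using s by (simp add: power2_eq_square)
  finally have "(cayley_inv z)\<^sup>2 = (2 - s) / s" .
  then show ?thesis
    unfolding m using s by (simp add: field_simps)
qed

text \<open>
  The point \<open>r z\<close> is at least as far from \<open>1\<close> as from \<open>z\<close>.
\<close>

lemma Abel_bound:
  assumes z: "cmod z = 1" and r: "0 \<le> r" "r \<le> 1"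
  shows "cmod (1 - z) \<le> 2 * cmod (1 - of_real r * z)"
proof -
  have "cmod (1 - z) = cmod ((1 - of_real r * z) - (1 - of_real r) * z)"
    by (simp add: algebra_simps)
  also have "\<dots> \<le> cmod (1 - of_real r * z) + cmod ((1 - of_real r) * z)"
    by (rule norm_triangle_ineq4)
  also have "cmod ((1 - of_real r) * z) = 1 - r"
    using z r norm_of_real[of "1 - r", where 'a = complex] by (simp add: norm_mult)
  also have "\<dots> \<le> cmod (1 - of_real r * z)"
    using norm_triangle_ineq2[of 1 "of_real r * z"] z r by (simp add: norm_mult)
  finally show ?thesis
    by simp
qed

text \<open>
  Truncated Abel sums of the geometric series. They converge to \<open>1/(1 - z)\<close> on the punctured
  circle and, unlike the partial sums, they are dominated by a multiple of \<open>1/|1 - z|\<close>.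
\<close>

lemma Abel_sums:
  obtains r :: "nat \<Rightarrow> real" and N :: "nat \<Rightarrow> nat" where
    "\<And>n z. cmod z = 1 \<Longrightarrow> cmod ((1 - z) * (\<Sum>k<N n. (of_real (r n) * z) ^ k)) \<le> 4"
    "\<And>z. cmod z = 1 \<Longrightarrow> z \<noteq> 1 \<Longrightarrow> (\<lambda>n. \<Sum>k<N n. (of_real (r n) * z) ^ k) \<longlonglongrightarrow> 1 / (1 - z)"
proof -
  define r where "r n = 1 - 1 / real (Suc n)" for n
  have r: "0 \<le> r n" "r n < 1" for n
    by (auto simp: r_def)
  \<comment> \<open>Truncating late enough makes the remainder of the geometric series vanish in the limit.\<close>
  have "\<exists>N. r n ^ N < 1 / real (Suc n)" for n
    by (rule real_arch_pow_inv) (auto simp: r)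
  then obtain N where N: "\<And>n. r n ^ N n < 1 / real (Suc n)"
    by metis
  have r1: "r \<longlonglongrightarrow> 1"
    using tendsto_diff[OF tendsto_const LIMSEQ_Suc[OF lim_1_over_n], of "1::real"] by (simp add: r_def[abs_def])
  have rz: "cmod (of_real (r n) * z) < 1" if "cmod z = 1" for n z
    using that r by (simp add: norm_mult)
  have sum: "(\<Sum>k<N n. (of_real (r n) * z) ^ k) = (1 - (of_real (r n) * z) ^ N n) / (1 - of_real (r n) * z)"
    if "cmod z = 1" for n z
  proof -
    have "of_real (r n) * z \<noteq> 1"
      using rz[OF that, of n] by auto
    then show ?thesis
      by (simp add: sum_gp_strict)
  qed
  have pow: "cmod ((of_real (r n) * z) ^ N n) = r n ^ N n" if "cmod z = 1" for n z
    using that r by (simp add: norm_mult norm_power)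
  have "cmod ((1 - z) * (\<Sum>k<N n. (of_real (r n) * z) ^ k)) \<le> 4" if z: "cmod z = 1" for n z
  proof -
    have pos: "0 < cmod (1 - of_real (r n) * z)"
      using rz[OF z, of n] by auto
    have "cmod (1 - (of_real (r n) * z) ^ N n) \<le> 2"
      using norm_triangle_ineq4[of 1 "(of_real (r n) * z) ^ N n"] pow[OF z, of n]
        power_le_one[of "r n" "N n"] r[of n] by simp
    then have "cmod (1 - z) * cmod (1 - (of_real (r n) * z) ^ N n) \<le> (2 * cmod (1 - of_real (r n) * z)) * 2"
      using Abel_bound[OF z, of "r n"] r[of n] by (intro mult_mono) auto
    then show ?thesis
      unfolding sum[OF z] using pos by (simp add: norm_mult norm_divide pos_divide_le_eq)
  qed
  moreover have "(\<lambda>n. \<Sum>k<N n. (of_real (r n) * z) ^ k) \<longlonglongrightarrow> 1 / (1 - z)"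
    if z: "cmod z = 1" "z \<noteq> 1" for z
  proof -
    have "(\<lambda>n. (of_real (r n) * z) ^ N n) \<longlonglongrightarrow> 0"
    proof (rule Lim_null_comparison)
      show "\<forall>\<^sub>F n in sequentially. cmod ((of_real (r n) * z) ^ N n) \<le> 1 / real (Suc n)"
        unfolding pow[OF z(1)] by (intro always_eventually allI less_imp_le N)
    qed (rule LIMSEQ_Suc[OF lim_1_over_n])
    then have "(\<lambda>n. (1 - (of_real (r n) * z) ^ N n) / (1 - of_real (r n) * z)) \<longlonglongrightarrow> (1 - 0) / (1 - of_real 1 * z)"
      using z(2) by (intro tendsto_intros r1) auto
    then show ?thesis
      unfolding sum[OF z(1)] by simp
  qed
  ultimately show ?thesis
    using that by blast
qed

context selfadjoint
begin

sublocale cayley: unitary cayley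
  using clinear_cayley norm_cayley surj_cayley by (rule unitary.intro)

text \<open>
  Applying \<open>I - cayley\<close> to a vector multiplies its measure by \<open>|1 - z|\<^sup>2\<close>, as is seen on the moments.
  Since \<open>D\<close> is the range of this operator, the measures of all vectors in \<open>D\<close> have this form.
\<close>

lemma represents_range:
  assumes \<sigma>: "cayley.represents y \<sigma>"
  shows "cayley.represents (y - cayley y) (density \<sigma> (\<lambda>z. ennreal ((cmod (1 - z))\<^sup>2)))"
proof -
  have [measurable_cong]: "sets \<sigma> = sets borel"
    using \<sigma> by (simp add: cayley.represents_def)
  have cnt: "integrable \<sigma> (\<lambda>z. (cmod (1 - z))\<^sup>2)"
    by (intro cayley.represents_integrable_continuous[OF \<sigma>] continuous_intros)
  show ?thesis
    unfolding cayley.represents_def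
  proof (intro conjI allI)
    have "(\<integral>\<^sup>+z. ennreal ((cmod (1 - z))\<^sup>2) \<partial>\<sigma>) < \<infinity>"
      using cnt by (subst nn_integral_eq_integral) auto
    then show "finite_measure (density \<sigma> (\<lambda>z. ennreal ((cmod (1 - z))\<^sup>2)))"
      by (intro finite_measureI) (simp add: emeasure_density space_density cong: nn_integral_cong)
    show "AE z in density \<sigma> (\<lambda>z. ennreal ((cmod (1 - z))\<^sup>2)). norm z = 1"
      using \<sigma> by (subst AE_density) (auto simp: cayley.represents_def)
    fix n
    have t: "cayley.trig (\<lambda>z. zpow (int n) z - zpow (int n + 1) z) (\<lambda>x. cayley.upow (int n) x - cayley.upow (int n + 1) x)"
      using cayley.trig_diff[OF cayley.monomial[of 1 "int n"] cayley.monomial[of 1 "int n + 1"]]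
      by (simp add: scaleC_one)
    have t': "cayley.trig (\<lambda>z. zpow 0 z - zpow 1 z) (\<lambda>x. cayley.upow 0 x - cayley.upow 1 x)"
      using cayley.trig_diff[OF cayley.monomial[of 1 0] cayley.monomial[of 1 1]]
      by (simp add: scaleC_one)
    have zp: "zpow (int n) z = z ^ n" "zpow (int n + 1) z = z * z ^ n" "zpow 1 z = z" for n z
      by (auto simp: zpow_def nat_add_distrib)
    have up: "cayley.upow (int n) x = (cayley ^^ n) x" "cayley.upow (int n + 1) x = cayley ((cayley ^^ n) x)"
        "cayley.upow 1 x = cayley x" for n x
      by (auto simp: cayley.upow_def nat_add_distrib)
    have "(\<integral>z. z ^ n \<partial>density \<sigma> (\<lambda>z. ennreal ((cmod (1 - z))\<^sup>2))) = (\<integral>z. (cmod (1 - z))\<^sup>2 *\<^sub>R z ^ n \<partial>\<sigma>)"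
      by (intro integral_density) auto
    also have "\<dots> = (\<integral>z. (z ^ n - z * z ^ n) * cnj (1 - z) \<partial>\<sigma>)"
    proof (rule Bochner_Integration.integral_cong)
      fix z
      have "(cmod (1 - z))\<^sup>2 *\<^sub>R z ^ n = ((1 - z) * cnj (1 - z)) * z ^ n"
        unfolding complex_norm_square[symmetric] by (simp add: scaleR_conv_of_real)
      then show "(cmod (1 - z))\<^sup>2 *\<^sub>R z ^ n = (z ^ n - z * z ^ n) * cnj (1 - z)"
        by (simp add: algebra_simps)
    qed simp
    also have "\<dots> = cinner ((cayley ^^ n) y - cayley ((cayley ^^ n) y)) (y - cayley y)"
      using cayley.trig_cinner[OF \<sigma> t t'] by (simp add: zp up)
    also have "\<dots> = cinner ((cayley ^^ n) (y - cayley y)) (y - cayley y)"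
      by (simp add: clinear_diff[OF cayley.clinear_funpow] funpow_swap1)
    finally show "(\<integral>z. z ^ n \<partial>density \<sigma> (\<lambda>z. ennreal ((cmod (1 - z))\<^sup>2)))
        = cinner ((cayley ^^ n) (y - cayley y)) (y - cayley y)" .
  qed (simp add: \<open>sets \<sigma> = sets borel\<close>)
qed

lemma circle_measure_range:
  "cayley.circle_measure (y - cayley y)
    = density (cayley.circle_measure y) (\<lambda>z. ennreal ((cmod (1 - z))\<^sup>2))"
  by (intro cayley.circle_measure_eqI represents_range cayley.represents_circle_measure)

text \<open>
  The density above vanishes at \<open>1\<close>, so the projection for the point \<open>1\<close> vanishes on the dense
  set \<open>D\<close>.
\<close>

lemma circle_measure_1: "measure (cayley.circle_measure x) {1} = 0"
proof -
  let ?P = "cayley.proj {1}"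
  have P: "orth_projection ?P"
    by (rule cayley.orth_projection_proj) simp
  have D0: "?P v = 0" if v: "v \<in> D" for v
  proof -
    obtain y where y: "v = y - cayley y"
      using v D_eq_cayley by auto
    have "emeasure (cayley.circle_measure v) {1}
        = (\<integral>\<^sup>+z. ennreal ((cmod (1 - z))\<^sup>2) * indicator {1} z \<partial>cayley.circle_measure y)"
      unfolding y circle_measure_range by (intro emeasure_density) auto
    also have "\<dots> = (\<integral>\<^sup>+z. 0 \<partial>cayley.circle_measure y)"
      by (intro nn_integral_cong) (auto simp: indicator_def)
    finally have "(norm (?P v))\<^sup>2 = 0"
      by (simp add: cayley.norm_proj measure_def)
    then show ?thesis
      by simp
  qed
  have "?P x = 0"
  proof (rule dense_orthogonal_imp_zero[OF dense])
    fix v assume "v \<in> D"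
    then show "cinner v (?P x) = 0"
      using D0 orth_projection_symmetric[OF P, of v x] by simp
  qed
  then show ?thesis
    using cayley.norm_proj[of "{1}" x] by simp
qed

lemma AE_circle_measure: "AE z in cayley.circle_measure x. cmod z = 1 \<and> z \<noteq> 1"
proof -
  interpret finite_measure "cayley.circle_measure x"
    by (rule cayley.finite_circle_measure)
  have "{1} \<in> null_sets (cayley.circle_measure x)"
    using circle_measure_1[of x] by (simp add: null_sets_def emeasure_eq_measure)
  then have "AE z in cayley.circle_measure x. z \<notin> {1}"
    by (rule AE_not_in)
  moreover have "AE z in cayley.circle_measure x. cmod z = 1"
    using cayley.represents_circle_measure by (simp add: cayley.represents_def)
  ultimately show ?thesis
    by eventually_elim simp
qed

definition spectral_projection :: "real set \<Rightarrow> 'h \<Rightarrow> 'h"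
  where "spectral_projection M = cayley.proj (cayley_inv -` M)"

lemma vimage_cayley_inv: "M \<in> sets borel \<Longrightarrow> cayley_inv -` M \<in> sets borel"
  using measurable_sets[OF cayley_inv_measurable] by simp

lemma pvm_spectral_projection: "projection_valued_measure spectral_projection"
  unfolding projection_valued_measure_def
proof (intro conjI ballI allI impI)
  fix M :: "real set" assume "M \<in> sets borel"
  then show "orth_projection (spectral_projection M)"
    unfolding spectral_projection_def by (intro cayley.orth_projection_proj vimage_cayley_inv)
next
  show "spectral_projection UNIV = id"
    by (simp add: spectral_projection_def cayley.proj_UNIV)
next
  fix M :: "nat \<Rightarrow> real set" and x
  assume "range M \<subseteq> sets borel" "disjoint_family M"
  then have "range (\<lambda>n. cayley_inv -` M n) \<subseteq> sets borel" "disjoint_family (\<lambda>n. cayley_inv -` M n)"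
    using vimage_cayley_inv by (auto simp: disjoint_family_on_def)
  from cayley.proj_sums[OF this]
  show "(\<lambda>n. spectral_projection (M n) x) sums spectral_projection (\<Union>n. M n) x"
    by (simp add: spectral_projection_def vimage_UN)
qed

lemma scalar_measure_spectral_projection:
  "scalar_measure spectral_projection x = distr (cayley.circle_measure x) borel cayley_inv"
proof (rule measure_eqI)
  fix M assume "M \<in> sets (scalar_measure spectral_projection x)"
  then have M: "M \<in> sets borel"
    by simp
  interpret finite_measure "cayley.circle_measure x"
    by (rule cayley.finite_circle_measure)
  have "emeasure (scalar_measure spectral_projection x) M = ennreal ((norm (spectral_projection M x))\<^sup>2)"
    using pvm_spectral_projection M
    by (simp add: emeasure_scalar_measure orth_projection_form projection_valued_measure_def)
  also have "\<dots> = emeasure (cayley.circle_measure x) (cayley_inv -` M)"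
    by (simp add: spectral_projection_def cayley.norm_proj vimage_cayley_inv M emeasure_eq_measure)
  also have "\<dots> = emeasure (distr (cayley.circle_measure x) borel cayley_inv) M"
    using M by (simp add: emeasure_distr)
  finally show "emeasure (scalar_measure spectral_projection x) M
      = emeasure (distr (cayley.circle_measure x) borel cayley_inv) M" .
qed simp

lemma integrable_scalar_measure_iff:
  "integrable (scalar_measure spectral_projection x) (\<lambda>t. t\<^sup>2)
    \<longleftrightarrow> integrable (cayley.circle_measure x) (\<lambda>z. (cayley_inv z)\<^sup>2)"
  unfolding scalar_measure_spectral_projection by (intro integrable_distr_eq) auto

text \<open>
  The density \<open>|1 - z|\<^sup>2\<close> compensates the pole of \<open>cayley_inv\<close> at \<open>1\<close>. The second claim then
  compares \<open>a (y - U y) = \<i>(y + U y)\<close> with the first moment of \<open>y\<close>.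
\<close>

lemma D_imp_integrable:
  assumes "x \<in> D"
  shows "integrable (cayley.circle_measure x) (\<lambda>z. (cayley_inv z)\<^sup>2)"
    and "cinner (a x) x = complex_of_real (\<integral>z. cayley_inv z \<partial>cayley.circle_measure x)"
proof -
  obtain y where y: "x = y - cayley y"
    using assms D_eq_cayley by auto
  let ?\<sigma> = "cayley.circle_measure y"
  interpret finite_measure ?\<sigma>
    by (rule cayley.finite_circle_measure)
  have "integrable ?\<sigma> (\<lambda>z. (cmod (1 - z))\<^sup>2 *\<^sub>R (cayley_inv z)\<^sup>2)"
  proof (rule integrable_const_bound)
    show "AE z in ?\<sigma>. norm ((cmod (1 - z))\<^sup>2 *\<^sub>R (cayley_inv z)\<^sup>2) \<le> 4"
      using AE_circle_measure[of y]
    proof eventually_elim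
      case (elim z)
      have "(cmod (1 - z))\<^sup>2 * (cayley_inv z)\<^sup>2 = 4 - (cmod (1 - z))\<^sup>2"
        using cayley_inv_sqr[of z] elim by (simp add: distrib_left)
      then have "(cmod (1 - z))\<^sup>2 * (cayley_inv z)\<^sup>2 \<le> 4"
        by simp
      then show ?case
        by simp
    qed
  qed measurable
  then show "integrable (cayley.circle_measure x) (\<lambda>z. (cayley_inv z)\<^sup>2)"
    unfolding y circle_measure_range by (subst integrable_density) auto
  have "(\<integral>z. cayley_inv z \<partial>cayley.circle_measure x) = (\<integral>z. (cmod (1 - z))\<^sup>2 *\<^sub>R cayley_inv z \<partial>?\<sigma>)"
    unfolding y circle_measure_range by (intro integral_density) auto
  also have "\<dots> = (\<integral>z. - 2 * Im z \<partial>?\<sigma>)"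
    by (simp only: real_scaleR_def cayley_inv_mult)
  also have "\<dots> = - 2 * Im (\<integral>z. z \<partial>?\<sigma>)"
  proof -
    have "integrable ?\<sigma> (\<lambda>z. z)"
      by (intro cayley.represents_integrable_continuous[OF cayley.represents_circle_measure] continuous_intros)
    then show ?thesis
      by simp
  qed
  also have "(\<integral>z. z \<partial>?\<sigma>) = cinner (cayley y) y"
  proof -
    have "(\<integral>z. z ^ 1 \<partial>?\<sigma>) = cinner ((cayley ^^ 1) y) y"
      using cayley.represents_circle_measure[of y] unfolding cayley.represents_def by blast
    then show ?thesis
      by simp
  qed
  finally have "complex_of_real (\<integral>z. cayley_inv z \<partial>cayley.circle_measure x)
      = complex_of_real (- 2 * Im (cinner (cayley y) y))"
    by simp
  also have "\<dots> = \<i> * (cinner (cayley y) y - cnj (cinner (cayley y) y))"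
    by (simp add: complex_eq_iff)
  also have "\<dots> = cinner (\<i> *\<^sub>C (y + cayley y)) (y - cayley y)"
    by (simp add: cinner_simps cinner_self norm_cayley flip: cinner_commute) (simp add: algebra_simps)
  finally show "cinner (a x) x = complex_of_real (\<integral>z. cayley_inv z \<partial>cayley.circle_measure x)"
    unfolding y a_cayley by simp
qed

text \<open>
  The hypothesis makes \<open>1/(1 - z)\<close> square integrable, and then the vectors obtained from the Abel
  sums converge to a preimage of \<open>x\<close> under \<open>I - cayley\<close>.
\<close>

lemma integrable_imp_D:
  assumes int: "integrable (cayley.circle_measure x) (\<lambda>z. (cayley_inv z)\<^sup>2)"
  shows "x \<in> D"
proof -
  let ?\<sigma> = "cayley.circle_measure x"
  note rep = cayley.represents_circle_measure[of x]
  interpret finite_measure ?\<sigma>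
    by (rule cayley.finite_circle_measure)
  obtain r :: "nat \<Rightarrow> real" and N :: "nat \<Rightarrow> nat" where
    bound: "\<And>n z. cmod z = 1 \<Longrightarrow> cmod ((1 - z) * (\<Sum>k<N n. (of_real (r n) * z) ^ k)) \<le> 4" and
    lim: "\<And>z. cmod z = 1 \<Longrightarrow> z \<noteq> 1 \<Longrightarrow> (\<lambda>n. \<Sum>k<N n. (of_real (r n) * z) ^ k) \<longlonglongrightarrow> 1 / (1 - z)"
    using Abel_sums by blast
  define p where "p n z = (\<Sum>k<N n. of_real (r n) ^ k * zpow (int k) z)" for n z
  define P where "P n v = (\<Sum>k<N n. (of_real (r n) ^ k) *\<^sub>C cayley.upow (int k) v)" for n v
  define g where "g z = 1 / (1 - z)" for z :: complex
  have p_eq: "p n z = (\<Sum>k<N n. (of_real (r n) * z) ^ k)" for n z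
    by (simp add: p_def zpow_def power_mult_distrib)
  have trig: "cayley.trig (p n) (P n)" for n
    unfolding p_def[abs_def] P_def[abs_def] by (intro cayley.trig_sum cayley.monomial)
  have p_m [measurable]: "p n \<in> borel_measurable borel" for n
    by (intro borel_measurable_continuous_onI cayley.trig_continuous[OF trig])
  have g_m [measurable]: "g \<in> borel_measurable borel"
    unfolding g_def[abs_def] by (intro borel_measurable_divide borel_measurable_continuous_onI continuous_intros)
  have bound': "cmod ((1 - z) * p n z) \<le> 4" if "cmod z = 1" for n z
    using bound[OF that] by (simp add: p_eq)
  have dominated: "AE z in ?\<sigma>. norm ((cmod (p n z - g z))\<^sup>2) \<le> 25 * (1 + (cayley_inv z)\<^sup>2)" for n
    using AE_circle_measure[of x]
  proof eventually_elim
    case (elim z)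
    have "(1 - z) * (p n z - g z) = (1 - z) * p n z - 1"
      using elim by (simp add: g_def right_diff_distrib)
    then have "cmod (1 - z) * cmod (p n z - g z) \<le> 4 + 1"
      using norm_triangle_ineq4[of "(1 - z) * p n z" 1] bound'[of z n] elim
      by (simp flip: norm_mult)
    then have "(cmod (1 - z))\<^sup>2 * (cmod (p n z - g z))\<^sup>2 \<le> 5\<^sup>2"
      by (subst power_mult_distrib[symmetric]) (intro power_mono, auto)
    also have "\<dots> \<le> (cmod (1 - z))\<^sup>2 * (25 * (1 + (cayley_inv z)\<^sup>2))"
      using cayley_inv_sqr[of z] elim unfolding mult.left_commute[of _ 25] by simp
    finally show ?case
      using elim by (simp add: mult_le_cancel_left)
  qed
  have dom_int: "integrable ?\<sigma> (\<lambda>z. 25 * (1 + (cayley_inv z)\<^sup>2))"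
    using int by simp
  have ptw: "AE z in ?\<sigma>. (\<lambda>n. p n z) \<longlonglongrightarrow> g z"
    using AE_circle_measure[of x] by eventually_elim (use lim in \<open>auto simp: p_eq g_def\<close>)
  have "convergent (\<lambda>n. P n x)"
  proof (rule cayley.trig_L2_convergent[OF rep trig, where g = g])
    show "integrable ?\<sigma> (\<lambda>z. (cmod (p n z - g z))\<^sup>2)" for n
      by (rule Bochner_Integration.integrable_bound[OF dom_int])
        (use dominated[of n] in \<open>auto elim!: eventually_mono\<close>)
    have "(\<lambda>n. \<integral>z. (cmod (p n z - g z))\<^sup>2 \<partial>?\<sigma>) \<longlonglongrightarrow> (\<integral>z. 0 \<partial>?\<sigma>)"
    proof (rule integral_dominated_convergence[OF _ _ dom_int _ dominated])
      show "AE z in ?\<sigma>. (\<lambda>n. (cmod (p n z - g z))\<^sup>2) \<longlonglongrightarrow> 0"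
        using ptw
      proof eventually_elim
        case (elim z)
        then have "(\<lambda>n. (cmod (p n z - g z))\<^sup>2) \<longlonglongrightarrow> (cmod (g z - g z))\<^sup>2"
          by (intro tendsto_intros)
        then show ?case
          by simp
      qed
    qed measurable
    then show "(\<lambda>n. \<integral>z. (cmod (p n z - g z))\<^sup>2 \<partial>?\<sigma>) \<longlonglongrightarrow> 0"
      by simp
  qed
  then obtain y where y: "(\<lambda>n. P n x) \<longlonglongrightarrow> y"
    by (auto simp: convergent_def)
  \<comment> \<open>This is the polynomial of \<open>(I - U) p(U) - I\<close>; as it tends to zero, \<open>y\<close> is a preimage of \<open>x\<close>.\<close>
  define q where "q n z = p n z - (\<Sum>k<N n. of_real (r n) ^ k * zpow (int k + 1) z) - 1" for n z
  have q_eq: "q n z = (1 - z) * p n z - 1" for n z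
  proof -
    have "zpow (int k + 1) z = z * zpow (int k) z" for k
      by (simp add: zpow_def nat_add_distrib)
    then show ?thesis
      unfolding q_def p_def left_diff_distrib sum_distrib_left by (simp add: mult.left_commute sum_subtractf)
  qed
  have trig_q: "cayley.trig (q n) (\<lambda>v. P n v - cayley (P n v) - v)" for n
  proof -
    have "cayley (P n v) = (\<Sum>k<N n. (of_real (r n) ^ k) *\<^sub>C cayley.upow (int k + 1) v)" for v
    proof -
      have "cayley (\<Sum>k<m. (of_real (r n) ^ k) *\<^sub>C cayley.upow (int k) v)
          = (\<Sum>k<m. (of_real (r n) ^ k) *\<^sub>C cayley.upow (int k + 1) v)" for m
        by (induction m) (simp_all add: clinear_zero[OF clinear_cayley] clinear_add[OF clinear_cayley]
            clinear_scale[OF clinear_cayley] cayley.upow_add_1)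
      then show ?thesis
        by (simp add: P_def)
    qed
    then have "cayley.trig (\<lambda>z. \<Sum>k<N n. of_real (r n) ^ k * zpow (int k + 1) z) (\<lambda>v. cayley (P n v))"
      by (simp only:) (intro cayley.trig_sum cayley.monomial)
    from cayley.trig_diff[OF cayley.trig_diff[OF trig this] cayley.trig_const[of 1]]
    show ?thesis
      by (simp add: scaleC_one q_def[abs_def])
  qed
  have "(\<lambda>n. \<integral>z. (cmod (q n z))\<^sup>2 \<partial>?\<sigma>) \<longlonglongrightarrow> (\<integral>z. 0 \<partial>?\<sigma>)"
  proof (rule integral_dominated_convergence[where w = "\<lambda>_. 25"])
    show "AE z in ?\<sigma>. (\<lambda>n. (cmod (q n z))\<^sup>2) \<longlonglongrightarrow> 0"
      using ptw AE_circle_measure[of x]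
    proof eventually_elim
      case (elim z)
      then have "(\<lambda>n. (cmod ((1 - z) * p n z - 1))\<^sup>2) \<longlonglongrightarrow> (cmod ((1 - z) * g z - 1))\<^sup>2"
        by (intro tendsto_intros)
      then show ?case
        using elim by (simp add: q_eq g_def)
    qed
    show "AE z in ?\<sigma>. norm ((cmod (q n z))\<^sup>2) \<le> 25" for n
      using AE_circle_measure[of x]
    proof eventually_elim
      case (elim z)
      have "cmod (q n z) \<le> 4 + 1"
        using norm_triangle_ineq4[of "(1 - z) * p n z" 1] bound'[of z n] elim by (simp add: q_eq)
      then show ?case
        using power_mono[of "cmod (q n z)" 5 2] by simp
    qed
    show "(\<lambda>z. (cmod (q n z))\<^sup>2) \<in> borel_measurable ?\<sigma>" for n
      unfolding q_eq by measurable
  qed auto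
  then have "(\<lambda>n. (norm (P n x - cayley (P n x) - x))\<^sup>2) \<longlonglongrightarrow> 0"
    by (simp add: cayley.trig_norm[OF rep trig_q])
  then have "(\<lambda>n. sqrt ((norm (P n x - cayley (P n x) - x))\<^sup>2)) \<longlonglongrightarrow> sqrt 0"
    by (rule tendsto_real_sqrt)
  then have lim_0: "(\<lambda>n. P n x - cayley (P n x) - x) \<longlonglongrightarrow> 0"
    by (simp add: tendsto_norm_zero_iff)
  have cayley_y: "(\<lambda>n. cayley (P n x)) \<longlonglongrightarrow> cayley y"
  proof -
    have "(\<lambda>n. norm (P n x - y)) \<longlonglongrightarrow> 0"
      using y by (simp add: LIM_zero_iff tendsto_norm_zero)
    then have "(\<lambda>n. norm (cayley (P n x) - cayley y)) \<longlonglongrightarrow> 0"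
      by (simp add: norm_cayley flip: clinear_diff[OF clinear_cayley])
    then show ?thesis
      by (simp add: LIM_zero_iff tendsto_norm_zero_iff)
  qed
  have "(\<lambda>n. P n x - cayley (P n x) - x) \<longlonglongrightarrow> y - cayley y - x"
    by (intro tendsto_intros y cayley_y)
  then have "y - cayley y - x = 0"
    using lim_0 by (rule LIMSEQ_unique)
  then have "x = y - cayley y"
    by simp
  then have "x \<in> range (\<lambda>y. y - cayley y)"
    by (rule range_eqI)
  then show ?thesis
    by (rule D_eq_cayley[THEN equalityD2, THEN subsetD])
qed

end

section \<open>Projection-valued measures\<close>

context
  fixes E :: "real set \<Rightarrow> 'h::complex_hilbert \<Rightarrow> 'h"
  assumes E: "projection_valued_measure E"
begin

lemma pvm_orth_projection: "M \<in> sets borel \<Longrightarrow> orth_projection (E M)"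
  using E by (simp add: projection_valued_measure_def)

lemma pvm_clinear: "M \<in> sets borel \<Longrightarrow> clinear (E M)"
  using pvm_orth_projection orth_projection_clinear by blast

lemma pvm_emeasure:
  "M \<in> sets borel \<Longrightarrow> emeasure (scalar_measure E x) M = ennreal ((norm (E M x))\<^sup>2)"
  by (simp add: emeasure_scalar_measure[OF E] orth_projection_form[OF pvm_orth_projection])

lemma pvm_measure:
  "M \<in> sets borel \<Longrightarrow> measure (scalar_measure E x) M = (norm (E M x))\<^sup>2"
  by (simp add: measure_def pvm_emeasure)

lemma space_scalar_measure [simp]: "space (scalar_measure E x) = UNIV"
  using sets_eq_imp_space_eq[OF sets_scalar_measure, of E x] by simp

lemma pvm_finite_measure: "finite_measure (scalar_measure E x)"
  by (intro finite_measureI) (simp add: pvm_emeasure)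

lemma pvm_UNIV: "E UNIV x = x"
  using E by (simp add: projection_valued_measure_def)

lemma pvm_norm_Un:
  assumes "M \<in> sets borel" "N \<in> sets borel" "M \<inter> N = {}"
  shows "(norm (E (M \<union> N) x))\<^sup>2 = (norm (E M x))\<^sup>2 + (norm (E N x))\<^sup>2"
  using finite_measure.finite_measure_Union[OF pvm_finite_measure, of M x N] assms
  by (simp add: pvm_measure)

lemma pvm_Un:
  assumes M: "M \<in> sets borel" and N: "N \<in> sets borel" and dis: "M \<inter> N = {}"
  shows "E (M \<union> N) x = E M x + E N x"
proof -
  have "E (M \<union> N) = (\<lambda>x. E M x + E N x)"
  proof (rule clinear_eqI)
    show "clinear (E (M \<union> N))"
      using M N by (intro pvm_clinear) simp
    show "clinear (\<lambda>x. E M x + E N x)"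
      by (rule clinearI) (simp_all add: clinear_add[OF pvm_clinear] clinear_scale[OF pvm_clinear]
          M N scaleC_add_right)
    show "cinner (E (M \<union> N) x) x = cinner (E M x + E N x) x" for x
      using pvm_norm_Un[OF assms, of x] M N
      by (simp add: cinner_add_left orth_projection_form[OF pvm_orth_projection] flip: of_real_add of_real_power)
  qed
  then show ?thesis
    by simp
qed

lemma pvm_disjoint:
  assumes M: "M \<in> sets borel" and N: "N \<in> sets borel" and dis: "M \<inter> N = {}"
  shows "E M (E N x) = 0"
proof (rule orth_projections_orthogonal[of "E M" "E N"])
  fix x
  have "norm (E (M \<union> N) x) \<le> norm x"
    using M N by (intro norm_orth_projection_le pvm_orth_projection) simp
  then show "(norm (E M x))\<^sup>2 + (norm (E N x))\<^sup>2 \<le> (norm x)\<^sup>2"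
    unfolding pvm_norm_Un[OF assms, symmetric] by (intro power_mono) auto
qed (use M N pvm_orth_projection in auto)

text \<open>
  Split \<open>M\<close> and \<open>N\<close> along their intersection: projections of disjoint sets annihilate each other.
\<close>

lemma pvm_Int:
  assumes M: "M \<in> sets borel" and N: "N \<in> sets borel"
  shows "E M (E N x) = E (M \<inter> N) x"
proof -
  have "E N x = E (N \<inter> M) x + E (N - M) x" for x
    using pvm_Un[of "N \<inter> M" "N - M" x] M N by (simp add: Int_Diff_Un Int_Diff_disjoint)
  then have "E M (E N x) = E M (E (N \<inter> M) x)"
    using pvm_disjoint[of M "N - M" x] M N by (simp add: clinear_add[OF pvm_clinear])
  also have "\<dots> = E (M \<inter> N) (E (N \<inter> M) x) + E (M - N) (E (N \<inter> M) x)"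
    using pvm_Un[of "M \<inter> N" "M - N"] M N by (simp add: Int_Diff_Un Int_Diff_disjoint)
  also have "\<dots> = E (M \<inter> N) x"
    using pvm_disjoint[of "M - N" "N \<inter> M" x] M N orth_projection_idem[OF pvm_orth_projection, of "M \<inter> N"]
    by (auto simp: Int_commute)
  finally show ?thesis .
qed

lemma pvm_reflection: "M \<in> sets borel \<Longrightarrow> unitary (\<lambda>x. 2 *\<^sub>C E M x - x)"
  by (intro orth_projection_reflection pvm_orth_projection)

end

lemma commutes_with_reflection_iff:
  assumes T: "clinear T"
  shows "T (2 *\<^sub>C P x - x) = 2 *\<^sub>C P (T x) - T x \<longleftrightarrow> T (P x) = P (T x)"
  by (simp add: clinear_diff[OF T] clinear_scale[OF T])

section \<open>Uniqueness of the spectral measure\<close>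

context selfadjoint
begin

text \<open>
  The notion \<open>is_spectral_measure_of\<close> for an operator given by its domain and a total function.
\<close>

definition spectral :: "(real set \<Rightarrow> 'h \<Rightarrow> 'h) \<Rightarrow> bool"
  where "spectral E \<longleftrightarrow> projection_valued_measure E \<and>
    D = {x. integrable (scalar_measure E x) (\<lambda>t. t\<^sup>2)} \<and>
    (\<forall>x\<in>D. cinner (a x) x = complex_of_real (\<integral>t. t \<partial>scalar_measure E x))"

lemma spectral_pvm: "spectral E \<Longrightarrow> projection_valued_measure E"
  by (simp only: spectral_def)

lemma spectral_spectral_projection: "spectral spectral_projection"
  unfolding spectral_def integrable_scalar_measure_iff
proof (intro conjI ballI)
  show "D = {x. integrable (cayley.circle_measure x) (\<lambda>z. (cayley_inv z)\<^sup>2)}"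
    using D_imp_integrable(1) integrable_imp_D by blast
  fix x assume "x \<in> D"
  moreover have "(\<integral>t. t \<partial>scalar_measure spectral_projection x)
      = (\<integral>z. cayley_inv z \<partial>cayley.circle_measure x)"
    unfolding scalar_measure_spectral_projection by (intro integral_distr) auto
  ultimately show "cinner (a x) x = complex_of_real (\<integral>t. t \<partial>scalar_measure spectral_projection x)"
    using D_imp_integrable(2) by simp
qed (rule pvm_spectral_projection)

text \<open>
  Such a \<open>W\<close> preserves the scalar measures, hence \<open>D\<close> and the quadratic form of \<open>a\<close>; by
  polarization \<open>a\<close> and its conjugate by \<open>W\<close> agree.
\<close>

lemma commutes_op_unitary:
  assumes E: "spectral E" and W: "unitary W"
    and comm: "\<And>M x. M \<in> sets borel \<Longrightarrow> E M (W x) = W (E M x)"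
  shows "commutes_op W"
proof -
  interpret W: unitary W
    by (rule W)
  have pvm: "projection_valued_measure E" and D_eq: "D = {x. integrable (scalar_measure E x) (\<lambda>t. t\<^sup>2)}"
    and form: "\<And>x. x \<in> D \<Longrightarrow> cinner (a x) x = complex_of_real (\<integral>t. t \<partial>scalar_measure E x)"
    using E by (auto simp: spectral_def)
  have sm: "scalar_measure E (W x) = scalar_measure E x" for x
    by (rule measure_eqI) (simp_all add: pvm_emeasure[OF pvm] comm W.norm)
  have WD: "W x \<in> D" if "x \<in> D" for x
    using that by (simp add: D_eq sm)
  have "a (W x) = W (a x)" if x: "x \<in> D" for x
  proof -
    have eq: "cinner (a (W x)) (W y) = cinner (a x) y" if y: "y \<in> D" for y
    proof -
      have "cinner (a (W x)) (W y) - cinner (a x) y = 0"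
      proof (rule sesquilinear_form_zero[where S = D and q = "\<lambda>x y. cinner (a (W x)) (W y) - cinner (a x) y"])
        show "cinner (a (W x)) (W x) - cinner (a x) x = 0" if "x \<in> D" for x
          using that by (simp add: form WD sm)
      qed (simp_all add: subspace x y clinear_add[OF W.lin] clinear_scale[OF W.lin] add scale WD
          cinner_simps algebra_simps)
      then show ?thesis
        by simp
    qed
    obtain v where v: "a (W x) - W (a x) = W v"
      using W.surj by (metis surjD)
    have "v = 0"
    proof (rule dense_orthogonal_imp_zero[OF dense])
      fix y assume y: "y \<in> D"
      have "cinner (W v) (W y) = 0"
        unfolding v[symmetric] by (simp add: cinner_diff_left eq y W.cinner_U)
      then show "cinner y v = 0"
        by (metis W.cinner_U cinner_commute complex_cnj_zero)
    qed
    then show ?thesis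
      using v by (simp add: clinear_zero[OF W.lin])
  qed
  then show ?thesis
    unfolding commutes_op_def using WD by blast
qed

lemma commutes_op_reflection:
  assumes E: "spectral E" and N: "N \<in> sets borel"
  shows "commutes_op (\<lambda>x. 2 *\<^sub>C E N x - x)"
proof -
  have pvm: "projection_valued_measure E"
    using E by (rule spectral_pvm)
  show ?thesis
  proof (rule commutes_op_unitary[OF E pvm_reflection[OF pvm N]])
    fix M :: "real set" and x assume M: "M \<in> sets borel"
    show "E M (2 *\<^sub>C E N x - x) = 2 *\<^sub>C E N (E M x) - E M x"
      using M N by (simp add: clinear_diff[OF pvm_clinear[OF pvm]] clinear_scale[OF pvm_clinear[OF pvm]]
          pvm_Int[OF pvm] Int_commute)
  qed
qed

text \<open>
  The reflection through the range of \<open>E N\<close> maps \<open>D\<close> into itself, and \<open>E N x\<close> is the midpoint of \<open>x\<close>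
  and its reflection.
\<close>

lemma spectral_in_D:
  assumes E: "spectral E" and N: "N \<in> sets borel" and x: "x \<in> D"
  shows "E N x \<in> D"
proof -
  have "2 *\<^sub>C E N x - x \<in> D"
    using commutes_op_reflection[OF E N] x by (simp add: commutes_op_def)
  then have "(1 / 2) *\<^sub>C ((2 *\<^sub>C E N x - x) + x) \<in> D"
    using x by (intro D_scale D_add)
  then show ?thesis
    by (simp add: scaleC_scaleC scaleC_one)
qed

text \<open>
  The reflection through the range of \<open>E N\<close> is unitary and commutes with \<open>a\<close>, hence with its
  Cayley transform and the projections constructed from it.
\<close>

lemma spectral_commutes:
  assumes E: "spectral E" and N: "N \<in> sets borel" and M: "M \<in> sets borel"
  shows "E N (spectral_projection M x) = spectral_projection M (E N x)"
proof -
  let ?W = "\<lambda>x. 2 *\<^sub>C E N x - x"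
  have pvm: "projection_valued_measure E"
    using E by (rule spectral_pvm)
  have W: "unitary ?W"
    by (rule pvm_reflection[OF pvm N])
  have comm: "?W (cayley y) = cayley (?W y)" for y
    using commutes_op_iff_cayley[OF unitary.lin[OF W]] commutes_op_reflection[OF E N] by blast
  have "spectral_projection M (?W x) = ?W (spectral_projection M x)"
    unfolding spectral_projection_def
    by (rule cayley.proj_commutes[OF W]) (use comm vimage_cayley_inv[OF M] in auto)
  moreover have "clinear (spectral_projection M)"
    by (rule pvm_clinear[OF pvm_spectral_projection M])
  ultimately show ?thesis
    using commutes_with_reflection_iff by metis
qed

lemma spectral_integrable:
  assumes E: "spectral E" and x: "x \<in> D"
  shows "integrable (scalar_measure E x) (\<lambda>t. t)"
proof -
  have pvm: "projection_valued_measure E"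
    using E by (rule spectral_pvm)
  interpret finite_measure "scalar_measure E x"
    by (rule pvm_finite_measure[OF pvm])
  have "integrable (scalar_measure E x) (\<lambda>t. t\<^sup>2)"
    using E x by (auto simp: spectral_def)
  then have "integrable (scalar_measure E x) (\<lambda>t. 1 + t\<^sup>2)"
    by simp
  then show ?thesis
  proof (rule Bochner_Integration.integrable_bound)
    have "\<bar>t\<bar> \<le> 1 + t\<^sup>2" for t :: real
      using sum_squares_bound[of "\<bar>t\<bar>" 1] by (simp add: power2_eq_square)
    then show "AE t in scalar_measure E x. norm t \<le> norm (1 + t\<^sup>2)"
      by simp
  qed (simp add: measurable_ident_sets)
qed

lemma spectral_form_le:
  assumes E: "spectral E" and x: "x \<in> D" and zero: "E {c<..} x = 0"
  shows "Re (cinner (a x) x) \<le> c * (norm x)\<^sup>2"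
proof -
  have pvm: "projection_valued_measure E"
    using E by (rule spectral_pvm)
  interpret finite_measure "scalar_measure E x"
    by (rule pvm_finite_measure[OF pvm])
  have "{c<..} \<in> null_sets (scalar_measure E x)"
    using zero by (simp add: null_sets_def pvm_emeasure[OF pvm])
  then have "AE t in scalar_measure E x. t \<notin> {c<..}"
    by (rule AE_not_in)
  then have "(\<integral>t. t \<partial>scalar_measure E x) \<le> (\<integral>t. c \<partial>scalar_measure E x)"
    by (intro integral_mono_AE spectral_integrable[OF E x]) auto
  also have "\<dots> = c * (norm x)\<^sup>2"
    by (simp add: pvm_measure[OF pvm] pvm_UNIV[OF pvm] space_scalar_measure[OF pvm])
  finally show ?thesis
    using E x by (simp add: spectral_def)
qed

lemma spectral_form_ge:
  assumes E: "spectral E" and x: "x \<in> D" and zero: "E {..c} x = 0"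
  shows "c * (norm x)\<^sup>2 \<le> Re (cinner (a x) x)"
proof -
  have pvm: "projection_valued_measure E"
    using E by (rule spectral_pvm)
  interpret finite_measure "scalar_measure E x"
    by (rule pvm_finite_measure[OF pvm])
  have "{..c} \<in> null_sets (scalar_measure E x)"
    using zero by (simp add: null_sets_def pvm_emeasure[OF pvm])
  then have "AE t in scalar_measure E x. t \<notin> {..c}"
    by (rule AE_not_in)
  then have le: "(\<integral>t. c \<partial>scalar_measure E x) \<le> (\<integral>t. t \<partial>scalar_measure E x)"
    by (intro integral_mono_AE spectral_integrable[OF E x]) auto
  have "c * (norm x)\<^sup>2 = (\<integral>t. c \<partial>scalar_measure E x)"
    by (simp add: pvm_measure[OF pvm] pvm_UNIV[OF pvm] space_scalar_measure[OF pvm])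
  also note le
  finally show ?thesis
    using E x by (simp add: spectral_def)
qed

text \<open>
  On the common range of \<open>E {..p}\<close> and \<open>F {q<..}\<close> the quadratic form of \<open>a\<close> is at most \<open>p\<close>
  and at least \<open>q\<close> times the squared norm, so for \<open>p < q\<close> the range is trivial.
\<close>

lemma spectral_half_lines:
  assumes E: "spectral E" and F: "spectral F"
    and comm: "\<And>M N x. M \<in> sets borel \<Longrightarrow> N \<in> sets borel \<Longrightarrow> E M (F N x) = F N (E M x)"
    and pq: "p < q"
  shows "E {..p} (F {q<..} x) = 0"
proof (rule dense_orthogonal_imp_zero[OF dense])
  have pE: "projection_valued_measure E" and pF: "projection_valued_measure F"
    using E F spectral_pvm by blast+
  fix v assume v: "v \<in> D"
  define w where "w = E {..p} (F {q<..} v)"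
  have w_D: "w \<in> D"
    unfolding w_def using v by (intro spectral_in_D[OF E] spectral_in_D[OF F]) auto
  have "E {p<..} w = 0"
    unfolding w_def by (rule pvm_disjoint[OF pE]) auto
  moreover have "F {..q} w = 0"
  proof -
    have "w = F {q<..} (E {..p} v)"
      unfolding w_def by (rule comm) auto
    then show ?thesis
      by (simp only:) (rule pvm_disjoint[OF pF]; auto)
  qed
  ultimately have "q * (norm w)\<^sup>2 \<le> p * (norm w)\<^sup>2"
    using spectral_form_le[OF E w_D, of p] spectral_form_ge[OF F w_D, of q] by linarith
  then have "w = 0"
    using pq by (simp add: mult_le_cancel_right)
  have "cinner v (E {..p} (F {q<..} x)) = cinner (F {q<..} (E {..p} v)) x"
    using orth_projection_symmetric[OF pvm_orth_projection[OF pE], of "{..p}" v]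
      orth_projection_symmetric[OF pvm_orth_projection[OF pF], of "{q<..}" "E {..p} v" x] by simp
  also have "F {q<..} (E {..p} v) = w"
    unfolding w_def by (rule comm[symmetric]) auto
  finally show "cinner v (E {..p} (F {q<..} x)) = 0"
    using \<open>w = 0\<close> by simp
qed

lemma finite_borel_scalar_measure:
  assumes "spectral E" shows "finite_borel_measure (scalar_measure E x)"
  using pvm_finite_measure[OF spectral_pvm[OF assms]]
  by (simp add: finite_borel_measure_def finite_borel_measure_axioms_def)

text \<open>
  By the preceding lemma \<open>E {..p}\<close> is below \<open>F {..q}\<close> for every \<open>q > p\<close>. Right-continuity of the
  distribution function lets \<open>q\<close> tend to \<open>p\<close>.
\<close>

lemma spectral_cdf_le:
  assumes E: "spectral E" and F: "spectral F"
    and comm: "\<And>M N x. M \<in> sets borel \<Longrightarrow> N \<in> sets borel \<Longrightarrow> E M (F N x) = F N (E M x)"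
  shows "cdf (scalar_measure E x) p \<le> cdf (scalar_measure F x) p"
proof -
  have pE: "projection_valued_measure E" and pF: "projection_valued_measure F"
    using E F spectral_pvm by blast+
  have le: "cdf (scalar_measure E x) p \<le> cdf (scalar_measure F x) q" if pq: "p < q" for q
  proof -
    have "{..q} \<union> {q<..} = UNIV" "{..q} \<inter> {q<..} = {}"
      by auto
    then have "F {..q} x + F {q<..} x = x"
      using pvm_Un[OF pF, of "{..q}" "{q<..}" x] pvm_UNIV[OF pF] by simp
    then have "E {..p} x = E {..p} (F {..q} x) + E {..p} (F {q<..} x)"
      using clinear_add[OF pvm_clinear[OF pE], of "{..p}" "F {..q} x" "F {q<..} x"] by simp
    also have "E {..p} (F {q<..} x) = 0"
      by (rule spectral_half_lines[OF E F _ pq]) (rule comm)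
    finally have "E {..p} x = E {..p} (F {..q} x)"
      by simp
    then have "norm (E {..p} x) \<le> norm (F {..q} x)"
      using norm_orth_projection_le[OF pvm_orth_projection[OF pE], of "{..p}" "F {..q} x"] by simp
    then show ?thesis
      by (simp add: cdf_def pvm_measure[OF pE] pvm_measure[OF pF])
  qed
  show ?thesis
  proof (rule tendsto_lowerbound)
    show "(cdf (scalar_measure F x) \<longlongrightarrow> cdf (scalar_measure F x) p) (at_right p)"
      using finite_borel_measure.cdf_is_right_cont[OF finite_borel_scalar_measure[OF F]]
      by (simp add: continuous_within)
    show "\<forall>\<^sub>F q in at_right p. cdf (scalar_measure E x) p \<le> cdf (scalar_measure F x) q"
      using eventually_at_right_less by (rule eventually_mono) (rule le)
  qed simp
qed

text \<open>
  Comparing with one particular spectral measure suffices, and the constructed one has the advantage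
  of commuting with all others. Exchanging the two in the comparison of distribution functions gives
  equality.
\<close>

theorem spectral_unique:
  assumes E: "spectral E" and M: "M \<in> sets borel"
  shows "E M = spectral_projection M"
proof -
  note F = spectral_spectral_projection
  have pE: "projection_valued_measure E" and pF: "projection_valued_measure spectral_projection"
    using E F spectral_pvm by blast+
  have "scalar_measure E x = scalar_measure spectral_projection x" for x
  proof (rule cdf_unique')
    show "cdf (scalar_measure E x) = cdf (scalar_measure spectral_projection x)"
    proof (intro ext antisym)
      show "cdf (scalar_measure E x) p \<le> cdf (scalar_measure spectral_projection x) p" for p
        by (rule spectral_cdf_le[OF E F]) (rule spectral_commutes[OF E])
      show "cdf (scalar_measure spectral_projection x) p \<le> cdf (scalar_measure E x) p" for p
        by (rule spectral_cdf_le[OF F E]) (rule spectral_commutes[OF E, symmetric])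
    qed
  qed (intro finite_borel_scalar_measure E F)+
  then have "(norm (E M x))\<^sup>2 = (norm (spectral_projection M x))\<^sup>2" for x
    using pvm_measure[OF pE M, of x] pvm_measure[OF pF M, of x] by simp
  then show ?thesis
    by (intro clinear_eqI pvm_clinear pE pF M)
      (simp add: orth_projection_form[OF pvm_orth_projection[OF pE M]]
        orth_projection_form[OF pvm_orth_projection[OF pF M]])
qed

end

text \<open>
  From left to right, the reflections for \<open>b\<close> commute with the projections for \<open>a\<close>, hence with \<open>a\<close> and
  its Cayley transform; so this transform commutes with the projections for \<open>b\<close>, hence with \<open>b\<close>.
  From right to left, each Cayley transform is replaced by its projections in the same way.
\<close>

lemma spectral_projections_commute_iff:
  fixes a b :: "'h::complex_hilbert \<Rightarrow> 'h"
  assumes "selfadjoint D a" "selfadjoint D' b"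
  shows "(\<forall>M\<in>sets borel. \<forall>N\<in>sets borel. selfadjoint.spectral_projection D a M \<circ> selfadjoint.spectral_projection D' b N
      = selfadjoint.spectral_projection D' b N \<circ> selfadjoint.spectral_projection D a M)
    \<longleftrightarrow> selfadjoint.commutes_op D a (selfadjoint.cayley D' b)"
proof -
  interpret A: selfadjoint D a
    by fact
  interpret B: selfadjoint D' b
    by fact
  note pA = A.pvm_spectral_projection and pB = B.pvm_spectral_projection
  show ?thesis
  proof
    assume "\<forall>M\<in>sets borel. \<forall>N\<in>sets borel. A.spectral_projection M \<circ> B.spectral_projection N
        = B.spectral_projection N \<circ> A.spectral_projection M"
    then have comm: "A.spectral_projection M (B.spectral_projection N x)
        = B.spectral_projection N (A.spectral_projection M x)"
      if "M \<in> sets borel" "N \<in> sets borel" for M N x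
      using that by (metis comp_apply)
    have "A.cayley (B.spectral_projection N x) = B.spectral_projection N (A.cayley x)"
      if N: "N \<in> sets borel" for N x
    proof -
      let ?W = "\<lambda>x. 2 *\<^sub>C B.spectral_projection N x - x"
      have W: "unitary ?W"
        by (rule pvm_reflection[OF pB N])
      have "A.commutes_op ?W"
      proof (rule A.commutes_op_unitary[OF A.spectral_spectral_projection W])
        fix M :: "real set" and x assume M: "M \<in> sets borel"
        show "A.spectral_projection M (?W x) = ?W (A.spectral_projection M x)"
          using M N by (simp add: comm clinear_diff[OF pvm_clinear[OF pA]] clinear_scale[OF pvm_clinear[OF pA]])
      qed
      then have "?W (A.cayley x) = A.cayley (?W x)"
        using A.commutes_op_iff_cayley[OF unitary.lin[OF W]] by blast
      then show ?thesis
        using commutes_with_reflection_iff[OF A.clinear_cayley] by metis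
    qed
    then have "B.commutes_op A.cayley"
      by (intro B.commutes_op_unitary[OF B.spectral_spectral_projection A.cayley.unitary_axioms]) auto
    then show "A.commutes_op B.cayley"
      using B.commutes_op_iff_cayley[OF A.clinear_cayley] A.commutes_op_iff_cayley[OF B.clinear_cayley]
      by metis
  next
    assume "A.commutes_op B.cayley"
    then have BA: "B.cayley (A.cayley x) = A.cayley (B.cayley x)" for x
      using A.commutes_op_iff_cayley[OF B.clinear_cayley] by blast
    have AB: "A.spectral_projection M (B.cayley x) = B.cayley (A.spectral_projection M x)"
      if "M \<in> sets borel" for M x
      unfolding A.spectral_projection_def
      by (rule A.cayley.proj_commutes[OF B.cayley.unitary_axioms]) (use BA that A.vimage_cayley_inv in auto)
    have "B.spectral_projection N (A.spectral_projection M x) = A.spectral_projection M (B.spectral_projection N x)"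
      if M: "M \<in> sets borel" and N: "N \<in> sets borel" for M N x
    proof -
      let ?W = "\<lambda>x. 2 *\<^sub>C A.spectral_projection M x - x"
      have W: "unitary ?W"
        by (rule pvm_reflection[OF pA M])
      have "B.spectral_projection N (?W x) = ?W (B.spectral_projection N x)"
        unfolding B.spectral_projection_def
        by (rule B.cayley.proj_commutes[OF W])
          (simp_all add: AB M N B.vimage_cayley_inv clinear_diff[OF B.clinear_cayley]
            clinear_scale[OF B.clinear_cayley])
      then show ?thesis
        using commutes_with_reflection_iff[OF pvm_clinear[OF pB N]] by metis
    qed
    then show "\<forall>M\<in>sets borel. \<forall>N\<in>sets borel. A.spectral_projection M \<circ> B.spectral_projection N
        = B.spectral_projection N \<circ> A.spectral_projection M"
      by (auto simp: fun_eq_iff)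
  qed
qed

section \<open>From partial maps to self-adjoint operators\<close>

text \<open>
  The choice of a value in the definition of the adjoint is unambiguous because the domain is dense.
\<close>

lemma self_adjoint_selfadjoint:
  fixes A :: "'h::complex_hilbert operator"
  assumes A: "self_adjoint A"
  shows "selfadjoint (dom A) (\<lambda>x. the (A x))"
proof -
  have lin: "lin_op A" and dense: "closure (dom A) = UNIV" and adj: "op_adjoint A = A"
    using A by (auto simp: self_adjoint_def densely_defined_def)
  have adjoint: "A y = Some z" if z: "\<And>x. x \<in> dom A \<Longrightarrow> cinner (the (A x)) y = cinner x z" for y z
  proof -
    have "(THE z. \<forall>x\<in>dom A. cinner (the (A x)) y = cinner x z) = z"
    proof (rule the_equality)
      fix z' assume z': "\<forall>x\<in>dom A. cinner (the (A x)) y = cinner x z'"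
      have "z' - z = 0"
        by (rule dense_orthogonal_imp_zero[OF dense]) (use z z' in \<open>auto simp: cinner_diff_right\<close>)
      then show "z' = z"
        by simp
    qed (use z in blast)
    then have "op_adjoint A y = Some z"
      using z unfolding op_adjoint_def by auto
    then show ?thesis
      by (simp add: adj)
  qed
  show ?thesis
  proof
    show "complex_vector.subspace (dom A)"
      using lin by (simp add: lin_op_def)
    show "the (A (x + y)) = the (A x) + the (A y)" if "x \<in> dom A" "y \<in> dom A" for x y
      using lin that unfolding lin_op_def by blast
    show "the (A (c *\<^sub>C x)) = c *\<^sub>C the (A x)" if "x \<in> dom A" for c x
      using lin that unfolding lin_op_def by blast
    show "cinner (the (A x)) y = cinner x (the (A y))" if x: "x \<in> dom A" and y: "y \<in> dom A" for x y
    proof -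
      have "op_adjoint A y \<noteq> None"
        using y adj by auto
      then obtain z where z: "\<forall>x\<in>dom A. cinner (the (A x)) y = cinner x z"
        unfolding op_adjoint_def by (metis (no_types, lifting))
      then have "A y = Some z"
        by (intro adjoint) auto
      then show ?thesis
        using z x by simp
    qed
    show "y \<in> dom A \<and> the (A y) = z" if "\<And>x. x \<in> dom A \<Longrightarrow> cinner (the (A x)) y = cinner x z" for y z
      using adjoint[OF that] by auto
  qed (rule dense)
qed

lemma is_spectral_measure_of_iff:
  assumes "self_adjoint A"
  shows "is_spectral_measure_of E A \<longleftrightarrow> selfadjoint.spectral (dom A) (\<lambda>x. the (A x)) E"
  unfolding is_spectral_measure_of_def
    selfadjoint.spectral_def[OF self_adjoint_selfadjoint[OF assms]] by (rule refl)

text \<open>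
  The spectral theorem makes the choice in \<open>spectral_measure\<close> meaningful, and uniqueness identifies
  its result.
\<close>

lemma spectral_measure_eq:
  assumes A: "self_adjoint A" and M: "M \<in> sets borel"
  shows "spectral_measure A M = selfadjoint.spectral_projection (dom A) (\<lambda>x. the (A x)) M"
proof -
  interpret selfadjoint "dom A" "\<lambda>x. the (A x)"
    by (rule self_adjoint_selfadjoint[OF A])
  have "spectral (spectral_measure A)"
    unfolding spectral_measure_def is_spectral_measure_of_iff[OF A]
    by (rule someI[of spectral, OF spectral_spectral_projection])
  then show ?thesis
    using M by (rule spectral_unique)
qed

lemma strongly_commute_iff:
  assumes "self_adjoint A" "self_adjoint B"
  shows "strongly_commute A B \<longleftrightarrow> selfadjoint.commutes_op (dom A) (\<lambda>x. the (A x))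
    (selfadjoint.cayley (dom B) (\<lambda>x. the (B x)))"
  unfolding strongly_commute_def
    spectral_projections_commute_iff[OF assms[THEN self_adjoint_selfadjoint], symmetric]
  by (simp add: spectral_measure_eq assms)

lemma the_op_shift: "x \<in> dom T \<Longrightarrow> the ((T -\<^sub>I \<mu>) x) = the (T x) - \<mu> *\<^sub>C x"
  by (auto simp: op_shift_def)

lemma dom_shift_product:
  "dom ((A -\<^sub>I \<mu>) \<circ>\<^sub>m (B -\<^sub>I \<nu>)) = {x \<in> dom B. the (B x) - \<nu> *\<^sub>C x \<in> dom A}"
  by (auto simp: map_comp_def op_shift_def dom_def split: option.splits)

lemma the_shift_product:
  assumes "x \<in> dom B" "the (B x) - \<nu> *\<^sub>C x \<in> dom A"
  shows "((A -\<^sub>I \<mu>) \<circ>\<^sub>m (B -\<^sub>I \<nu>)) x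
    = Some (the (A (the (B x) - \<nu> *\<^sub>C x)) - \<mu> *\<^sub>C (the (B x) - \<nu> *\<^sub>C x))"
  using assms by (auto simp: map_comp_def op_shift_def)

lemma resolvent_set_resolvent:
  assumes A: "self_adjoint A" and \<mu>: "\<mu> \<in> resolvent_set A"
  obtains S C where "selfadjoint.is_resolvent (dom A) (\<lambda>x. the (A x)) \<mu> S" "\<And>y. norm (S y) \<le> C * norm y"
proof -
  interpret selfadjoint "dom A" "\<lambda>x. the (A x)"
    by (rule self_adjoint_selfadjoint[OF A])
  define f where "f x = the ((A -\<^sub>I \<mu>) x)" for x
  have bij: "bij_betw f (dom A) UNIV"
    using \<mu> by (simp add: resolvent_set_def f_def[abs_def])
  obtain C where C: "\<And>x. x \<in> dom A \<Longrightarrow> norm x \<le> C * norm (f x)"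
    using \<mu> by (auto simp: resolvent_set_def f_def)
  define S where "S = the_inv_into (dom A) f"
  have S: "S y \<in> dom A" "f (S y) = y" for y
    using the_inv_into_into[of f "dom A" y "dom A"] f_the_inv_into_f[of f "dom A" y] bij
    by (auto simp: bij_betw_def S_def)
  have left: "S (f x) = x" if "x \<in> dom A" for x
    using that bij by (simp add: S_def the_inv_into_f_f bij_betw_def)
  have f: "f x = the (A x) - \<mu> *\<^sub>C x" if "x \<in> dom A" for x
    using that by (simp add: f_def the_op_shift)
  have "is_resolvent \<mu> S"
    unfolding is_resolvent_def
  proof (intro conjI allI ballI)
    show "S y \<in> dom A" for y
      by (rule S(1))
    show "the (A (S y)) - \<mu> *\<^sub>C S y = y" for y
      unfolding f[OF S(1), symmetric] by (rule S(2))
    show "S (the (A x) - \<mu> *\<^sub>C x) = x" if "x \<in> dom A" for x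
      unfolding f[OF that, symmetric] by (rule left[OF that])
  qed
  moreover have "norm (S y) \<le> C * norm y" for y
    using C[OF S(1), of y] by (simp add: S(2))
  ultimately show ?thesis
    using that by blast
qed

section \<open>Products of commuting self-adjoint operators\<close>

context selfadjoint
begin

text \<open>
  Yosida approximation: on \<open>D\<close> the error \<open>-\<i>n(a - \<i>n)\<^sup>-\<^sup>1y - y\<close> equals \<open>-(a - \<i>n)\<^sup>-\<^sup>1 a y\<close>, which is
  at most \<open>\<parallel>a y\<parallel>/n\<close> in norm, and density gives the rest.
\<close>

lemma yosida_approximation:
  obtains \<mu> :: "nat \<Rightarrow> complex" and S :: "nat \<Rightarrow> 'h \<Rightarrow> 'h" where
    "\<And>n. is_resolvent (\<mu> n) (S n)" "\<And>y. (\<lambda>n. (- \<mu> n) *\<^sub>C S n y) \<longlonglongrightarrow> y"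
proof -
  define \<mu> :: "nat \<Rightarrow> complex" where "\<mu> n = \<i> * of_nat (Suc n)" for n
  have \<mu>: "Re (\<mu> n) = 0" "\<mu> n \<noteq> 0" "cmod (\<mu> n) = real (Suc n)" for n
    by (simp_all add: \<mu>_def norm_mult del: of_nat_Suc)
  obtain S where S: "\<And>n. is_resolvent (\<mu> n) (S n)"
    using imaginary_resolvent[OF \<mu>(1,2)] by metis
  have S_D: "S n y \<in> D" and S_right: "a (S n y) - \<mu> n *\<^sub>C S n y = y" for n y
    using S by (auto simp: is_resolvent_def)
  have S_left: "S n (a x - \<mu> n *\<^sub>C x) = x" if "x \<in> D" for n x
    using S that by (auto simp: is_resolvent_def)
  note lin = clinear_resolvent[OF S]
  have bound: "real (Suc n) * norm (S n y) \<le> norm y" for n y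
    using imaginary_shift_bound(1)[OF S_D[of n y] \<mu>(1)[of n]] by (simp add: S_right \<mu>(3))
  define J where "J n y = (- \<mu> n) *\<^sub>C S n y" for n y
  have J_bound: "norm (J n y) \<le> norm y" for n y
    using bound[of n y] by (simp only: J_def norm_scaleC norm_minus_cancel \<mu>(3))
  have J_diff: "J n (x - y) = J n x - J n y" for n x y
    by (simp add: J_def clinear_diff[OF lin] scaleC_diff_right)
  have J_error: "norm (J n y - y) \<le> norm (a y) / real (Suc n)" if y: "y \<in> D" for n y
  proof -
    have "S n (a y) = S n (a y - \<mu> n *\<^sub>C y) + \<mu> n *\<^sub>C S n y"
      by (simp add: clinear_diff[OF lin] clinear_scale[OF lin])
    then have "J n y - y = - S n (a y)"
      using S_left[OF y] by (simp add: J_def scaleC_minus_left)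
    then show ?thesis
      using bound[of n "a y"] by (simp add: pos_le_divide_eq mult.commute)
  qed
  have "(\<lambda>n. J n y) \<longlonglongrightarrow> y" for y
  proof (rule metric_LIMSEQ_I)
    fix e :: real assume e: "0 < e"
    obtain x where x: "x \<in> D" "dist x y < e / 3"
      using dense e closure_approachable[of y D] by (metis UNIV_I divide_pos_pos zero_less_numeral)
    obtain N where N: "3 * norm (a x) / e < real N"
      using reals_Archimedean2 by blast
    have "dist (J n y) y < e" if "N \<le> n" for n
    proof -
      have "3 * norm (a x) < e * real N"
        using N e by (simp add: pos_divide_less_eq mult.commute)
      also have "\<dots> \<le> e * real (Suc n)"
        using e that by (intro mult_left_mono) auto
      finally have "norm (a x) / real (Suc n) < e / 3"
        by (simp add: pos_divide_less_eq del: of_nat_Suc)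
      then have "norm (J n x - x) < e / 3"
        using J_error[OF x(1), of n] by linarith
      moreover have "norm (J n (x - y)) < e / 3" "norm (x - y) < e / 3"
        using J_bound[of n "x - y"] x(2) by (simp_all add: dist_norm)
      moreover have "J n y - y = (J n x - x) - J n (x - y) + (x - y)"
        by (simp add: J_diff)
      then have "norm (J n y - y) \<le> norm (J n x - x) + norm (J n (x - y)) + norm (x - y)"
        using norm_triangle_ineq[of "(J n x - x) - J n (x - y)" "x - y"]
          norm_triangle_ineq4[of "J n x - x" "J n (x - y)"] by simp
      ultimately show ?thesis
        unfolding dist_norm by linarith
    qed
    then show "\<exists>N. \<forall>n\<ge>N. dist (J n y) y < e"
      by blast
  qed
  then show ?thesis
    by (intro that[of \<mu> S] S) (simp add: J_def)
qed

end

locale commuting_selfadjoint = A: selfadjoint D a + B: selfadjoint D' b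
  for D D' :: "'h::complex_hilbert set" and a b +
  fixes C :: "'h set"
  assumes dense_C: "closure C = UNIV"
    and C: "y \<in> C \<Longrightarrow> y \<in> D \<and> y \<in> D' \<and> b y \<in> D \<and> a y \<in> D' \<and> a (b y) = b (a y)"
begin

lemma commuting_swap: "commuting_selfadjoint D' D b a C"
  by unfold_locales (use dense_C C in auto)

text \<open>
  By symmetry the inner product of \<open>a (b x) - b (a x)\<close> with \<open>y\<close> in \<open>C\<close> equals that of \<open>x\<close> with
  \<open>b (a y) - a (b y) = 0\<close>.
\<close>

lemma products_agree:
  assumes x: "x \<in> D" "x \<in> D'" "b x \<in> D" "a x \<in> D'"
  shows "a (b x) = b (a x)"
proof -
  have "a (b x) - b (a x) = 0"
  proof (rule dense_orthogonal_imp_zero[OF dense_C])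
    fix y assume y: "y \<in> C"
    have "cinner (a (b x) - b (a x)) y = cinner x (b (a y)) - cinner x (a (b y))"
      using C[OF y] x by (simp add: cinner_diff_left A.symmetric B.symmetric)
    then have "cinner (a (b x) - b (a x)) y = 0"
      using C[OF y] by simp
    then show "cinner y (a (b x) - b (a x)) = 0"
      by (metis cinner_commute complex_cnj_zero)
  qed
  then show ?thesis
    by simp
qed

lemma shifted_products_agree:
  assumes x: "x \<in> D'" "b x - \<beta> *\<^sub>C x \<in> D" "x \<in> D" "a x - \<gamma> *\<^sub>C x \<in> D'"
  shows "a (b x - \<beta> *\<^sub>C x) - \<gamma> *\<^sub>C (b x - \<beta> *\<^sub>C x) = b (a x - \<gamma> *\<^sub>C x) - \<beta> *\<^sub>C (a x - \<gamma> *\<^sub>C x)"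
proof -
  have bx: "b x \<in> D"
    using A.D_add[OF x(2) A.D_scale[OF x(3), of \<beta>]] by simp
  have ax: "a x \<in> D'"
    using B.D_add[OF x(4) B.D_scale[OF x(1), of \<gamma>]] by simp
  have "a (b x - \<beta> *\<^sub>C x) = a (b x) - \<beta> *\<^sub>C a x" "b (a x - \<gamma> *\<^sub>C x) = b (a x) - \<gamma> *\<^sub>C b x"
    using x bx ax by (simp_all add: A.diff A.D_scale A.scale B.diff B.D_scale B.scale)
  then show ?thesis
    using products_agree[OF x(3,1) bx ax]
    by (simp add: scaleC_diff_right scaleC_scaleC algebra_simps)
qed

text \<open>
  For \<open>y\<close> in \<open>D\<close> the inclusion applies to \<open>x = S y\<close>, whose image under \<open>b - \<beta>\<close> is \<open>y\<close>. There the
  two products agree, which says that \<open>S\<close> intertwines the values of \<open>a\<close> at \<open>x\<close> and \<open>y\<close>.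
\<close>

lemma product_domains_subset_iff:
  assumes S: "B.is_resolvent \<beta> S"
  shows "{x \<in> D'. b x - \<beta> *\<^sub>C x \<in> D} \<subseteq> {x \<in> D. a x - \<gamma> *\<^sub>C x \<in> D'} \<longleftrightarrow> A.commutes_op S"
proof -
  have S_D: "S y \<in> D'" and S_right: "b (S y) - \<beta> *\<^sub>C S y = y" for y
    using S by (auto simp: B.is_resolvent_def)
  have S_left: "S (b x - \<beta> *\<^sub>C x) = x" if "x \<in> D'" for x
    using S that by (auto simp: B.is_resolvent_def)
  show ?thesis
  proof
    assume sub: "{x \<in> D'. b x - \<beta> *\<^sub>C x \<in> D} \<subseteq> {x \<in> D. a x - \<gamma> *\<^sub>C x \<in> D'}"
    show "A.commutes_op S"
      unfolding A.commutes_op_def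
    proof
      fix y assume y: "y \<in> D"
      define x where "x = S y"
      have x: "x \<in> D'" "b x - \<beta> *\<^sub>C x = y"
        by (simp_all add: x_def S_D S_right)
      then have x': "x \<in> D" "a x - \<gamma> *\<^sub>C x \<in> D'"
        using sub y by auto
      have ax: "a x \<in> D'"
        using B.D_add[OF x'(2) B.D_scale[OF x(1), of \<gamma>]] by simp
      have "a y = b (a x) - \<beta> *\<^sub>C a x"
        using shifted_products_agree[of x \<beta> 0] x x' y ax by simp
      then have "S (a y) = a x"
        using S_left[OF ax] by simp
      then show "S y \<in> D \<and> a (S y) = S (a y)"
        using x' by (simp add: x_def)
    qed
  next
    assume comm: "A.commutes_op S"
    show "{x \<in> D'. b x - \<beta> *\<^sub>C x \<in> D} \<subseteq> {x \<in> D. a x - \<gamma> *\<^sub>C x \<in> D'}"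
    proof
      fix x assume "x \<in> {x \<in> D'. b x - \<beta> *\<^sub>C x \<in> D}"
      then have x: "x \<in> D'" "b x - \<beta> *\<^sub>C x \<in> D"
        by auto
      have "x \<in> D \<and> a x = S (a (b x - \<beta> *\<^sub>C x))"
        using comm x(2) S_left[OF x(1)] unfolding A.commutes_op_def by metis
      then show "x \<in> {x \<in> D. a x - \<gamma> *\<^sub>C x \<in> D'}"
        using S_D x(1) by (auto intro!: B.D_diff B.D_scale)
    qed
  qed
qed

text \<open>
  Commutation of two everywhere defined operators is symmetric, which lets the roles of \<open>a\<close> and \<open>b\<close>
  be exchanged at the level of Cayley transforms and resolvents.
\<close>

lemma commutes_op_cayley_iff_resolvent:
  assumes S: "B.is_resolvent \<beta> S"
  shows "A.commutes_op B.cayley \<longleftrightarrow> A.commutes_op S"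
proof -
  have "A.commutes_op B.cayley \<longleftrightarrow> B.commutes_op A.cayley"
    unfolding A.commutes_op_iff_cayley[OF B.clinear_cayley] B.commutes_op_iff_cayley[OF A.clinear_cayley]
    by metis
  also have "\<dots> \<longleftrightarrow> A.commutes_op S"
    unfolding A.commutes_op_iff_cayley[OF B.clinear_resolvent[OF S]]
      B.commutes_op_iff_resolvent[OF S A.clinear_cayley] by metis
  finally show ?thesis .
qed

lemma product_domains_eq:
  assumes R: "A.is_resolvent \<alpha> R" and S: "B.is_resolvent \<beta> S" and comm: "A.commutes_op S"
  shows "{x \<in> D'. b x - \<beta> *\<^sub>C x \<in> D} = {x \<in> D. a x - \<alpha> *\<^sub>C x \<in> D'}"
proof
  show "{x \<in> D'. b x - \<beta> *\<^sub>C x \<in> D} \<subseteq> {x \<in> D. a x - \<alpha> *\<^sub>C x \<in> D'}"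
    using product_domains_subset_iff[OF S] comm by blast
  have "B.commutes_op R"
    using comm unfolding B.commutes_op_iff_resolvent[OF S A.clinear_resolvent[OF R]]
      A.commutes_op_iff_resolvent[OF R B.clinear_resolvent[OF S]] by metis
  then show "{x \<in> D. a x - \<alpha> *\<^sub>C x \<in> D'} \<subseteq> {x \<in> D'. b x - \<beta> *\<^sub>C x \<in> D}"
    using commuting_selfadjoint.product_domains_subset_iff[OF commuting_swap R] by blast
qed

definition product_graph :: "complex \<Rightarrow> complex \<Rightarrow> ('h \<times> 'h) set"
  where "product_graph \<gamma> \<beta> = {(x, a (b x - \<beta> *\<^sub>C x) - \<gamma> *\<^sub>C (b x - \<beta> *\<^sub>C x)) | x. x \<in> D' \<and> b x - \<beta> *\<^sub>C x \<in> D}"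

text \<open>The product is closable because its adjoint is defined on the dense set \<open>C\<close>.\<close>

lemma product_closable: "single_valued (closure (product_graph \<gamma> \<beta>))"
proof (rule single_valuedI)
  define T where "T y = b (a y - cnj \<gamma> *\<^sub>C y) - cnj \<beta> *\<^sub>C (a y - cnj \<gamma> *\<^sub>C y)" for y
  have adj: "cinner w y = cinner x (T y)" if xw: "(x, w) \<in> closure (product_graph \<gamma> \<beta>)" and y: "y \<in> C" for x w y
  proof -
    obtain f where f: "\<And>n. f n \<in> product_graph \<gamma> \<beta>" "f \<longlonglongrightarrow> (x, w)"
      using xw unfolding closure_sequential by blast
    have eq: "cinner (snd (f n)) y = cinner (fst (f n)) (T y)" for n
    proof -
      obtain u where u: "u \<in> D'" "b u - \<beta> *\<^sub>C u \<in> D"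
        and fn: "f n = (u, a (b u - \<beta> *\<^sub>C u) - \<gamma> *\<^sub>C (b u - \<beta> *\<^sub>C u))"
        using f(1)[of n] by (auto simp: product_graph_def)
      have z: "a y - cnj \<gamma> *\<^sub>C y \<in> D'"
        using C[OF y] by (intro B.D_diff B.D_scale) auto
      have "cinner (a (b u - \<beta> *\<^sub>C u) - \<gamma> *\<^sub>C (b u - \<beta> *\<^sub>C u)) y = cinner (b u - \<beta> *\<^sub>C u) (a y - cnj \<gamma> *\<^sub>C y)"
        using A.symmetric[OF u(2), of y] C[OF y] by (simp only: cinner_diff_left[of "a _"] cinner_diff_right cinner_scaleC_left cinner_scaleC_right complex_cnj_cnj)
      also have "\<dots> = cinner u (T y)"
        using B.symmetric[OF u(1) z] unfolding T_def
        by (simp only: cinner_diff_left[of "b u"] cinner_diff_right[of u "b _"] cinner_scaleC_left cinner_scaleC_right complex_cnj_cnj)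
      finally show ?thesis
        by (simp add: fn)
    qed
    have "(\<lambda>n. cinner (snd (f n)) y) \<longlonglongrightarrow> cinner w y" "(\<lambda>n. cinner (fst (f n)) (T y)) \<longlonglongrightarrow> cinner x (T y)"
      using tendsto_fst[OF f(2)] tendsto_snd[OF f(2)] by (auto intro!: tendsto_intros)
    then show ?thesis
      unfolding eq by (rule LIMSEQ_unique)
  qed
  fix x w w' assume w: "(x, w) \<in> closure (product_graph \<gamma> \<beta>)" "(x, w') \<in> closure (product_graph \<gamma> \<beta>)"
  have "w - w' = 0"
  proof (rule dense_orthogonal_imp_zero[OF dense_C])
    fix y assume "y \<in> C"
    then have "cinner (w - w') y = 0"
      using adj w by (simp add: cinner_diff_left)
    then show "cinner y (w - w') = 0"
      by (metis cinner_commute complex_cnj_zero)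
  qed
  then show "w = w'"
    by simp
qed

text \<open>
  When \<open>S\<close> commutes with \<open>a\<close>, the product in the other order is a closed extension. It is the
  closure because the Yosida approximations of \<open>b\<close> map its domain into the smaller one and commute
  with the product.
\<close>

lemma closure_product_domain:
  assumes S: "B.is_resolvent \<beta> S" and S_bound: "\<And>y. norm (S y) \<le> K * norm y" and comm: "A.commutes_op S"
  shows "Domain (closure (product_graph \<gamma> \<beta>)) = {x \<in> D. a x - \<gamma> *\<^sub>C x \<in> D'}"
proof (intro equalityI subsetI)
  have S_D: "S y \<in> D'" for y
    using S by (auto simp: B.is_resolvent_def)
  have S_left: "S (b x - \<beta> *\<^sub>C x) = x" if "x \<in> D'" for x
    using S that by (auto simp: B.is_resolvent_def)
  note S_lin = B.clinear_resolvent[OF S]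
  fix x assume "x \<in> Domain (closure (product_graph \<gamma> \<beta>))"
  then obtain w f where f: "\<And>n. f n \<in> product_graph \<gamma> \<beta>" "f \<longlonglongrightarrow> (x, w)"
    unfolding closure_sequential by (metis DomainE closure_sequential)
  let ?x = "\<lambda>n. fst (f n)" and ?w = "\<lambda>n. snd (f n)"
  have xw: "?x \<longlonglongrightarrow> x" "?w \<longlonglongrightarrow> w"
    using tendsto_fst[OF f(2)] tendsto_snd[OF f(2)] by simp_all
  have eq: "?x n \<in> D \<and> a (?x n) = S (?w n) + \<gamma> *\<^sub>C ?x n" for n
  proof -
    obtain u where u: "u \<in> D'" "b u - \<beta> *\<^sub>C u \<in> D"
      and fn: "f n = (u, a (b u - \<beta> *\<^sub>C u) - \<gamma> *\<^sub>C (b u - \<beta> *\<^sub>C u))"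
      using f(1)[of n] by (auto simp: product_graph_def)
    have "S (b u - \<beta> *\<^sub>C u) \<in> D \<and> a (S (b u - \<beta> *\<^sub>C u)) = S (a (b u - \<beta> *\<^sub>C u))"
      using comm u(2) unfolding A.commutes_op_def by blast
    then show ?thesis
      unfolding S_left[OF u(1)] fn fst_conv snd_conv clinear_diff[OF S_lin, of "a _"] clinear_scale[OF S_lin]
      by simp
  qed
  have "(\<lambda>n. S (?w n)) \<longlonglongrightarrow> S w"
  proof -
    have "(\<lambda>n. K * norm (?w n - w)) \<longlonglongrightarrow> K * 0"
      using xw(2) by (intro tendsto_intros) (simp add: LIM_zero_iff tendsto_norm_zero)
    then have "(\<lambda>n. K * norm (?w n - w)) \<longlonglongrightarrow> 0"
      by simp
    moreover have "\<forall>\<^sub>F n in sequentially. norm (S (?w n) - S w) \<le> K * norm (?w n - w)"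
      using S_bound by (intro always_eventually allI) (simp flip: clinear_diff[OF S_lin])
    ultimately have "(\<lambda>n. S (?w n) - S w) \<longlonglongrightarrow> 0"
      by (rule Lim_null_comparison[rotated])
    then show ?thesis
      by (simp add: LIM_zero_iff)
  qed
  then have "(\<lambda>n. S (?w n) + \<gamma> *\<^sub>C ?x n) \<longlonglongrightarrow> S w + \<gamma> *\<^sub>C x"
    by (intro tendsto_intros xw)
  then have "(\<lambda>n. a (?x n)) \<longlonglongrightarrow> S w + \<gamma> *\<^sub>C x"
    using eq by simp
  then have "x \<in> D \<and> a x = S w + \<gamma> *\<^sub>C x"
    using A.closed_graph[of ?x x] eq xw(1) by blast
  then show "x \<in> {x \<in> D. a x - \<gamma> *\<^sub>C x \<in> D'}"
    using S_D by simp
next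
  fix x assume "x \<in> {x \<in> D. a x - \<gamma> *\<^sub>C x \<in> D'}"
  then have x: "x \<in> D" "a x - \<gamma> *\<^sub>C x \<in> D'"
    by auto
  define z where "z = a x - \<gamma> *\<^sub>C x"
  define w where "w = b z - \<beta> *\<^sub>C z"
  obtain \<mu> R where R': "\<And>n. B.is_resolvent (\<mu> n) (R n)"
    and lim: "\<And>y. (\<lambda>n. (- \<mu> n) *\<^sub>C R n y) \<longlonglongrightarrow> y"
    using B.yosida_approximation by blast
  define J where "J n y = (- \<mu> n) *\<^sub>C R n y" for n y
  have J_lim: "(\<lambda>n. J n y) \<longlonglongrightarrow> y" for y
    unfolding J_def by (rule lim)
  note R_lin = B.clinear_resolvent[OF R']
  have R_D: "R n y \<in> D'" and R_right: "b (R n y) = y + \<mu> n *\<^sub>C R n y" for n y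
    using R'[of n] by (auto simp: B.is_resolvent_def diff_eq_eq)
  have R_left: "R n (b y - \<mu> n *\<^sub>C y) = y" if "y \<in> D'" for n y
    using R'[of n] that by (auto simp: B.is_resolvent_def)
  have J_D: "J n y \<in> D'" for n y
    unfolding J_def by (intro B.D_scale R_D)
  have J_lin: "clinear (J n)" for n
    by (rule clinearI) (simp_all add: J_def clinear_add[OF R_lin] clinear_scale[OF R_lin]
        scaleC_add_right scaleC_scaleC mult.commute)
  have Jb: "b (J n y) = (- \<mu> n) *\<^sub>C y + \<mu> n *\<^sub>C J n y" for n y
    by (simp only: J_def B.scale[OF R_D] R_right scaleC_add_right scaleC_scaleC mult.commute)
  have bJ: "b (J n y) = J n (b y)" if "y \<in> D'" for n y
  proof -
    have "J n (b y) = (- \<mu> n) *\<^sub>C R n (b y - \<mu> n *\<^sub>C y) + \<mu> n *\<^sub>C J n y"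
      by (simp add: J_def clinear_diff[OF R_lin] clinear_scale[OF R_lin] scaleC_diff_right
          scaleC_minus_left scaleC_scaleC)
    then show ?thesis
      by (simp add: R_left[OF that] Jb)
  qed
  have J_a: "J n y \<in> D" "a (J n y) = J n (a y)" if y: "y \<in> D" for n y
  proof -
    have "A.commutes_op (R n)"
      using comm commutes_op_cayley_iff_resolvent[OF S] commutes_op_cayley_iff_resolvent[OF R'] by blast
    then have *: "R n y \<in> D" "a (R n y) = R n (a y)"
      using y by (auto simp: A.commutes_op_def)
    show "J n y \<in> D"
      unfolding J_def by (intro A.D_scale *)
    show "a (J n y) = J n (a y)"
      unfolding J_def A.scale[OF *(1)] *(2) ..
  qed
  have mem: "(J n x, J n w) \<in> product_graph \<gamma> \<beta>" for n
  proof -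
    have dom: "b (J n x) - \<beta> *\<^sub>C J n x \<in> D"
      unfolding Jb by (intro A.D_diff A.D_add A.D_scale J_a x)
    have Jz: "a (J n x) - \<gamma> *\<^sub>C J n x = J n z"
      by (simp add: z_def J_a x clinear_diff[OF J_lin] clinear_scale[OF J_lin])
    have "a (b (J n x) - \<beta> *\<^sub>C J n x) - \<gamma> *\<^sub>C (b (J n x) - \<beta> *\<^sub>C J n x)
        = b (a (J n x) - \<gamma> *\<^sub>C J n x) - \<beta> *\<^sub>C (a (J n x) - \<gamma> *\<^sub>C J n x)"
      by (rule shifted_products_agree[OF J_D dom J_a(1)[OF x(1)]]) (simp only: Jz J_D)
    also have "\<dots> = J n w"
      unfolding Jz w_def using x(2) by (simp add: bJ z_def[symmetric] clinear_diff[OF J_lin] clinear_scale[OF J_lin])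
    finally show ?thesis
      unfolding product_graph_def using J_D dom by (intro CollectI exI[of _ "J n x"]) simp
  qed
  have "(x, w) \<in> closure (product_graph \<gamma> \<beta>)"
    unfolding closure_sequential
    using mem tendsto_Pair[OF J_lim[of x] J_lim[of w]] by (intro exI[of _ "\<lambda>n. (J n x, J n w)"]) simp
  then show "x \<in> Domain (closure (product_graph \<gamma> \<beta>))"
    by blast
qed

end

theorem theorem2:
  fixes A B :: "'h::complex_hilbert operator" and \<alpha> \<beta> \<gamma> :: complex
  assumes "self_adjoint A" and "self_adjoint B"
    and "ops_commute A B"
    and "\<alpha> \<in> resolvent_set A" and "\<beta> \<in> resolvent_set B"
  shows "(strongly_commute A B \<longleftrightarrow>
           dom ((A -\<^sub>I \<alpha>) \<circ>\<^sub>m (B -\<^sub>I \<beta>)) = dom ((B -\<^sub>I \<beta>) \<circ>\<^sub>m (A -\<^sub>I \<alpha>))) \<and>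
         (strongly_commute A B \<longleftrightarrow>
           dom ((A -\<^sub>I \<alpha>) \<circ>\<^sub>m (B -\<^sub>I \<beta>)) \<subseteq> dom ((B -\<^sub>I \<beta>) \<circ>\<^sub>m (A -\<^sub>I \<alpha>))) \<and>
         (strongly_commute A B \<longleftrightarrow>
           dom (op_closure ((A -\<^sub>I \<gamma>) \<circ>\<^sub>m (B -\<^sub>I \<beta>))) = dom ((B -\<^sub>I \<beta>) \<circ>\<^sub>m (A -\<^sub>I \<gamma>))) \<and>
         (strongly_commute A B \<longleftrightarrow>
           dom ((A -\<^sub>I \<gamma>) \<circ>\<^sub>m (B -\<^sub>I \<beta>)) \<subseteq> dom ((B -\<^sub>I \<beta>) \<circ>\<^sub>m (A -\<^sub>I \<gamma>)))"
proof -
  define a where "a x = the (A x)" for x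
  define b where "b x = the (B x)" for x
  obtain C where C: "closure C = UNIV" "C \<subseteq> dom (A \<circ>\<^sub>m B) \<inter> dom (B \<circ>\<^sub>m A)"
    "\<And>x. x \<in> C \<Longrightarrow> (A \<circ>\<^sub>m B) x = (B \<circ>\<^sub>m A) x"
    using assms(3) by (auto simp: ops_commute_def)
  interpret A: selfadjoint "dom A" a
    unfolding a_def[abs_def] by (rule self_adjoint_selfadjoint[OF assms(1)])
  interpret B: selfadjoint "dom B" b
    unfolding b_def[abs_def] by (rule self_adjoint_selfadjoint[OF assms(2)])
  interpret commuting_selfadjoint "dom A" "dom B" a b C
  proof
    show "closure C = UNIV"
      by (rule C(1))
    fix y assume y: "y \<in> C"
    then have "y \<in> dom (A \<circ>\<^sub>m B)" "y \<in> dom (B \<circ>\<^sub>m A)" "(A \<circ>\<^sub>m B) y = (B \<circ>\<^sub>m A) y"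
      using C(2,3) by auto
    then show "y \<in> dom A \<and> y \<in> dom B \<and> b y \<in> dom A \<and> a y \<in> dom B \<and> a (b y) = b (a y)"
      by (auto simp: map_comp_def a_def b_def split: option.splits)
  qed
  obtain R where R: "A.is_resolvent \<alpha> R"
    using resolvent_set_resolvent[OF assms(1,4)] by (metis a_def ext)
  obtain S K where S: "B.is_resolvent \<beta> S" "\<And>y. norm (S y) \<le> K * norm y"
    using resolvent_set_resolvent[OF assms(2,5), folded b_def] by (metis b_def ext)
  have strong: "strongly_commute A B \<longleftrightarrow> A.commutes_op S"
    using strongly_commute_iff[OF assms(1,2), folded a_def b_def]
      commutes_op_cayley_iff_resolvent[OF S(1)] by simp
  have dom_AB: "dom ((A -\<^sub>I \<mu>) \<circ>\<^sub>m (B -\<^sub>I \<beta>)) = {x \<in> dom B. b x - \<beta> *\<^sub>C x \<in> dom A}" for \<mu>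
    by (simp add: dom_shift_product b_def)
  have dom_BA: "dom ((B -\<^sub>I \<beta>) \<circ>\<^sub>m (A -\<^sub>I \<mu>)) = {x \<in> dom A. a x - \<mu> *\<^sub>C x \<in> dom B}" for \<mu>
    by (simp add: dom_shift_product a_def)
  have subset: "strongly_commute A B \<longleftrightarrow>
      dom ((A -\<^sub>I \<mu>) \<circ>\<^sub>m (B -\<^sub>I \<beta>)) \<subseteq> dom ((B -\<^sub>I \<beta>) \<circ>\<^sub>m (A -\<^sub>I \<mu>))" for \<mu>
    unfolding strong dom_AB dom_BA product_domains_subset_iff[OF S(1)] ..
  have equal: "strongly_commute A B \<longleftrightarrow>
      dom ((A -\<^sub>I \<alpha>) \<circ>\<^sub>m (B -\<^sub>I \<beta>)) = dom ((B -\<^sub>I \<beta>) \<circ>\<^sub>m (A -\<^sub>I \<alpha>))"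
  proof
    assume "strongly_commute A B"
    then show "dom ((A -\<^sub>I \<alpha>) \<circ>\<^sub>m (B -\<^sub>I \<beta>)) = dom ((B -\<^sub>I \<beta>) \<circ>\<^sub>m (A -\<^sub>I \<alpha>))"
      unfolding strong dom_AB dom_BA by (rule product_domains_eq[OF R S(1)])
  next
    assume "dom ((A -\<^sub>I \<alpha>) \<circ>\<^sub>m (B -\<^sub>I \<beta>)) = dom ((B -\<^sub>I \<beta>) \<circ>\<^sub>m (A -\<^sub>I \<alpha>))"
    then show "strongly_commute A B"
      using subset[of \<alpha>] by simp
  qed
  let ?T = "(A -\<^sub>I \<gamma>) \<circ>\<^sub>m (B -\<^sub>I \<beta>)"
  have graph: "Map.graph ?T = product_graph \<gamma> \<beta>"
  proof -
    have "Map.graph ?T = (\<lambda>x. (x, the (?T x))) ` dom ?T"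
      by (rule graph_eq_to_snd_dom)
    also have "\<dots> = (\<lambda>x. (x, a (b x - \<beta> *\<^sub>C x) - \<gamma> *\<^sub>C (b x - \<beta> *\<^sub>C x))) `
        {x \<in> dom B. b x - \<beta> *\<^sub>C x \<in> dom A}"
      by (rule image_cong[OF dom_AB]) (simp add: the_shift_product[of _ B \<beta> A \<gamma>, folded a_def b_def])
    also have "\<dots> = product_graph \<gamma> \<beta>"
      by (auto simp: product_graph_def)
    finally show ?thesis .
  qed
  have "Map.graph (op_closure ?T) = closure (product_graph \<gamma> \<beta>)"
    using graph_op_closure[of ?T] product_closable unfolding graph by blast
  then have dom_closure: "dom (op_closure ?T) = Domain (closure (product_graph \<gamma> \<beta>))"
    by (metis fst_graph_eq_dom Domain_fst)
  have le: "dom ?T \<subseteq> dom (op_closure ?T)"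
  proof -
    have "dom ?T = Domain (product_graph \<gamma> \<beta>)"
      by (metis graph fst_graph_eq_dom Domain_fst)
    then show ?thesis
      unfolding dom_closure using closure_subset by blast
  qed
  have closure: "strongly_commute A B \<longleftrightarrow> dom (op_closure ?T) = dom ((B -\<^sub>I \<beta>) \<circ>\<^sub>m (A -\<^sub>I \<gamma>))"
  proof
    assume "strongly_commute A B"
    then have "A.commutes_op S"
      by (rule strong[THEN iffD1])
    from closure_product_domain[OF S this]
    show "dom (op_closure ?T) = dom ((B -\<^sub>I \<beta>) \<circ>\<^sub>m (A -\<^sub>I \<gamma>))"
      unfolding dom_closure dom_BA .
  next
    assume "dom (op_closure ?T) = dom ((B -\<^sub>I \<beta>) \<circ>\<^sub>m (A -\<^sub>I \<gamma>))"
    with le have "dom ?T \<subseteq> dom ((B -\<^sub>I \<beta>) \<circ>\<^sub>m (A -\<^sub>I \<gamma>))"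
      by (simp only:)
    then show "strongly_commute A B"
      by (rule subset[THEN iffD2])
  qed
  show ?thesis
    by (intro conjI equal subset closure)
qed

end
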